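(* Let $k$ be an algebraically closed field of characteristic not $2$, $P=k[x_1,\dots,x_n]$, $\mathbb A$ the affine space of $n$-tuples $\mathbf f=(f_1,\dots,f_n)$ of quadratic forms in $P$ (of dimension $n\binom{n+1}{2}$, coordinates the coefficients), and $\mathcal I=\{\mathbf f\in\mathbb A:\ f_1,\dots,f_n \text{ is a regular sequence and every nonzero element of the } k\text{-span of } f_1,\dots,f_n \text{ is irreducible in } P\}$. Then: (1) $\mathcal I$ is open in $\mathbb A$; (2) if $n\le4$, then $\mathcal I$ is empty; (3) if $n\ge5$, then $\mathcal I$ is nonempty. *)

theory Defs
  imports "HOL-Library.Poly_Mapping" "HOL-Library.Cardinality" "HOL-Computational_Algebra.Polynomial"
    "HOL-Computational_Algebra.Factorial_Ring"
begin

definition alg_closed :: "'k::field itself \<Rightarrow> bool" where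
  "alg_closed _ \<longleftrightarrow> (\<forall>p::'k poly. degree p \<ge> 1 \<longrightarrow> (\<exists>x. poly p x = 0))"

(* P = k[x_i : i \<in> 'n], with n = CARD('n): monomials are finitely supported exponent vectors *)
type_synonym ('n, 'k) mpoly = "('n \<Rightarrow>\<^sub>0 nat) \<Rightarrow>\<^sub>0 'k"

definition mon_deg :: "('n \<Rightarrow>\<^sub>0 nat) \<Rightarrow> nat" where
  "mon_deg m = (\<Sum>v\<in>Poly_Mapping.keys m. Poly_Mapping.lookup m v)"

(* quadratic form: homogeneous of degree 2 (the zero form included) *)
definition quad_form :: "('n, 'k::zero) mpoly \<Rightarrow> bool" where
  "quad_form f \<longleftrightarrow> (\<forall>m\<in>Poly_Mapping.keys f. mon_deg m = 2)"

definition const_mp :: "'k::zero \<Rightarrow> ('n, 'k) mpoly" where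
  "const_mp c = Poly_Mapping.single 0 c"

definition gen_ideal :: "(nat \<Rightarrow> ('n, 'k::comm_ring_1) mpoly) \<Rightarrow> nat \<Rightarrow> ('n, 'k) mpoly set" where
  "gen_ideal f i = {(\<Sum>j<i. a j * f j) | a. True}"

definition regular_seq :: "(nat \<Rightarrow> ('n, 'k::comm_ring_1) mpoly) \<Rightarrow> nat \<Rightarrow> bool" where
  "regular_seq f r \<longleftrightarrow>
     (\<forall>i<r. \<forall>g. f i * g \<in> gen_ideal f i \<longrightarrow> g \<in> gen_ideal f i) \<and> 1 \<notin> gen_ideal f r"

definition kspan :: "(nat \<Rightarrow> ('n, 'k::comm_ring_1) mpoly) \<Rightarrow> nat \<Rightarrow> ('n, 'k) mpoly set" where
  "kspan f r = {(\<Sum>j<r. const_mp (c j) * f j) | c. True}"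

(* the affine space A of n-tuples (f_0,...,f_{n-1}) of quadratic forms in n = CARD('n)
   variables; tuples are functions nat \<Rightarrow> P vanishing outside {0..<n} *)
definition quad_tuples :: "('n::finite, 'k::comm_ring_1) mpoly itself \<Rightarrow> (nat \<Rightarrow> ('n, 'k) mpoly) set" where
  "quad_tuples _ = {f. (\<forall>i<CARD('n). quad_form (f i)) \<and> (\<forall>i. CARD('n) \<le> i \<longrightarrow> f i = 0)}"

definition mp_eval :: "('v, 'k::comm_ring_1) mpoly \<Rightarrow> ('v \<Rightarrow> 'k) \<Rightarrow> 'k" where
  "mp_eval p x = (\<Sum>m\<in>Poly_Mapping.keys p. Poly_Mapping.lookup p m * (\<Prod>v\<in>Poly_Mapping.keys m. x v ^ Poly_Mapping.lookup m v))"

definition coords :: "(nat \<Rightarrow> ('n, 'k::zero) mpoly) \<Rightarrow> nat \<times> ('n \<Rightarrow>\<^sub>0 nat) \<Rightarrow> 'k" where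
  "coords f = (\<lambda>(i, m). Poly_Mapping.lookup (f i) m)"

definition zariski_closed_A :: "(nat \<Rightarrow> ('n::finite, 'k::comm_ring_1) mpoly) set \<Rightarrow> bool" where
  "zariski_closed_A S \<longleftrightarrow>
     (\<exists>F :: (nat \<times> ('n \<Rightarrow>\<^sub>0 nat), 'k) mpoly set.
        S = {f \<in> quad_tuples TYPE(('n, 'k) mpoly). \<forall>p\<in>F. mp_eval p (coords f) = 0})"

definition zariski_open_A :: "(nat \<Rightarrow> ('n::finite, 'k::comm_ring_1) mpoly) set \<Rightarrow> bool" where
  "zariski_open_A U \<longleftrightarrow> U \<subseteq> quad_tuples TYPE(('n, 'k) mpoly) \<and>
     zariski_closed_A (quad_tuples TYPE(('n, 'k) mpoly) - U)"

definition I_set :: "('n::finite, 'k::comm_ring_1) mpoly itself \<Rightarrow> (nat \<Rightarrow> ('n, 'k) mpoly) set" where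
  "I_set T = {f \<in> quad_tuples T. regular_seq f CARD('n) \<and>
      (\<forall>g\<in>kspan f CARD('n). g \<noteq> 0 \<longrightarrow> irreducible g)}"

end

(*
  Regularity: a tuple f of n quadrics in n variables is regular iff P is free over k[f_1, ..., f_n]
  on homogeneous elements whose degrees are those of the squarefree monomials. Both directions are a
  count of dimensions, degree by degree, since every monomial is uniquely a squarefree monomial
  times a square. That given elements span needs to be tested in finitely many degrees only, and is
  an open condition.

  Irreducibility: the span of an independent tuple is cut out by linear functionals depending
  polynomially on the tuple. They restrict to bilinear forms on pairs (x, y) of linear forms, so
  openness is an instance of elimination theory on the Segre variety, which rests on a homogeneous
  Nullstellensatz. For n <= 4 there are at most 2 n - 2 functionals, too few to have no common zero
  on the Segre variety of dimension 2 n - 2.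

  For n >= 5 the tuple of squares of variables is regular, and n independent quadrics through the
  rational normal curve have no product of linear forms in their span; on the line joining these
  two tuples some point satisfies both open conditions.
*)

theory Submission
  imports Defs
begin

section \<open>Polynomials, evaluation and degrees\<close>

text \<open>Openness is proved pointwise: at each f in \<open>I_set\<close> a polynomial function G
  with G f \<noteq> 0 is built such that G g \<noteq> 0 forces g into \<open>I_set\<close>. The
  obstacle is that regularity quantifies over all polynomials of all degrees. A complement B d of
  the degree d part of the ideal, chosen at f, is kept fixed while g varies. Its size is the
  coefficient of t^d in (1 + t)^n, which is 0 for d = n + 1, so rank conditions up to degree n + 1
  are enough. They give regularity back through the identity 1/(1 - t)^n = (1 + t)^n / (1 - t^2)^n,
  read as a count of monomials. Where rank enters, minors are avoided: elimination without division
  yields polynomial functions directly. The bound 4 comes from n(n + 1)/2 - n \<le> 2n - 2, that is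
  (n - 1)(n - 4) \<le> 0. Dimension theory of the Segre variety is replaced by a comparison of
  growth rates of graded pieces.\<close>

type_synonym 'v expo = "'v \<Rightarrow>\<^sub>0 nat"

abbreviation lookup where "lookup \<equiv> Poly_Mapping.lookup"
abbreviation keys where "keys \<equiv> Poly_Mapping.keys"
abbreviation single where "single \<equiv> Poly_Mapping.single"
abbreviation mon :: "'v expo \<Rightarrow> ('v, 'k::comm_ring_1) mpoly" where "mon m \<equiv> single m 1"
abbreviation var :: "'v \<Rightarrow> ('v, 'k::comm_ring_1) mpoly" where "var v \<equiv> mon (single v (Suc 0))"

lemma sum_single_lookup: "(\<Sum>m\<in>keys p. single m (lookup p m)) = p"
proof (rule poly_mapping_eqI)
  fix m
  have "lookup (\<Sum>m\<in>keys p. single m (lookup p m)) m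
      = (\<Sum>k\<in>keys p. if k = m then lookup p k else 0)"
    unfolding lookup_sum by (rule sum.cong) (auto simp: lookup_single when_def)
  also have "\<dots> = lookup p m"
    by (simp add: in_keys_iff)
  finally show "lookup (\<Sum>m\<in>keys p. single m (lookup p m)) m = lookup p m" .
qed

lemma mpoly_induct [case_names single add]:
  fixes p :: "'a \<Rightarrow>\<^sub>0 'b::comm_monoid_add"
  assumes "\<And>m c. P (single m c)" and "\<And>p q. P p \<Longrightarrow> P q \<Longrightarrow> P (p + q)"
  shows "P p"
proof -
  have "P (\<Sum>m\<in>S. single m (lookup p m))" if "finite S" for S
    using that
  proof induction
    case empty
    show ?case using assms(1)[of undefined 0] by simp
  next
    case (insert m S)
    then show ?case using assms by simp
  qed
  from this[of "keys p"] show ?thesis by (simp add: sum_single_lookup)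
qed

lemma const_mp_0 [simp]: "const_mp 0 = 0"
  and const_mp_1 [simp]: "const_mp 1 = 1"
  by (simp_all add: const_mp_def)

lemma const_mp_add: "const_mp (a + b) = const_mp a + const_mp b"
  by (simp add: const_mp_def single_add)

lemma const_mp_mult: "const_mp (a * b) = const_mp a * const_mp b"
  by (simp add: const_mp_def mult_single)

lemma const_mp_uminus: "const_mp (- a) = - const_mp a"
  by (simp add: const_mp_def single_uminus)

lemma lookup_const_mult [simp]: "lookup (const_mp c * p) m = c * lookup p m"
  by (induction p rule: mpoly_induct)
    (simp_all add: const_mp_def mult_single lookup_single algebra_simps lookup_add mult_when)

lemma single_conv_const_mon: "single m c = const_mp c * mon m"
  by (simp add: const_mp_def mult_single)

lemma mon_add: "mon (m + m') = mon m * mon m'"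
  by (simp add: mult_single)

lemma mpoly_conv_mon:
  fixes p :: "('v, 'k::comm_ring_1) mpoly"
  assumes "finite S" "keys p \<subseteq> S"
  shows "p = (\<Sum>m\<in>S. const_mp (lookup p m) * mon m)"
proof -
  have "(\<Sum>m\<in>keys p. const_mp (lookup p m) * mon m) = (\<Sum>m\<in>S. const_mp (lookup p m) * mon m)"
    by (rule sum.mono_neutral_left) (use assms in \<open>auto simp: in_keys_iff\<close>)
  with sum_single_lookup[of p] show ?thesis by (simp add: single_conv_const_mon[symmetric])
qed

interpretation mp: vector_space "\<lambda>c (p :: ('v, 'k::field) mpoly). const_mp c * p"
  by unfold_locales (simp_all add: algebra_simps const_mp_add const_mp_mult)

interpretation up: vector_space "smult :: 'k::field \<Rightarrow> _"
  by unfold_locales (simp_all add: smult_add_right smult_add_left)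

definition ring_map :: "('a::comm_ring_1 \<Rightarrow> 'b::comm_ring_1) \<Rightarrow> bool" where
  "ring_map \<kappa> \<longleftrightarrow> \<kappa> 1 = 1 \<and> (\<forall>a b. \<kappa> (a + b) = \<kappa> a + \<kappa> b) \<and> (\<forall>a b. \<kappa> (a * b) = \<kappa> a * \<kappa> b)"

lemma ring_mapD:
  assumes "ring_map \<kappa>"
  shows "\<kappa> 1 = 1" "\<kappa> (a + b) = \<kappa> a + \<kappa> b" "\<kappa> (a * b) = \<kappa> a * \<kappa> b" "\<kappa> 0 = 0"
    "\<kappa> (- a) = - \<kappa> a" "\<kappa> (a - b) = \<kappa> a - \<kappa> b"
proof -
  show add: "\<kappa> 1 = 1" "\<kappa> (a + b) = \<kappa> a + \<kappa> b" "\<kappa> (a * b) = \<kappa> a * \<kappa> b" for a b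
    using assms by (auto simp: ring_map_def)
  show 0: "\<kappa> 0 = 0"
    using add(2)[of 0 0] by simp
  show neg: "\<kappa> (- a) = - \<kappa> a" for a
    using add(2)[of "- a" a] by (simp add: 0 eq_neg_iff_add_eq_0)
  show "\<kappa> (a - b) = \<kappa> a - \<kappa> b"
    using add(2)[of a "- b"] by (simp add: neg)
qed

lemma ring_map_sum:
  assumes "ring_map \<kappa>"
  shows "\<kappa> (\<Sum>i\<in>A. f i) = (\<Sum>i\<in>A. \<kappa> (f i))"
  by (induction A rule: infinite_finite_induct) (simp_all add: ring_mapD[OF assms])

lemma ring_map_prod:
  assumes "ring_map \<kappa>"
  shows "\<kappa> (\<Prod>i\<in>A. f i) = (\<Prod>i\<in>A. \<kappa> (f i))"
  by (induction A rule: infinite_finite_induct) (simp_all add: ring_mapD[OF assms])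

lemma ring_map_power:
  assumes "ring_map \<kappa>"
  shows "\<kappa> (a ^ i) = \<kappa> a ^ i"
  by (induction i) (simp_all add: ring_mapD[OF assms])

lemma ring_map_id: "ring_map (\<lambda>c. c)"
  by (simp add: ring_map_def)

lemma ring_map_const_mp: "ring_map const_mp"
  by (simp add: ring_map_def const_mp_add const_mp_mult)

lemma ring_map_pCons: "ring_map (\<lambda>c. [:c:])"
  by (simp add: ring_map_def one_pCons)

lemma ring_map_poly: "ring_map (\<lambda>p. poly p c)"
  by (simp add: ring_map_def)

definition mon_ev :: "('v \<Rightarrow> 'r::comm_ring_1) \<Rightarrow> 'v expo \<Rightarrow> 'r" where
  "mon_ev x m = (\<Prod>v\<in>keys m. x v ^ lookup m v)"

text \<open>The coefficient map \<kappa> lets one notion cover evaluation in the field, substitution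
  of univariate polynomials along \<open>[:c:]\<close>, and renaming of variables along
  \<open>const_mp\<close>.\<close>

definition ev :: "('k::comm_ring_1 \<Rightarrow> 'r::comm_ring_1) \<Rightarrow> ('v \<Rightarrow> 'r) \<Rightarrow> ('v, 'k) mpoly \<Rightarrow> 'r" where
  "ev \<kappa> x p = (\<Sum>m\<in>keys p. \<kappa> (lookup p m) * mon_ev x m)"

lemma mp_eval_conv_ev: "mp_eval p x = ev (\<lambda>c. c) x p"
  by (simp add: mp_eval_def ev_def mon_ev_def)

lemma mon_ev_superset:
  assumes "finite S" "keys m \<subseteq> S"
  shows "mon_ev x m = (\<Prod>v\<in>S. x v ^ lookup m v)"
  unfolding mon_ev_def
  by (rule prod.mono_neutral_left) (use assms in \<open>auto simp: in_keys_iff\<close>)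

lemma mon_ev_0 [simp]: "mon_ev x 0 = 1"
  by (simp add: mon_ev_def)

lemma mon_ev_add: "mon_ev x (m + m') = mon_ev x m * mon_ev x m'"
proof -
  let ?S = "keys m \<union> keys m'"
  have "keys (m + m') \<subseteq> ?S" by (rule Poly_Mapping.keys_add)
  then show ?thesis
    by (simp add: mon_ev_superset[of ?S] lookup_add power_add prod.distrib)
qed

lemma mon_ev_single [simp]: "mon_ev x (single v i) = x v ^ i"
  by (simp add: mon_ev_superset[of "{v}"])

context
  fixes \<kappa> :: "'k::comm_ring_1 \<Rightarrow> 'r::comm_ring_1"
  assumes \<kappa>: "ring_map \<kappa>"
begin

lemma ev_superset:
  assumes "finite S" "keys p \<subseteq> S"
  shows "ev \<kappa> x p = (\<Sum>m\<in>S. \<kappa> (lookup p m) * mon_ev x m)"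
  unfolding ev_def
  by (rule sum.mono_neutral_left) (use assms in \<open>auto simp: in_keys_iff ring_mapD[OF \<kappa>]\<close>)

lemma ev_single: "ev \<kappa> x (single m c) = \<kappa> c * mon_ev x m"
  by (simp add: ev_superset[of "{m}"])

lemma ev_add: "ev \<kappa> x (p + q) = ev \<kappa> x p + ev \<kappa> x q"
proof -
  let ?S = "keys p \<union> keys q"
  have "keys (p + q) \<subseteq> ?S" by (rule Poly_Mapping.keys_add)
  then show ?thesis
    by (simp add: ev_superset[of ?S] lookup_add ring_mapD[OF \<kappa>] algebra_simps sum.distrib)
qed

lemma ev_mult: "ev \<kappa> x (p * q) = ev \<kappa> x p * ev \<kappa> x q"
proof (induction p rule: mpoly_induct)
  case (single m c)
  show ?case
    by (induction q rule: mpoly_induct)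
      (simp_all add: mult_single ev_single ring_mapD[OF \<kappa>] mon_ev_add ev_add algebra_simps)
next
  case (add p q)
  then show ?case by (simp add: algebra_simps ev_add)
qed

lemma ring_map_ev: "ring_map (ev \<kappa> x)"
  unfolding ring_map_def
  using ev_single[of x 0 1] by (simp add: ev_add ev_mult ring_mapD[OF \<kappa>])

lemma ev_const: "ev \<kappa> x (const_mp c) = \<kappa> c"
  by (simp add: const_mp_def ev_single)

lemma ev_var: "ev \<kappa> x (var v) = x v"
  by (simp add: ev_single ring_mapD[OF \<kappa>])

end

lemma ring_map_comp_ev:
  assumes "ring_map \<kappa>" "ring_map \<phi>"
  shows "\<phi> (ev \<kappa> x p) = ev (\<lambda>c. \<phi> (\<kappa> c)) (\<lambda>v. \<phi> (x v)) p"
  by (simp add: ev_def mon_ev_def ring_map_sum[OF assms(2)] ring_map_prod[OF assms(2)]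
      ring_map_power[OF assms(2)] ring_mapD[OF assms(2)])

lemma ring_map_mp_eval: "ring_map (\<lambda>p. mp_eval p x)"
  using ring_map_ev[OF ring_map_id, of x] by (simp add: mp_eval_conv_ev[abs_def])

lemmas mp_eval_simps = ring_mapD[OF ring_map_mp_eval]
lemmas mp_eval_sum = ring_map_sum[OF ring_map_mp_eval]

lemma mp_eval_single: "mp_eval (single m c) x = c * mon_ev x m"
  by (simp add: mp_eval_conv_ev ev_single[OF ring_map_id])

lemma mp_eval_const [simp]: "mp_eval (const_mp c) x = c"
  by (simp add: mp_eval_conv_ev ev_const[OF ring_map_id])

lemma mp_eval_var [simp]: "mp_eval (var v) x = x v"
  by (simp add: mp_eval_single)

lemma mp_eval_mon [simp]: "mp_eval (mon m) x = mon_ev x m"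
  by (simp add: mp_eval_single)

text \<open>Used to turn statements about a line, or about a point with one coordinate left free,
  into statements about roots of univariate polynomials.\<close>

lemma poly_ev_conv_mp_eval: "poly (ev (\<lambda>c. [:c:]) x p) c = mp_eval p (\<lambda>v. poly (x v) c)"
  by (subst ring_map_comp_ev[OF ring_map_pCons ring_map_poly]) (simp add: mp_eval_conv_ev)

section \<open>Total degree, forms and homogeneous components\<close>

lemma mon_deg_superset:
  assumes "finite S" "keys m \<subseteq> S"
  shows "mon_deg m = (\<Sum>v\<in>S. lookup m v)"
  unfolding mon_deg_def
  by (rule sum.mono_neutral_left) (use assms in \<open>auto simp: in_keys_iff\<close>)

lemma mon_deg_0 [simp]: "mon_deg 0 = 0"
  by (simp add: mon_deg_def)

lemma mon_deg_single [simp]: "mon_deg (single v i) = i"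
  by (simp add: mon_deg_superset[of "{v}"])

lemma mon_deg_add [simp]: "mon_deg (m + m') = mon_deg m + mon_deg m'"
proof -
  let ?S = "keys m \<union> keys m'"
  have "keys (m + m') \<subseteq> ?S" by (rule Poly_Mapping.keys_add)
  then show ?thesis
    by (simp add: mon_deg_superset[of ?S] lookup_add sum.distrib)
qed

lemma mon_deg_eq_0_iff [simp]: "mon_deg m = 0 \<longleftrightarrow> m = 0"
  by (auto simp: mon_deg_def in_keys_iff intro!: poly_mapping_eqI)

lemma lookup_le_mon_deg: "lookup m v \<le> mon_deg m"
  by (cases "v \<in> keys m") (auto simp: mon_deg_def in_keys_iff intro: member_le_sum)

lemma finite_mon_deg_le: "finite {m :: 'v::finite \<Rightarrow>\<^sub>0 nat. mon_deg m \<le> d}"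
proof (rule inj_on_finite)
  show "inj_on lookup {m :: 'v expo. mon_deg m \<le> d}"
    by (auto simp: inj_on_def lookup_inject)
  show "lookup ` {m :: 'v expo. mon_deg m \<le> d}
      \<subseteq> {f. \<forall>v. (v \<in> UNIV \<longrightarrow> f v \<in> {..d}) \<and> (v \<notin> UNIV \<longrightarrow> f v = 0)}"
    using lookup_le_mon_deg order_trans by fastforce
  show "finite {f. \<forall>v :: 'v. (v \<in> UNIV \<longrightarrow> f v \<in> {..d}) \<and> (v \<notin> UNIV \<longrightarrow> f v = 0)}"
    by (rule finite_set_of_finite_funs) auto
qed

definition mons :: "nat \<Rightarrow> 'v expo set" where
  "mons d = {m. mon_deg m = d}"

lemma finite_mons [simp]: "finite (mons d :: ('v::finite \<Rightarrow>\<^sub>0 nat) set)"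
  by (rule finite_subset[OF _ finite_mon_deg_le[of d]]) (auto simp: mons_def)

lemma mon_split_var:
  fixes m :: "'v expo"
  assumes "i \<le> lookup m v"
  obtains m' where "m = m' + single v i"
proof
  show "m = (m - single v i) + single v i"
    by (rule poly_mapping_eqI) (use assms in \<open>auto simp: lookup_add lookup_minus lookup_single when_def\<close>)
qed

lemma mon_split:
  fixes m :: "'v::finite \<Rightarrow>\<^sub>0 nat"
  assumes "e \<le> mon_deg m"
  obtains m' m'' where "m = m' + m''" "mon_deg m' = e"
  using assms
proof (induction e arbitrary: thesis)
  case 0
  then show ?case by (metis add_0 mon_deg_0)
next
  case (Suc e)
  obtain m' m'' where m: "m = m' + m''" "mon_deg m' = e"
    using Suc.IH Suc.prems(2) by (metis Suc_leD)
  then have "mon_deg m'' \<noteq> 0"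
    using Suc.prems(2) by auto
  then obtain v where "v \<in> keys m''"
    by (metis keys_eq_empty mon_deg_eq_0_iff equals0I)
  then have "1 \<le> lookup m'' v"
    by (simp add: in_keys_iff Suc_leI)
  then obtain m3 where "m'' = m3 + single v 1"
    by (rule mon_split_var)
  then show ?case
    using m by (intro Suc.prems(1)[of "m' + single v 1" m3]) (simp_all add: algebra_simps)
qed

definition homog :: "nat \<Rightarrow> ('v, 'k::comm_ring_1) mpoly \<Rightarrow> bool" where
  "homog d p \<longleftrightarrow> keys p \<subseteq> mons d"

lemma quad_form_iff_homog: "quad_form p \<longleftrightarrow> homog 2 p"
  by (auto simp: quad_form_def homog_def mons_def)

lemma homog_0 [simp]: "homog d 0"
  by (simp add: homog_def)

lemma homog_single: "homog (mon_deg m) (single m c)"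
  by (simp add: homog_def mons_def)

lemma homog_mon: "mon_deg m = d \<Longrightarrow> homog d (mon m)"
  using homog_single by blast

lemma homog_const [simp]: "homog 0 (const_mp c)"
  by (simp add: homog_def mons_def const_mp_def)

lemma homog_add: "homog d p \<Longrightarrow> homog d q \<Longrightarrow> homog d (p + q)"
  using Poly_Mapping.keys_add[of p q] by (auto simp: homog_def)

lemma homog_sum: "(\<And>i. i \<in> A \<Longrightarrow> homog d (f i)) \<Longrightarrow> homog d (\<Sum>i\<in>A. f i)"
  by (induction A rule: infinite_finite_induct) (auto intro: homog_add)

lemma homog_mult:
  assumes "homog d p" "homog e q"
  shows "homog (d + e) (p * q)"
  using Poly_Mapping.keys_mult[of p q] assms by (fastforce simp: homog_def mons_def)

lemma homog_const_mult: "homog d p \<Longrightarrow> homog d (const_mp c * p)"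
  using homog_mult[of 0 "const_mp c" d p] by simp

lemma homog_uminus: "homog d p \<Longrightarrow> homog d (- p)"
  by (simp add: homog_def keys.rep_eq)

lemma homog_diff: "homog d p \<Longrightarrow> homog d q \<Longrightarrow> homog d (p - q)"
  using homog_add[OF _ homog_uminus, of d p q] by simp

lemma homog_in_span_mons:
  fixes p :: "('v::finite, 'k::field) mpoly"
  assumes "homog d p"
  shows "p \<in> mp.span (mon ` mons d)"
proof -
  have "p = (\<Sum>m\<in>mons d. const_mp (lookup p m) * mon m)"
    using assms by (intro mpoly_conv_mon) (auto simp: homog_def)
  also have "\<dots> \<in> mp.span (mon ` mons d)"
    by (intro mp.span_sum mp.span_scale mp.span_base imageI)
  finally show ?thesis .
qed

definition hcomp :: "nat \<Rightarrow> ('v, 'k::comm_ring_1) mpoly \<Rightarrow> ('v, 'k) mpoly" where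
  "hcomp d p = Poly_Mapping.mapp (\<lambda>m c. c when mon_deg m = d) p"

lemma lookup_hcomp: "lookup (hcomp d p) m = (lookup p m when mon_deg m = d)"
  by (auto simp: hcomp_def lookup_mapp when_def in_keys_iff)

lemma homog_hcomp [simp]: "homog d (hcomp d p)"
  by (auto simp: homog_def mons_def in_keys_iff lookup_hcomp when_def split: if_splits)

lemma hcomp_0 [simp]: "hcomp d 0 = 0"
  by (rule poly_mapping_eqI) (simp add: lookup_hcomp)

lemma hcomp_add: "hcomp d (p + q) = hcomp d p + hcomp d q"
  by (rule poly_mapping_eqI) (simp add: lookup_hcomp lookup_add when_add_distrib)

lemma hcomp_sum: "hcomp d (\<Sum>i\<in>A. f i) = (\<Sum>i\<in>A. hcomp d (f i))"
  by (induction A rule: infinite_finite_induct) (simp_all add: hcomp_add)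

lemma hcomp_homog: "homog e p \<Longrightarrow> hcomp d p = (if d = e then p else 0)"
  by (rule poly_mapping_eqI)
    (auto simp: homog_def mons_def lookup_hcomp when_def in_keys_iff)

lemma hcomp_mult_homog:
  assumes "homog e q"
  shows "hcomp d (p * q) = (if e \<le> d then hcomp (d - e) p * q else 0)"
proof (induction p rule: mpoly_induct)
  case (single m c)
  have "homog (mon_deg m + e) (single m c * q)"
    by (intro homog_mult homog_single assms)
  then show ?case
    using homog_single[of m c] by (auto simp: hcomp_homog)
next
  case (add p q)
  then show ?case by (simp add: algebra_simps hcomp_add)
qed

lemma hcomp_const_mult: "hcomp d (const_mp c * p) = const_mp c * hcomp d p"
  by (rule poly_mapping_eqI) (simp add: lookup_hcomp mult_when)

lemma sum_hcomp:
  assumes "\<And>m. m \<in> keys p \<Longrightarrow> mon_deg m \<le> D"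
  shows "(\<Sum>d\<le>D. hcomp d p) = p"
proof (rule poly_mapping_eqI)
  fix m
  show "lookup (\<Sum>d\<le>D. hcomp d p) m = lookup p m"
    using assms[of m] by (auto simp: lookup_sum lookup_hcomp when_def in_keys_iff)
qed

lemma ex_mon_deg_bound: "\<exists>D. \<forall>m\<in>keys p. mon_deg m \<le> D"
  by (rule exI[of _ "Max (mon_deg ` keys p)"]) simp

lemma mp_eval_eq_0_at_0:
  assumes "homog d p" "d > 0"
  shows "mp_eval p (\<lambda>_. 0) = 0"
proof -
  have "mon_ev (\<lambda>_. 0) m = (0 :: 'b)" if "m \<in> keys p" for m
  proof -
    have "m \<noteq> 0" using that assms by (auto simp: homog_def mons_def)
    then obtain v where "v \<in> keys m"
      by (metis keys_eq_empty equals0I)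
    then show ?thesis
      unfolding mon_ev_def by (intro prod_zero) (auto simp: in_keys_iff zero_power)
  qed
  then show ?thesis by (simp add: mp_eval_conv_ev ev_def)
qed

text \<open>The instance \<open>idom\<close> for polynomial mappings needs linearly ordered indices, which are
  obtained here by renaming the variables.\<close>

lemma mpoly_mult_eq_0_iff:
  fixes p q :: "('v::finite, 'k::field) mpoly"
  shows "p * q = 0 \<longleftrightarrow> p = 0 \<or> q = 0"
proof -
  obtain idx :: "'v \<Rightarrow> nat" where idx: "inj idx"
    using finite_imp_inj_to_nat_seg by (metis finite_code)
  define \<kappa> :: "'k \<Rightarrow> (nat, 'k) mpoly" where "\<kappa> = const_mp"
  define x :: "'v \<Rightarrow> (nat, 'k) mpoly" where "x v = var (idx v)" for v
  \<comment> \<open>Exponent vectors after renaming. As \<open>re\<close> is injective, the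
    coefficients of p can be read off from the renamed polynomial, so nothing nonzero is sent to
    0.\<close>
  define re :: "'v expo \<Rightarrow> (nat \<Rightarrow>\<^sub>0 nat)"
    where "re m = (\<Sum>v\<in>UNIV. single (idx v) (lookup m v))" for m
  have \<kappa>: "ring_map \<kappa>" by (simp add: \<kappa>_def ring_map_const_mp)
  have mon_power: "mon a ^ i = (mon (of_nat i * a) :: (nat, 'k) mpoly)" for a i
    by (induction i) (simp_all add: mult_single algebra_simps)
  have of_nat_single1: "of_nat i * single j (Suc 0) = (single j i :: nat \<Rightarrow>\<^sub>0 nat)" for i j
    by (induction i) (simp_all add: single_add[symmetric] algebra_simps)
  have mon_sum: "(\<Prod>v\<in>S. mon (a v)) = (mon (\<Sum>v\<in>S. a v) :: (nat, 'k) mpoly)" for S :: "'v set" and a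
    by (induction S rule: infinite_finite_induct) (simp_all add: mult_single)
  have mon_ev_x: "mon_ev x m = mon (re m)" for m
    by (simp add: mon_ev_superset[of UNIV] x_def mon_power of_nat_single1 mon_sum re_def)
  have "lookup (re m) (idx v) = lookup m v" for m v
    using idx by (auto simp: re_def lookup_sum lookup_single when_def inj_eq if_distrib cong: if_cong)
  then have "inj re"
    by (metis injI poly_mapping_eqI)
  have "lookup (ev \<kappa> x p) (re m) = lookup p m" for p m
  proof -
    have "lookup (ev \<kappa> x p) (re m) = (\<Sum>m'\<in>keys p. lookup p m' when m' = m)"
      unfolding ev_def lookup_sum
      by (rule sum.cong) (use \<open>inj re\<close> in \<open>auto simp: \<kappa>_def mon_ev_x lookup_single when_def inj_eq\<close>)
    also have "\<dots> = lookup p m"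
      by (simp add: when_def in_keys_iff)
    finally show ?thesis .
  qed
  then have nz: "ev \<kappa> x p = 0 \<Longrightarrow> p = 0" for p
    by (metis lookup_zero poly_mapping_eqI)
  show ?thesis
  proof
    assume "p * q = 0"
    then have "ev \<kappa> x p * ev \<kappa> x q = 0"
      by (metis ev_mult[OF \<kappa>] ring_mapD(4)[OF ring_map_ev[OF \<kappa>]])
    then show "p = 0 \<or> q = 0"
      using nz by auto
  qed auto
qed

section \<open>Independent families and polynomial conditions on tuples\<close>

text \<open>Families instead of sets: a repeated vector counts as a dependence, so cardinalities of
  index sets can be compared directly. The scalar action is a parameter because multivariate and
  univariate polynomials both occur.\<close>

definition indep_family ::
  "('a::zero \<Rightarrow> 'b \<Rightarrow> 'b::comm_monoid_add) \<Rightarrow> 'i set \<Rightarrow> ('i \<Rightarrow> 'b) \<Rightarrow> bool" where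
  "indep_family s I v \<longleftrightarrow> (\<forall>c. (\<Sum>i\<in>I. s (c i) (v i)) = 0 \<longrightarrow> (\<forall>i\<in>I. c i = 0))"

lemma indep_familyD:
  "indep_family s I v \<Longrightarrow> (\<Sum>i\<in>I. s (c i) (v i)) = 0 \<Longrightarrow> i \<in> I \<Longrightarrow> c i = 0"
  by (auto simp: indep_family_def)

context vector_space
begin

lemma indep_family_imp_inj_on:
  assumes "finite I" "indep_family scale I v"
  shows "inj_on v I"
proof (rule inj_onI, rule ccontr)
  fix i j assume ij: "i \<in> I" "j \<in> I" "v i = v j" "i \<noteq> j"
  define c where "c k = (if k = i then 1 else if k = j then - 1 else 0 :: 'a)" for k
  have "(\<Sum>k\<in>I. scale (c k) (v k)) = (\<Sum>k\<in>{i, j}. scale (c k) (v k))"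
    by (rule sum.mono_neutral_right) (use assms(1) ij in \<open>auto simp: c_def\<close>)
  also have "\<dots> = 0"
    using ij by (simp add: c_def)
  finally have "c i = 0"
    using indep_familyD[OF assms(2)] ij(1) by blast
  then show False by (simp add: c_def)
qed

lemma indep_family_imp_independent:
  assumes "finite I" "indep_family scale I v"
  shows "independent (v ` I)"
proof (rule independent_if_scalars_zero)
  fix c x assume *: "(\<Sum>x\<in>v ` I. scale (c x) x) = 0" "x \<in> v ` I"
  have "(\<Sum>i\<in>I. scale (c (v i)) (v i)) = 0"
    using *(1) sum.reindex[OF indep_family_imp_inj_on[OF assms], of "\<lambda>x. scale (c x) x"]
    by simp
  with *(2) show "c x = 0"
    using indep_familyD[OF assms(2), of "\<lambda>i. c (v i)"] by blast
qed (use assms in auto)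

lemma card_indep_family_le:
  assumes "finite I" "indep_family scale I v" "v ` I \<subseteq> span S" "finite S"
  shows "card I \<le> card S"
  using independent_span_bound[OF assms(4) indep_family_imp_independent[OF assms(1,2)] assms(3)]
    card_image[OF indep_family_imp_inj_on[OF assms(1,2)]]
  by simp

text \<open>A dependent family v could lose a member without changing its span, leaving fewer than
  \<open>card J\<close> vectors to span the independent family w.\<close>

lemma indep_family_if_card_le:
  assumes I: "finite I" and J: "finite J" "indep_family scale J w" and sub: "w ` J \<subseteq> span (v ` I)"
    and card: "card I \<le> card J"
  shows "indep_family scale I v"
proof (rule ccontr)
  assume "\<not> indep_family scale I v"
  then obtain c i where c: "(\<Sum>i\<in>I. scale (c i) (v i)) = 0" "i \<in> I" "c i \<noteq> 0"
    by (auto simp: indep_family_def)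
  have "scale (c i) (v i) = - (\<Sum>j\<in>I - {i}. scale (c j) (v j))"
    using c(1) sum.remove[OF I c(2), of "\<lambda>i. scale (c i) (v i)"] by (simp add: eq_neg_iff_add_eq_0)
  also have "\<dots> \<in> span (v ` (I - {i}))"
    by (intro span_neg span_sum span_scale span_base) auto
  finally have "scale (inverse (c i)) (scale (c i) (v i)) \<in> span (v ` (I - {i}))"
    by (rule span_scale)
  then have "v i \<in> span (v ` (I - {i}))"
    using c(3) by simp
  moreover have "v ` I = insert (v i) (v ` (I - {i}))"
    using c(2) by auto
  ultimately have "w ` J \<subseteq> span (v ` (I - {i}))"
    using sub span_redundant by metis
  then have "card J \<le> card (v ` (I - {i}))"
    using I by (intro card_indep_family_le[OF J]) auto
  also have "\<dots> \<le> card (I - {i})"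
    using I by (intro card_image_le) auto
  also have "\<dots> < card I"
    using I c(2) by (rule card_Diff1_less)
  finally show False using card by simp
qed

end

abbreviation indep_mp :: "'i set \<Rightarrow> ('i \<Rightarrow> ('v, 'k::comm_ring_1) mpoly) \<Rightarrow> bool" where
  "indep_mp \<equiv> indep_family (\<lambda>c. (*) (const_mp c))"

lemma indep_family_mon:
  "indep_mp M (mon :: 'v expo \<Rightarrow> ('v, 'k::field) mpoly)" if "finite M"
  unfolding indep_family_def
proof (intro allI impI ballI)
  fix c :: "'v expo \<Rightarrow> 'k" and m
  assume *: "(\<Sum>i\<in>M. const_mp (c i) * mon i) = 0" "m \<in> M"
  have "c m = (\<Sum>i\<in>M. if i = m then c i else 0)"
    using that *(2) by simp
  also have "\<dots> = lookup (\<Sum>i\<in>M. const_mp (c i) * mon i) m"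
    unfolding lookup_sum by (rule sum.cong) (auto simp: lookup_single when_def)
  finally show "c m = 0" using *(1) by simp
qed

definition polyfun :: "((nat \<Rightarrow> ('n, 'k::comm_ring_1) mpoly) \<Rightarrow> 'k) \<Rightarrow> bool" where
  "polyfun G \<longleftrightarrow> (\<exists>p. \<forall>f. G f = mp_eval p (coords f))"

lemma polyfunE:
  assumes "polyfun G" obtains p where "\<And>f. G f = mp_eval p (coords f)"
  using assms by (auto simp: polyfun_def)

lemma polyfun_const [simp, intro]: "polyfun (\<lambda>f. c)"
  unfolding polyfun_def by (rule exI[of _ "const_mp c"]) simp

lemma polyfun_lookup [simp, intro]: "polyfun (\<lambda>f. lookup (f i) m)"
  unfolding polyfun_def by (rule exI[of _ "var (i, m)"]) (simp add: coords_def)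

lemma polyfun_add [intro]: "polyfun G \<Longrightarrow> polyfun H \<Longrightarrow> polyfun (\<lambda>f. G f + H f)"
  by (elim polyfunE, unfold polyfun_def) (metis mp_eval_simps(2))

lemma polyfun_diff [intro]: "polyfun G \<Longrightarrow> polyfun H \<Longrightarrow> polyfun (\<lambda>f. G f - H f)"
  by (elim polyfunE, unfold polyfun_def) (metis mp_eval_simps(6))

lemma polyfun_mult [intro]: "polyfun G \<Longrightarrow> polyfun H \<Longrightarrow> polyfun (\<lambda>f. G f * H f)"
  by (elim polyfunE, unfold polyfun_def) (metis mp_eval_simps(3))

lemma polyfun_sum [intro]: "(\<And>i. i \<in> A \<Longrightarrow> polyfun (G i)) \<Longrightarrow> polyfun (\<lambda>f. \<Sum>i\<in>A. G i f)"
  by (induction A rule: infinite_finite_induct) auto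

lemma polyfun_prod [intro]: "(\<And>i. i \<in> A \<Longrightarrow> polyfun (G i)) \<Longrightarrow> polyfun (\<lambda>f. \<Prod>i\<in>A. G i f)"
  by (induction A rule: infinite_finite_induct) auto

text \<open>The rows A i span all functions on M: a full rank condition put without minors.\<close>

definition onto_family :: "'i set \<Rightarrow> 'm set \<Rightarrow> ('i \<Rightarrow> 'm \<Rightarrow> 'k::field) \<Rightarrow> bool" where
  "onto_family I M A \<longleftrightarrow> (\<forall>t. \<exists>c. \<forall>m\<in>M. (\<Sum>i\<in>I. c i * A i m) = t m)"

lemma onto_familyD: "onto_family I M A \<Longrightarrow> \<exists>c. \<forall>m\<in>M. (\<Sum>i\<in>I. c i * A i m) = t m"
  by (simp add: onto_family_def)

text \<open>Gaussian elimination without division: surjectivity is preserved both ways when a row with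
  nonzero pivot is cleared from the others.\<close>

lemma polyfun_onto_open:
  fixes A :: "'i \<Rightarrow> 'm \<Rightarrow> (nat \<Rightarrow> ('n, 'k::field) mpoly) \<Rightarrow> 'k"
  assumes "finite M" and I: "finite I" and "\<And>i m. i \<in> I \<Longrightarrow> m \<in> M \<Longrightarrow> polyfun (A i m)"
    and "onto_family I M (\<lambda>i m. A i m f)"
  shows "\<exists>G. polyfun G \<and> G f \<noteq> 0 \<and> (\<forall>g. G g \<noteq> 0 \<longrightarrow> onto_family I M (\<lambda>i m. A i m g))"
  using assms(1,3,4)
proof (induction M arbitrary: A)
  case empty
  show ?case by (rule exI[of _ "\<lambda>f. 1"]) (auto simp: onto_family_def)
next
  case (insert m0 M)
  \<comment> \<open>The value 1 is attained in column \<open>m0\<close>, so this column has a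
    nonzero entry, the pivot.\<close>
  obtain c1 where c1: "(\<Sum>i\<in>I. c1 i * A i m0 f) = 1"
    using onto_familyD[OF insert.prems(2), of "\<lambda>_. 1"] by auto
  then obtain i0 where i0: "i0 \<in> I" "A i0 m0 f \<noteq> 0"
    by (metis (no_types, lifting) mult_zero_right sum.neutral zero_neq_one)
  define A' where "A' i m g = A i0 m0 g * A i m g - A i m0 g * A i0 m g" for i m g
  have A'_sum: "(\<Sum>i\<in>I. c i * A' i m g)
      = A i0 m0 g * (\<Sum>i\<in>I. c i * A i m g) - (\<Sum>i\<in>I. c i * A i m0 g) * A i0 m g" for c m g
    by (simp add: A'_def sum_distrib_left sum_distrib_right sum_subtractf algebra_simps)
  have onto: "onto_family I M (\<lambda>i m. A' i m f)"
    unfolding onto_family_def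
  proof
    fix t
    \<comment> \<open>The value 0 at \<open>m0\<close> removes the subtracted term of
      \<open>A'_sum\<close>; the division by the pivot cancels the remaining factor.\<close>
    obtain c where "\<forall>m\<in>insert m0 M. (\<Sum>i\<in>I. c i * A i m f) = (if m = m0 then 0 else t m / A i0 m0 f)"
      using onto_familyD[OF insert.prems(2), of "\<lambda>m. if m = m0 then 0 else t m / A i0 m0 f"]
      by (elim exE) (rule that)
    then show "\<exists>c. \<forall>m\<in>M. (\<Sum>i\<in>I. c i * A' i m f) = t m"
      using insert.hyps(2) i0 by (intro exI[of _ c]) (auto simp: A'_sum)
  qed
  have pf: "polyfun (A' i m)" if "i \<in> I" "m \<in> M" for i m
    unfolding A'_def using that i0(1)
    by (intro polyfun_diff polyfun_mult insert.prems(1)) auto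
  have "\<exists>G. polyfun G \<and> G f \<noteq> 0 \<and> (\<forall>g. G g \<noteq> 0 \<longrightarrow> onto_family I M (\<lambda>i m. A' i m g))"
    using pf onto by (rule insert.IH)
  then obtain G where G: "polyfun G" "G f \<noteq> 0"
    "\<And>g. G g \<noteq> 0 \<Longrightarrow> onto_family I M (\<lambda>i m. A' i m g)"
    by blast
  have "\<exists>c. \<forall>m\<in>insert m0 M. (\<Sum>i\<in>I. c i * A i m g) = t m" if g: "G g * A i0 m0 g \<noteq> 0" for g t
  proof -
    \<comment> \<open>The multiple of the pivot row to be used. The cleared system has to reach t
      minus this multiple, and the correction of c at \<open>i0\<close> makes column
      \<open>m0\<close> come out as s times the pivot, which is t m0.\<close>
    define s where "s = t m0 / A i0 m0 g"
    obtain c' where c': "\<forall>m\<in>M. (\<Sum>i\<in>I. c' i * A' i m g) = t m - s * A i0 m g"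
      using onto_familyD[OF G(3), of g "\<lambda>m. t m - s * A i0 m g"] g by auto
    define c where "c i = A i0 m0 g * c' i + (if i = i0 then s - (\<Sum>i\<in>I. c' i * A i m0 g) else 0)" for i
    have sum_c: "(\<Sum>i\<in>I. c i * A i m g) = A i0 m0 g * (\<Sum>i\<in>I. c' i * A i m g)
        + (s - (\<Sum>i\<in>I. c' i * A i m0 g)) * A i0 m g" for m
    proof -
      have "(\<Sum>i\<in>I. c i * A i m g) = (\<Sum>i\<in>I. A i0 m0 g * (c' i * A i m g))
          + (\<Sum>i\<in>I. if i = i0 then (s - (\<Sum>i\<in>I. c' i * A i m0 g)) * A i0 m g else 0)"
        unfolding sum.distrib[symmetric] by (rule sum.cong) (auto simp: c_def algebra_simps)
      then show ?thesis
        using I i0(1) by (simp add: sum_distrib_left)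
    qed
    have "(\<Sum>i\<in>I. c i * A i m g) = t m" if "m \<in> insert m0 M" for m
    proof (cases "m = m0")
      case True
      then show ?thesis using g by (simp add: sum_c s_def algebra_simps)
    next
      case False
      then have "(\<Sum>i\<in>I. c' i * A' i m g) = t m - s * A i0 m g"
        using c' that by blast
      then show ?thesis by (simp add: sum_c A'_sum algebra_simps)
    qed
    then show ?thesis by blast
  qed
  moreover have "polyfun (\<lambda>g. G g * A i0 m0 g)"
    using i0(1) by (intro polyfun_mult G(1) insert.prems(1)) auto
  ultimately show ?case
    using G(2) i0(2) by (intro exI[of _ "\<lambda>g. G g * A i0 m0 g"]) (auto simp: onto_family_def)
qed

text \<open>The \<phi> s are linear functionals on functions on M. They annihilate v at every tuple
  g, but only at f is their common kernel required to lie in the span of v. Indexing by a subset of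
  M of size \<open>card M - r\<close> records their number.\<close>

definition cut_out :: "'m set \<Rightarrow> nat \<Rightarrow> (nat \<Rightarrow> 'm \<Rightarrow> (nat \<Rightarrow> ('n, 'k::field) mpoly) \<Rightarrow> 'k) \<Rightarrow>
    (nat \<Rightarrow> ('n, 'k) mpoly) \<Rightarrow> 'm set \<Rightarrow> ('m \<Rightarrow> 'm \<Rightarrow> (nat \<Rightarrow> ('n, 'k) mpoly) \<Rightarrow> 'k) \<Rightarrow> bool" where
  "cut_out M r v f S \<phi> \<longleftrightarrow> S \<subseteq> M \<and> card S + r = card M \<and> (\<forall>s\<in>S. \<forall>m\<in>M. polyfun (\<phi> s m)) \<and>
    (\<forall>g. \<forall>s\<in>S. \<forall>j<r. (\<Sum>m\<in>M. \<phi> s m g * v j m g) = 0) \<and>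
    (\<forall>q. (\<forall>s\<in>S. (\<Sum>m\<in>M. \<phi> s m f * q m) = 0) \<longrightarrow> (\<exists>c. \<forall>m\<in>M. q m = (\<Sum>j<r. c j * v j m f)))"

text \<open>Induction on r, starting from the coordinate functionals. A functional that is nonzero
  on the new vector at f serves as pivot; cross-multiplication clears the others without division,
  so they kill the new vector at every g.\<close>

lemma polyfun_annihilator:
  fixes v :: "nat \<Rightarrow> 'm \<Rightarrow> (nat \<Rightarrow> ('n, 'k::field) mpoly) \<Rightarrow> 'k"
  assumes M: "finite M" and "\<And>j m. j < r \<Longrightarrow> m \<in> M \<Longrightarrow> polyfun (v j m)"
    and "\<And>c j. (\<forall>m\<in>M. (\<Sum>j<r. c j * v j m f) = 0) \<Longrightarrow> j < r \<Longrightarrow> c j = 0"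
  shows "\<exists>S \<phi>. cut_out M r v f S \<phi>"
  using assms(2,3)
proof (induction r)
  case 0
  show ?case
    unfolding cut_out_def
    by (rule exI[of _ M], rule exI[of _ "\<lambda>s m g. if s = m then 1 else 0"])
      (use M in \<open>auto simp: if_distrib[of "\<lambda>x. x * _"] cong: if_cong\<close>)
next
  case (Suc r)
  have indep: "c j = 0" if "\<forall>m\<in>M. (\<Sum>j<r. c j * v j m f) = 0" "j < r" for c j
    using Suc.prems(2)[of "c(r := 0)" j] that by auto
  have pf: "polyfun (v j m)" if "j < r" "m \<in> M" for j m
    using Suc.prems(1) that by simp
  have "\<exists>S \<phi>. cut_out M r v f S \<phi>"
  proof (rule Suc.IH)
    show "polyfun (v j m)" if "j < r" "m \<in> M" for j m by (rule pf[OF that])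
    show "c j = 0" if "\<forall>m\<in>M. (\<Sum>j<r. c j * v j m f) = 0" "j < r" for c j by (rule indep[OF that])
  qed
  then obtain S \<phi> where *: "cut_out M r v f S \<phi>"
    by (elim exE) (rule that)
  have S: "S \<subseteq> M" "card S + r = card M"
    and \<phi>: "\<And>s m. s \<in> S \<Longrightarrow> m \<in> M \<Longrightarrow> polyfun (\<phi> s m)"
    and ann: "\<And>g s j. s \<in> S \<Longrightarrow> j < r \<Longrightarrow> (\<Sum>m\<in>M. \<phi> s m g * v j m g) = 0"
    and cut: "\<And>q. (\<forall>s\<in>S. (\<Sum>m\<in>M. \<phi> s m f * q m) = 0) \<Longrightarrow>
      \<exists>c. \<forall>m\<in>M. q m = (\<Sum>j<r. c j * v j m f)"
    using * by (simp_all add: cut_out_def)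
  define B where "B s q g = (\<Sum>m\<in>M. \<phi> s m g * q m)" for s q g
  define w where "w g m = v r m g" for g m
  \<comment> \<open>Otherwise the new vector would lie, at f, in the span of the previous
    ones.\<close>
  have "\<exists>s0\<in>S. B s0 (w f) f \<noteq> 0"
  proof (rule ccontr)
    assume "\<not> ?thesis"
    then obtain c where c: "\<And>m. m \<in> M \<Longrightarrow> v r m f = (\<Sum>j<r. c j * v j m f)"
      using cut[of "w f"] by (auto simp: B_def w_def)
    have "\<forall>m\<in>M. (\<Sum>j<Suc r. (c(r := - 1)) j * v j m f) = 0"
      using c by simp
    from Suc.prems(2)[OF this, of r] show False by simp
  qed
  then obtain s0 where s0: "s0 \<in> S" "B s0 (w f) f \<noteq> 0" by blast
  define \<phi>' where "\<phi>' s m g = B s0 (w g) g * \<phi> s m g - B s (w g) g * \<phi> s0 m g" for s m g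
  have \<phi>'_sum: "(\<Sum>m\<in>M. \<phi>' s m g * q m) = B s0 (w g) g * B s q g - B s (w g) g * B s0 q g" for s g q
    by (simp add: \<phi>'_def B_def[of s q] B_def[of s0 q] sum_distrib_left sum_subtractf algebra_simps)
  have S': "finite S" using S(1) M finite_subset by blast
  show ?case
    unfolding cut_out_def
  proof (intro exI[of _ "S - {s0}"] exI[of _ \<phi>'] conjI allI ballI impI)
    show "S - {s0} \<subseteq> M" using S by blast
    show "card (S - {s0}) + Suc r = card M"
      using S(2) s0(1) S' card_Suc_Diff1[of S s0] by simp
    show "polyfun (\<phi>' s m)" if "s \<in> S - {s0}" "m \<in> M" for s m
      unfolding \<phi>'_def B_def w_def using that s0(1) \<phi> Suc.prems(1)
      by (intro polyfun_diff polyfun_mult polyfun_sum) auto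
    show "(\<Sum>m\<in>M. \<phi>' s m g * v j m g) = 0" if "s \<in> S - {s0}" "j < Suc r" for g s j
    proof (cases "j = r")
      case True
      have "(\<Sum>m\<in>M. \<phi>' s m g * v r m g) = (\<Sum>m\<in>M. \<phi>' s m g * w g m)"
        by (simp add: w_def)
      with True show ?thesis by (simp add: \<phi>'_sum)
    next
      case False
      then have "j < r" using that by simp
      then show ?thesis
        using ann[of s j g] ann[of s0 j g] that s0(1)
        by (simp add: \<phi>'_sum B_def[of _ "\<lambda>m. v j m g"])
    qed
    show "\<exists>c. \<forall>m\<in>M. q m = (\<Sum>j<Suc r. c j * v j m f)"
      if q: "\<forall>s\<in>S - {s0}. (\<Sum>m\<in>M. \<phi>' s m f * q m) = 0" for q
    proof -
      \<comment> \<open>With this multiple of the new vector subtracted, q is killed by the pivot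
        functional too, and then by all the old ones, so the induction hypothesis applies.\<close>
      define \<alpha> where "\<alpha> = B s0 q f / B s0 (w f) f"
      have B_diff: "B s (\<lambda>m. q m - \<alpha> * w f m) f = B s q f - \<alpha> * B s (w f) f" for s
        by (simp add: B_def sum_distrib_left sum_subtractf algebra_simps)
      have "B s (\<lambda>m. q m - \<alpha> * w f m) f = 0" if "s \<in> S" for s
      proof (cases "s = s0")
        case True
        then show ?thesis unfolding B_diff using s0(2) by (simp add: \<alpha>_def)
      next
        case False
        then have "B s0 (w f) f * B s q f = B s (w f) f * B s0 q f"
          using q that by (auto simp: \<phi>'_sum)
        then show ?thesis unfolding B_diff using s0(2) by (simp add: \<alpha>_def field_simps)
      qed
      then obtain c where c: "\<And>m. m \<in> M \<Longrightarrow> q m - \<alpha> * w f m = (\<Sum>j<r. c j * v j m f)"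
        using cut[of "\<lambda>m. q m - \<alpha> * w f m"] by (auto simp: B_def)
      have "q m = (\<Sum>j<Suc r. (c(r := \<alpha>)) j * v j m f)" if "m \<in> M" for m
        using c[OF that] by (simp add: w_def algebra_simps)
      then show ?thesis by blast
    qed
  qed
qed

section \<open>The homogeneous Nullstellensatz and elimination\<close>

lemma (in vector_space) in_span_image_finite:
  assumes "finite K" "p \<in> span (w ` K)"
  shows "\<exists>c. p = (\<Sum>i\<in>K. scale (c i) (w i))"
  using assms(2)
proof (induction rule: span_induct_alt)
  case base
  show ?case by (rule exI[of _ "\<lambda>_. 0"]) simp
next
  case (step a x y)
  then obtain i c where i: "i \<in> K" "x = w i" and c: "y = (\<Sum>i\<in>K. scale (c i) (w i))"
    by auto
  have "scale a x = (\<Sum>j\<in>K. scale (if j = i then a else 0) (w j))"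
    using assms(1) i by (simp add: if_distrib[of "\<lambda>x. scale x _"] cong: if_cong)
  then have "scale a x + y = (\<Sum>j\<in>K. scale ((if j = i then a else 0) + c j) (w j))"
    by (simp add: c scale_left_distrib sum.distrib)
  then show ?case by (rule exI[of _ "\<lambda>j. (if j = i then a else 0) + c j"])
qed

lemma homog_eqI:
  assumes "homog d p" "homog d q" "\<And>m. m \<in> mons d \<Longrightarrow> lookup p m = lookup q m"
  shows "p = q"
proof (rule poly_mapping_eqI)
  fix m
  show "lookup p m = lookup q m"
    using assms by (cases "m \<in> mons d") (simp, metis homog_def in_keys_iff subsetD)
qed

lemma lookup_mon_mult:
  "lookup (mon m' * p) m = (if \<exists>m''. m = m' + m'' then lookup p (m - m') else 0)"
proof (induction p rule: mpoly_induct)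
  case (single a c)
  show ?case
    by (cases "\<exists>m''. m = m' + m''") (auto simp: mult_single lookup_single when_def)
next
  case (add p q)
  then show ?case by (auto simp: algebra_simps lookup_add)
qed

lemma polyfun_lookup_mon_mult:
  assumes "\<And>m. polyfun (\<lambda>g. lookup (\<Gamma> g) m)"
  shows "polyfun (\<lambda>g. lookup (mon m' * \<Gamma> g) m)"
  using assms by (cases "\<exists>m''. m = m' + m''") (simp_all add: lookup_mon_mult)

text \<open>Spanning degree d means that the coefficient vectors of the \<open>w i g\<close> reach
  every function on \<open>mons d\<close>, which is a rank condition. X is where the
  \<open>w i g\<close> are known to be homogeneous.\<close>

lemma polyfun_span_open:
  fixes w :: "'i \<Rightarrow> (nat \<Rightarrow> ('n, 'k::field) mpoly) \<Rightarrow> ('v::finite, 'k) mpoly"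
  assumes I: "finite I" and homog: "\<And>i g. i \<in> I \<Longrightarrow> g \<in> X \<Longrightarrow> homog d (w i g)" and "f \<in> X"
    and pf: "\<And>i m. i \<in> I \<Longrightarrow> polyfun (\<lambda>g. lookup (w i g) m)"
    and span: "\<And>p. homog d p \<Longrightarrow> p \<in> mp.span ((\<lambda>i. w i f) ` I)"
  shows "\<exists>G. polyfun G \<and> G f \<noteq> 0 \<and>
    (\<forall>g\<in>X. G g \<noteq> 0 \<longrightarrow> (\<forall>p. homog d p \<longrightarrow> p \<in> mp.span ((\<lambda>i. w i g) ` I)))"
proof -
  have lookup_comb: "lookup (\<Sum>i\<in>I. const_mp (c i) * w i g) m = (\<Sum>i\<in>I. c i * lookup (w i g) m)" for c g m
    by (simp add: lookup_sum)
  have "\<exists>G. polyfun G \<and> G f \<noteq> 0 \<and>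
      (\<forall>g. G g \<noteq> 0 \<longrightarrow> onto_family I (mons d) (\<lambda>i m. lookup (w i g) m))"
  proof (rule polyfun_onto_open[where A = "\<lambda>i m g. lookup (w i g) m"])
    show "onto_family I (mons d) (\<lambda>i m. lookup (w i f) m)"
      unfolding onto_family_def
    proof
      fix t :: "'v expo \<Rightarrow> 'k"
      define p where "p = (\<Sum>m\<in>mons d. const_mp (t m) * mon m)"
      have "homog d p"
        unfolding p_def by (intro homog_sum homog_const_mult homog_mon) (simp add: mons_def)
      then obtain c where c: "p = (\<Sum>i\<in>I. const_mp (c i) * w i f)"
        using mp.in_span_image_finite[OF I span] by blast
      have "lookup p m = t m" if "m \<in> mons d" for m
        using that by (simp add: p_def lookup_sum lookup_single when_def if_distrib cong: if_cong)
      then show "\<exists>c. \<forall>m\<in>mons d. (\<Sum>i\<in>I. c i * lookup (w i f) m) = t m"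
        unfolding c lookup_comb by blast
    qed
  qed (use I pf in auto)
  then obtain G where G: "polyfun G" "G f \<noteq> 0"
    "\<And>g. G g \<noteq> 0 \<Longrightarrow> onto_family I (mons d) (\<lambda>i m. lookup (w i g) m)"
    by blast
  have "p \<in> mp.span ((\<lambda>i. w i g) ` I)" if g: "g \<in> X" "G g \<noteq> 0" and p: "homog d p" for g p
  proof -
    obtain c where c: "\<forall>m\<in>mons d. (\<Sum>i\<in>I. c i * lookup (w i g) m) = lookup p m"
      using onto_familyD[OF G(3)[OF g(2)], of "lookup p"] by blast
    have "p = (\<Sum>i\<in>I. const_mp (c i) * w i g)"
      by (rule homog_eqI[OF p])
        (use homog[OF _ g(1)] c in \<open>auto intro!: homog_sum homog_const_mult simp: lookup_comb\<close>)
    also have "\<dots> \<in> mp.span ((\<lambda>i. w i g) ` I)"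
      by (intro mp.span_sum mp.span_scale mp.span_base) auto
    finally show ?thesis .
  qed
  with G show ?thesis by blast
qed

text \<open>The subring k[V], kept inside the full polynomial ring so that variables can be added
  one at a time without a change of type.\<close>

definition pvars :: "'v set \<Rightarrow> ('v, 'k::comm_ring_1) mpoly set" where
  "pvars V = {p. \<forall>m\<in>keys p. keys m \<subseteq> V}"

lemma pvars_add [intro]: "p \<in> pvars V \<Longrightarrow> q \<in> pvars V \<Longrightarrow> p + q \<in> pvars V"
  using Poly_Mapping.keys_add[of p q] by (auto simp: pvars_def)

lemma pvars_uminus [intro]: "p \<in> pvars V \<Longrightarrow> - p \<in> pvars V"
  by (simp add: pvars_def keys.rep_eq)

lemma pvars_diff [intro]: "p \<in> pvars V \<Longrightarrow> q \<in> pvars V \<Longrightarrow> p - q \<in> pvars V"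
  using pvars_add[of p V "- q"] pvars_uminus[of q V] by simp

lemma pvars_mult [intro]: "p \<in> pvars V \<Longrightarrow> q \<in> pvars V \<Longrightarrow> p * q \<in> pvars V"
proof -
  assume pq: "p \<in> pvars V" "q \<in> pvars V"
  have "keys m \<subseteq> V" if m: "m \<in> keys (p * q)" for m
  proof -
    obtain a b where "m = a + b" "a \<in> keys p" "b \<in> keys q"
      using m Poly_Mapping.keys_mult[of p q] by auto
    then show ?thesis
      using pq Poly_Mapping.keys_add[of a b] unfolding pvars_def by blast
  qed
  then show ?thesis by (simp add: pvars_def)
qed

lemma pvars_0 [simp]: "0 \<in> pvars V"
  by (simp add: pvars_def)

lemma pvars_const [simp]: "const_mp c \<in> pvars V"
  by (simp add: pvars_def const_mp_def)

lemma pvars_1 [simp]: "1 \<in> pvars V"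
  using pvars_const[of 1] by simp

lemma pvars_sum [intro]: "(\<And>i. i \<in> A \<Longrightarrow> f i \<in> pvars V) \<Longrightarrow> (\<Sum>i\<in>A. f i) \<in> pvars V"
  by (induction A rule: infinite_finite_induct) auto

lemma pvars_single: "keys m \<subseteq> V \<Longrightarrow> single m c \<in> pvars V"
  by (simp add: pvars_def)

lemma pvars_power [intro]: "p \<in> pvars V \<Longrightarrow> p ^ i \<in> pvars V"
  by (induction i) auto

lemma pvars_hcomp: "p \<in> pvars V \<Longrightarrow> hcomp d p \<in> pvars V"
  by (auto simp: pvars_def in_keys_iff lookup_hcomp when_def split: if_splits)

lemma ev_cong_pvars:
  assumes "p \<in> pvars V" "\<And>v. v \<in> V \<Longrightarrow> x v = y v"
  shows "ev \<kappa> x p = ev \<kappa> y p"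
  unfolding ev_def mon_ev_def
proof (intro sum.cong refl arg_cong2[where f = "(*)"] prod.cong arg_cong2[where f = "(^)"])
  show "x v = y v" if "m \<in> keys p" "v \<in> keys m" for m v
    using assms that by (auto simp: pvars_def)
qed

lemma var_power: "var v ^ i = mon (single v i)"
proof (induction i)
  case (Suc i)
  then show ?case by (simp add: mult_single single_add[symmetric])
qed simp

lemma pvars_insert_expand:
  assumes "p \<in> pvars (insert v V)" "v \<notin> V" "\<And>m. m \<in> keys p \<Longrightarrow> lookup m v < D"
  obtains r where "\<And>i. r i \<in> pvars V" "p = (\<Sum>i<D. r i * var v ^ i)"
proof
  define r where "r i = (\<Sum>m | m \<in> keys p \<and> lookup m v = i. single (m - single v i) (lookup p m))" for i
  have "keys (m - single v (lookup m v)) \<subseteq> V" if "m \<in> keys p" for m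
  proof
    fix w assume w: "w \<in> keys (m - single v (lookup m v))"
    then have "w \<noteq> v" "w \<in> keys m"
      by (auto simp: in_keys_iff lookup_minus lookup_single when_def split: if_splits)
    moreover have "keys m \<subseteq> insert v V"
      using assms(1) that by (simp add: pvars_def)
    ultimately show "w \<in> V" by blast
  qed
  then show "r i \<in> pvars V" for i
    unfolding r_def by (intro pvars_sum pvars_single) auto
  have split: "m - single v i + single v i = m" if "lookup m v = i" for m :: "'a expo" and i
    by (rule poly_mapping_eqI) (use that in \<open>auto simp: lookup_add lookup_minus lookup_single when_def\<close>)
  have "(\<Sum>i<D. r i * var v ^ i)
      = (\<Sum>i<D. \<Sum>m | m \<in> keys p \<and> lookup m v = i. single m (lookup p m))"
    by (simp add: r_def var_power sum_distrib_right mult_single split)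
  also have "\<dots> = (\<Sum>m\<in>keys p. single m (lookup p m))"
    by (rule sum.group) (use assms(3) in auto)
  finally show "p = (\<Sum>i<D. r i * var v ^ i)"
    by (simp add: sum_single_lookup)
qed

section \<open>Ideals and the extension of a zero to one more variable\<close>

definition ideal_set :: "'a::comm_ring_1 set \<Rightarrow> bool" where
  "ideal_set J \<longleftrightarrow> 0 \<in> J \<and> (\<forall>p\<in>J. \<forall>q\<in>J. p + q \<in> J) \<and> (\<forall>p\<in>J. \<forall>q. q * p \<in> J)"

lemma ideal_setD:
  assumes "ideal_set J"
  shows "0 \<in> J" "p \<in> J \<Longrightarrow> q \<in> J \<Longrightarrow> p + q \<in> J" "p \<in> J \<Longrightarrow> q * p \<in> J" "p \<in> J \<Longrightarrow> p * q \<in> J"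
    "p \<in> J \<Longrightarrow> - p \<in> J" "p \<in> J \<Longrightarrow> q \<in> J \<Longrightarrow> p - q \<in> J"
proof -
  show *: "0 \<in> J" "p \<in> J \<Longrightarrow> q \<in> J \<Longrightarrow> p + q \<in> J" "p \<in> J \<Longrightarrow> q * p \<in> J" for p q
    using assms by (auto simp: ideal_set_def)
  show "p \<in> J \<Longrightarrow> p * q \<in> J"
    using *(3)[of p q] by (simp add: mult.commute)
  show neg: "p \<in> J \<Longrightarrow> - p \<in> J" for p
    using *(3)[of p "- 1"] by simp
  show "p \<in> J \<Longrightarrow> q \<in> J \<Longrightarrow> p - q \<in> J"
    using *(2)[of p "- q"] neg by simp
qed

lemma ideal_set_sum:
  assumes "ideal_set J" "\<And>i. i \<in> A \<Longrightarrow> f i \<in> J"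
  shows "(\<Sum>i\<in>A. f i) \<in> J"
  using assms(2) by (induction A rule: infinite_finite_induct) (auto intro: ideal_setD[OF assms(1)])

text \<open>A nonzero element of least degree divides all others, and any of its roots is a common
  root.\<close>

lemma poly_ideal_common_root:
  fixes \<aa> :: "'k::field poly set"
  assumes "alg_closed TYPE('k)" and ideal: "ideal_set \<aa>" and "1 \<notin> \<aa>"
  shows "\<exists>c. \<forall>p\<in>\<aa>. poly p c = 0"
proof (cases "\<aa> \<subseteq> {0}")
  case False
  then have "\<exists>h. h \<in> \<aa> \<and> h \<noteq> 0" by blast
  then obtain h where h: "h \<in> \<aa>" "h \<noteq> 0" and least: "\<And>q. q \<in> \<aa> \<Longrightarrow> q \<noteq> 0 \<Longrightarrow> degree h \<le> degree q"
    using ex_has_least_nat[of "\<lambda>h. h \<in> \<aa> \<and> h \<noteq> 0" _ degree] by metis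
  have dvd: "h dvd q" if "q \<in> \<aa>" for q
  proof -
    have "q mod h = q - h * (q div h)"
      by (simp add: minus_mult_div_eq_mod)
    then have "q mod h \<in> \<aa>"
      using that h(1) ideal by (auto intro: ideal_setD)
    then have "q mod h = 0"
      using least[of "q mod h"] degree_mod_less'[of h q] h(2) by fastforce
    then show ?thesis by auto
  qed
  have "degree h \<noteq> 0"
  proof
    assume "degree h = 0"
    then have "h dvd 1" using h(2) by (simp add: is_unit_iff_degree)
    then obtain q where "1 = h * q" by (elim dvdE)
    then show False using h(1) assms(3) ideal ideal_setD(4) by metis
  qed
  then have "1 \<le> degree h" by simp
  then obtain c where "poly h c = 0"
    using assms(1) unfolding alg_closed_def by blast
  then show ?thesis using dvd by (metis dvdE mult_zero_left poly_mult)
next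
  case True
  then have "p = 0" if "p \<in> \<aa>" for p using that by auto
  then show ?thesis by fastforce
qed

text \<open>The determinant trick without determinants. Modulo J the vector e satisfies (u I - m) e
  = 0, where u has value 1 and m value 0 at a. Eliminating one unknown after the other keeps both
  properties, and the final u' plays the role of the determinant.\<close>

lemma elimination_mod_ideal:
  fixes e :: "nat \<Rightarrow> ('v, 'k::comm_ring_1) mpoly"
  assumes J: "ideal_set J"
    and "u \<in> pvars V" "mp_eval u a = 1"
    and "\<And>i j. i < d \<Longrightarrow> j < d \<Longrightarrow> m i j \<in> pvars V \<and> mp_eval (m i j) a = 0"
    and "\<And>i. i < d \<Longrightarrow> u * e i - (\<Sum>j<d. m i j * e j) \<in> J"
  shows "\<exists>u'\<in>pvars V. mp_eval u' a = 1 \<and> (\<forall>i<d. u' * e i \<in> J)"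
  using assms(2-)
proof (induction d arbitrary: u m)
  case 0
  then show ?case by auto
next
  case (Suc d)
  \<comment> \<open>The pivot: the diagonal coefficient of the last equation, again of value 1 at
    a.\<close>
  define w where "w = u - m d d"
  define m' where "m' i j = w * m i j + m i d * m d j" for i j
  have w: "w \<in> pvars V" "mp_eval w a = 1"
    using Suc.prems(1,2) Suc.prems(3)[of d d] by (auto simp: w_def mp_eval_simps)
  have d: "w * e d - (\<Sum>j<d. m d j * e j) \<in> J"
    using Suc.prems(4)[of d] by (simp add: w_def algebra_simps)
  have "\<exists>u'\<in>pvars V. mp_eval u' a = 1 \<and> (\<forall>i<d. u' * e i \<in> J)"
  proof (rule Suc.IH[of "w * u" m'])
    show "w * u \<in> pvars V" "mp_eval (w * u) a = 1"
      using w Suc.prems(1,2) by (auto simp: mp_eval_simps)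
    show "m' i j \<in> pvars V \<and> mp_eval (m' i j) a = 0" if "i < d" "j < d" for i j
      using that w Suc.prems(3)[of i j] Suc.prems(3)[of i d] Suc.prems(3)[of d j]
      by (auto simp: m'_def mp_eval_simps)
    show "w * u * e i - (\<Sum>j<d. m' i j * e j) \<in> J" if "i < d" for i
    proof -
      have "w * u * e i - (\<Sum>j<d. m' i j * e j)
          = w * (u * e i - (\<Sum>j<Suc d. m i j * e j)) + m i d * (w * e d - (\<Sum>j<d. m d j * e j))"
        by (simp add: m'_def algebra_simps sum.distrib sum_distrib_left)
      also have "\<dots> \<in> J"
        using that Suc.prems(4)[of i] d by (intro ideal_setD(2,3)[OF J]) auto
      finally show ?thesis .
    qed
  qed
  then obtain u' where u': "u' \<in> pvars V" "mp_eval u' a = 1" "\<And>i. i < d \<Longrightarrow> u' * e i \<in> J"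
    by blast
  show ?case
  proof (intro bexI[of _ "w * u'"] conjI allI impI)
    show "mp_eval (w * u') a = 1" "w * u' \<in> pvars V"
      using w u' by (auto simp: mp_eval_simps)
    fix i assume "i < Suc d"
    show "w * u' * e i \<in> J"
    proof (cases "i = d")
      case True
      have "w * u' * e d = u' * (w * e d - (\<Sum>j<d. m d j * e j)) + (\<Sum>j<d. m d j * (u' * e j))"
        by (simp add: algebra_simps sum_distrib_left)
      also have "\<dots> \<in> J"
        using d u'(3) ideal_setD(3)[OF J] by (intro ideal_setD(2)[OF J] ideal_set_sum[OF J]) auto
      finally show ?thesis using True by simp
    next
      case False
      then have "w * (u' * e i) \<in> J"
        using u'(3)[of i] \<open>i < Suc d\<close> by (intro ideal_setD(3)[OF J, of "u' * e i"]) auto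
      then show ?thesis by (simp add: mult.assoc)
    qed
  qed
qed

text \<open>Substituting a for the variables in V turns J into an ideal \<open>\<aa>\<close> of
  k[t]. If it were the unit ideal, some p in J would become 1. By \<open>monic\<close>, powers of v
  are modulo J combinations over k[V] of the first d of them, so the determinant trick, as in
  Nakayama's lemma, produces from p an element of J in k[V] with value 1 at a, against
  \<open>zero\<close>.\<close>

lemma zero_extends_if_monic:
  fixes J :: "('v, 'k::field) mpoly set"
  assumes alg: "alg_closed TYPE('k)" and J: "ideal_set J" and v: "v \<notin> V"
    and zero: "\<And>p. p \<in> J \<Longrightarrow> p \<in> pvars V \<Longrightarrow> mp_eval p a = 0"
    and F: "\<And>i. F i \<in> pvars V" and monic: "var v ^ d + (\<Sum>i<d. F i * var v ^ i) \<in> J"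
  shows "\<exists>c. \<forall>p\<in>J \<inter> pvars (insert v V). mp_eval p (a(v := c)) = 0"
proof -
  define x where "x = (\<lambda>w. if w = v then [:0, 1:] else [:a w:])"
  define E where "E = ev (\<lambda>c. [:c:]) x"
  define \<aa> where "\<aa> = E ` (J \<inter> pvars (insert v V))"
  have E: "ring_map E"
    unfolding E_def by (rule ring_map_ev[OF ring_map_pCons])
  have poly_E: "poly (E p) c = mp_eval p (a(v := c))" for p c
    unfolding E_def poly_ev_conv_mp_eval by (rule arg_cong[of _ _ "mp_eval p"]) (auto simp: x_def)
  have E_var: "E (var v) = [:0, 1:]" and E_const: "E (const_mp c) = [:c:]" for c
    by (simp_all add: E_def ev_var[OF ring_map_pCons] ev_const[OF ring_map_pCons] x_def)
  have E_pvars: "E p = [:mp_eval p a:]" if "p \<in> pvars V" for p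
  proof -
    have "E p = ev (\<lambda>c. [:c:]) (\<lambda>w. [:a w:]) p"
      unfolding E_def by (rule ev_cong_pvars[OF that]) (use v in \<open>auto simp: x_def\<close>)
    then show ?thesis
      by (simp add: mp_eval_conv_ev ring_map_comp_ev[OF ring_map_id ring_map_pCons])
  qed
  have var_pvars: "var v \<in> pvars (insert v V)"
    by (rule pvars_single) auto
  have "ideal_set \<aa>"
    unfolding ideal_set_def
  proof (intro conjI ballI allI)
    show "0 \<in> \<aa>"
      unfolding \<aa>_def by (rule image_eqI[of _ _ 0]) (auto simp: ring_mapD[OF E] ideal_setD[OF J])
    show "p + q \<in> \<aa>" if pq: "p \<in> \<aa>" "q \<in> \<aa>" for p q
    proof -
      obtain p' q' where "p = E p'" "q = E q'" "p' \<in> J \<inter> pvars (insert v V)" "q' \<in> J \<inter> pvars (insert v V)"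
        using pq by (auto simp: \<aa>_def)
      then show ?thesis
        unfolding \<aa>_def by (intro image_eqI[of _ _ "p' + q'"]) (auto simp: ring_mapD[OF E] ideal_setD[OF J])
    qed
    show "q * p \<in> \<aa>" if "p \<in> \<aa>" for p q
    proof -
      obtain p' where p': "p = E p'" "p' \<in> J \<inter> pvars (insert v V)"
        using \<open>p \<in> \<aa>\<close> by (auto simp: \<aa>_def)
      \<comment> \<open>A preimage of q under E: surjectivity onto k[t] is what makes the image of J
        an ideal.\<close>
      define q' where "q' = (\<Sum>i\<le>degree q. const_mp (coeff q i) * var v ^ i)"
      have "E q' = (\<Sum>i\<le>degree q. smult (coeff q i) ([:0, 1:] ^ i))"
        by (simp add: q'_def ring_map_sum[OF E] ring_map_power[OF E] ring_mapD[OF E] E_const E_var)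
      also have "\<dots> = q"
        by (simp add: monom_altdef[symmetric] poly_as_sum_of_monoms)
      finally have "E q' = q" .
      moreover have "q' \<in> pvars (insert v V)"
        unfolding q'_def using var_pvars by (intro pvars_sum pvars_mult pvars_power) auto
      ultimately show ?thesis
        unfolding \<aa>_def using p'
        by (intro image_eqI[of _ _ "q' * p'"]) (auto simp: ring_mapD[OF E] ideal_setD[OF J])
    qed
  qed
  moreover have "1 \<notin> \<aa>"
  proof
    assume "1 \<in> \<aa>"
    then obtain p where p: "p \<in> J" "p \<in> pvars (insert v V)" "E p = 1"
      by (auto simp: \<aa>_def)
    have "d \<noteq> 0"
    proof
      assume "d = 0"
      then have "1 \<in> J" using monic by simp
      from zero[OF this] show False by (simp add: mp_eval_simps)
    qed
    then obtain d' where d': "d = Suc d'" by (cases d) auto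
    \<comment> \<open>Division with remainder by the monic element, one power of v at a
      time.\<close>
    have "\<exists>s. (\<forall>j. s j \<in> pvars V) \<and> var v ^ i - (\<Sum>j<d. s j * var v ^ j) \<in> J" for i
    proof (induction i)
      case 0
      have "(\<Sum>j<d. (if j = 0 then 1 else 0) * var v ^ j) = (1 :: ('v, 'k) mpoly)"
        by (simp add: d' sum.lessThan_Suc_shift del: sum.lessThan_Suc)
      then show ?case
        by (intro exI[of _ "\<lambda>j. if j = 0 then 1 else 0"]) (auto simp: ideal_setD[OF J])
    next
      case (Suc i)
      then obtain s where s: "\<And>j. s j \<in> pvars V" "var v ^ i - (\<Sum>j<d. s j * var v ^ j) \<in> J"
        by blast
      define s' where "s' j = (if j = 0 then 0 else s (j - 1)) - s d' * F j" for j
      have "(\<Sum>j<d. s' j * var v ^ j)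
          = (\<Sum>j<d'. s j * var v ^ Suc j) - s d' * (\<Sum>j<d. F j * var v ^ j)"
      proof -
        have "(\<Sum>j<d. s' j * var v ^ j)
            = (\<Sum>j<d. (if j = 0 then 0 else s (j - 1)) * var v ^ j) - s d' * (\<Sum>j<d. F j * var v ^ j)"
          by (simp add: s'_def algebra_simps sum_subtractf sum_distrib_left)
        also have "(\<Sum>j<d. (if j = 0 then 0 else s (j - 1)) * var v ^ j) = (\<Sum>j<d'. s j * var v ^ Suc j)"
          unfolding d' by (subst sum.lessThan_Suc_shift) simp
        finally show ?thesis .
      qed
      then have "var v ^ Suc i - (\<Sum>j<d. s' j * var v ^ j)
          = var v * (var v ^ i - (\<Sum>j<d. s j * var v ^ j)) + s d' * (var v ^ d + (\<Sum>i<d. F i * var v ^ i))"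
        by (simp add: d' algebra_simps sum_distrib_left)
      also have "\<dots> \<in> J"
        using s(2) monic ideal_setD(3)[OF J] by (intro ideal_setD(2)[OF J]) auto
      finally show ?case
        using s(1) F by (intro exI[of _ s']) (auto simp: s'_def)
    qed
    then have "\<exists>s. \<forall>i. (\<forall>j. s i j \<in> pvars V) \<and> var v ^ i - (\<Sum>j<d. s i j * var v ^ j) \<in> J"
      by (intro choice) blast
    then obtain s where "\<forall>i. (\<forall>j. s i j \<in> pvars V) \<and> var v ^ i - (\<Sum>j<d. s i j * var v ^ j) \<in> J"
      by (elim exE) (rule that)
    then have s: "s i j \<in> pvars V" "var v ^ i - (\<Sum>j<d. s i j * var v ^ j) \<in> J" for i j
      by simp_all
    obtain B where B: "\<And>m. m \<in> keys p \<Longrightarrow> mon_deg m \<le> B"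
      using ex_mon_deg_bound by metis
    define D where "D = Suc B"
    have "lookup m v < D" if "m \<in> keys p" for m
      using B[OF that] lookup_le_mon_deg[of m v] by (simp add: D_def)
    then obtain r where r: "\<And>i. r i \<in> pvars V" "p = (\<Sum>i<D. r i * var v ^ i)"
      using pvars_insert_expand[OF p(2) v] by metis
    have "E p = (\<Sum>i<D. monom (mp_eval (r i) a) i)"
      by (simp add: r(2) ring_map_sum[OF E] ring_map_power[OF E] ring_mapD[OF E] E_pvars[OF r(1)]
          E_var monom_altdef)
    then have coeff_E: "coeff (E p) i = (\<Sum>j<D. if j = i then mp_eval (r j) a else 0)" for i
      by (simp only: coeff_sum coeff_monom)
    have r_eval: "mp_eval (r i) a = (if i = 0 then 1 else 0)" if "i < D" for i
      using coeff_E[of i] that p(3) by (auto split: if_splits)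
    \<comment> \<open>The coefficients of 1 - p in powers of v; they vanish at a because p becomes 1
      there. Modulo J, multiplication by 1 - p is the identity, and reducing the powers of v in it
      gives the system M.\<close>
    define n where "n i = (if i = 0 then 1 else 0) - r i" for i
    have n: "n i \<in> pvars V" "i < D \<Longrightarrow> mp_eval (n i) a = 0" for i
      using r(1)[of i] r_eval[of i] by (auto simp: n_def mp_eval_simps)
    have sum_n: "(\<Sum>i<D. n i * var v ^ i) = 1 - p"
    proof -
      have "(\<Sum>i<D. (if i = 0 then 1 else 0) * var v ^ i) = (1 :: ('v, 'k) mpoly)"
        by (simp add: D_def sum.lessThan_Suc_shift del: sum.lessThan_Suc)
      then show ?thesis
        by (simp add: r(2) n_def left_diff_distrib sum_subtractf)
    qed
    define M where "M j l = (\<Sum>i<D. n i * s (i + j) l)" for j l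
    have "\<exists>u\<in>pvars V. mp_eval u a = 1 \<and> (\<forall>j<d. u * var v ^ j \<in> J)"
    proof (rule elimination_mod_ideal[OF J, where u = 1 and m = M])
      show "M j l \<in> pvars V \<and> mp_eval (M j l) a = 0" for j l
        unfolding M_def using n s(1)
        by (intro conjI pvars_sum pvars_mult) (auto simp: mp_eval_simps mp_eval_sum)
      show "1 * var v ^ j - (\<Sum>l<d. M j l * var v ^ l) \<in> J" for j
      proof -
        have "(\<Sum>l<d. M j l * var v ^ l) = (\<Sum>i<D. n i * (\<Sum>l<d. s (i + j) l * var v ^ l))"
          unfolding M_def sum_distrib_right sum_distrib_left by (subst sum.swap) (simp add: mult.assoc)
        moreover have "(1 - p) * var v ^ j = (\<Sum>i<D. n i * var v ^ (i + j))"
          by (simp add: sum_n[symmetric] sum_distrib_right power_add mult.assoc)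
        ultimately have "1 * var v ^ j - (\<Sum>l<d. M j l * var v ^ l)
            = p * var v ^ j + (\<Sum>i<D. n i * (var v ^ (i + j) - (\<Sum>l<d. s (i + j) l * var v ^ l)))"
          by (simp add: algebra_simps sum_subtractf)
        also have "\<dots> \<in> J"
          using p(1) s(2) ideal_setD(3,4)[OF J]
          by (intro ideal_setD(2)[OF J] ideal_set_sum[OF J]) auto
        finally show ?thesis .
      qed
    qed (auto simp: mp_eval_simps)
    \<comment> \<open>Index 0, available because d > 0, is the claim about u itself.\<close>
    then obtain u where u: "u \<in> pvars V" "mp_eval u a = 1" "u * var v ^ 0 \<in> J"
      using d' by blast
    then have "u \<in> J" by (simp only: power_0 mult_1_right)
    then show False using zero u by force
  qed
  ultimately obtain c where "\<forall>p\<in>\<aa>. poly p c = 0"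
    using poly_ideal_common_root[OF alg] by blast
  then show ?thesis
    by (intro exI[of _ c]) (auto simp: \<aa>_def poly_E)
qed

text \<open>At the unit vector of v only pure powers of v survive, so p contains some c v^d with c
  \<noteq> 0. The degree d component of p, divided by c, is the element sought: every other monomial
  of degree d has a smaller exponent of v.\<close>

lemma homog_ideal_monic:
  fixes J :: "('v, 'k::field) mpoly set"
  assumes J: "ideal_set J" and hcomp: "\<And>p d. p \<in> J \<Longrightarrow> hcomp d p \<in> J"
    and p: "p \<in> J" "p \<in> pvars W" "mp_eval p (\<lambda>w. if w = v then 1 else 0) \<noteq> 0"
  obtains d q where "var v ^ d + q \<in> J" "q \<in> pvars W" "homog d q" "\<And>m. m \<in> keys q \<Longrightarrow> lookup m v < d"
proof -
  let ?e = "\<lambda>w. if w = v then 1 else 0 :: 'k"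
  have "\<exists>m\<in>keys p. mon_ev ?e m \<noteq> 0"
    using p(3) unfolding mp_eval_conv_ev ev_def by (metis (no_types, lifting) mult_zero_right sum.neutral)
  then obtain m where m: "m \<in> keys p" "mon_ev ?e m \<noteq> 0" by blast
  have "keys m \<subseteq> {v}"
  proof
    fix w assume w: "w \<in> keys m"
    show "w \<in> {v}"
    proof (rule ccontr)
      assume "w \<notin> {v}"
      then have "mon_ev ?e m = 0"
        unfolding mon_ev_def using w
        by (intro prod_zero) (auto simp: in_keys_iff zero_power intro!: bexI[of _ w])
      with m show False by simp
    qed
  qed
  define d where "d = lookup m v"
  have md: "m = single v d"
    by (rule poly_mapping_eqI)
      (use \<open>keys m \<subseteq> {v}\<close> in \<open>auto simp: d_def lookup_single when_def in_keys_iff\<close>)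
  define c where "c = lookup p m"
  have c: "c \<noteq> 0" using m(1) by (simp add: c_def in_keys_iff)
  define P where "P = const_mp (inverse c) * hcomp d p"
  have P: "P \<in> J" "P \<in> pvars W" "homog d P"
    unfolding P_def using p hcomp by (auto intro: ideal_setD[OF J] pvars_hcomp homog_const_mult)
  have "lookup P m = 1"
    unfolding P_def by (simp add: lookup_hcomp md) (use c md c_def in auto)
  have vW: "single v d \<in> keys p" "keys (single v d) \<subseteq> W"
    using m(1) md p(2) by (auto simp: pvars_def)
  show ?thesis
  proof
    show "var v ^ d + (P - var v ^ d) \<in> J" using P by simp
    show "P - var v ^ d \<in> pvars W"
      unfolding var_power using P(2) vW(2) by (intro pvars_diff pvars_single) auto
    show hom: "homog d (P - var v ^ d)"
      unfolding var_power using P(3) by (intro homog_diff homog_mon) auto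
    show "lookup m' v < d" if "m' \<in> keys (P - var v ^ d)" for m'
    proof -
      have deg: "mon_deg m' = d" using that hom by (auto simp: homog_def mons_def)
      have "m' \<noteq> m"
        using that \<open>lookup P m = 1\<close> by (auto simp: in_keys_iff lookup_minus var_power md)
      moreover have "m' = single v d" if eq: "lookup m' v = d"
      proof -
        obtain m'' where "m' = m'' + single v d"
          by (rule mon_split_var[of d m' v]) (use eq in simp)
        then show ?thesis using deg by simp
      qed
      ultimately show ?thesis
        using lookup_le_mon_deg[of m' v] deg md by fastforce
    qed
  qed
qed

text \<open>Either the unit vector of v is itself a zero, or J contains an element monic in v and
  the given zero extends.\<close>

lemma projective_zero_extends:
  fixes J :: "('v, 'k::field) mpoly set"
  assumes alg: "alg_closed TYPE('k)" and J: "ideal_set J" and hcomp: "\<And>p d. p \<in> J \<Longrightarrow> hcomp d p \<in> J"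
    and v: "v \<notin> V" and a: "\<exists>w\<in>V. a w \<noteq> 0"
    and zero: "\<And>p. p \<in> J \<Longrightarrow> p \<in> pvars V \<Longrightarrow> mp_eval p a = 0"
  shows "\<exists>b. (\<exists>w\<in>insert v V. b w \<noteq> 0) \<and> (\<forall>p\<in>J \<inter> pvars (insert v V). mp_eval p b = 0)"
proof (cases "\<forall>p\<in>J \<inter> pvars (insert v V). mp_eval p (\<lambda>w. if w = v then 1 else 0) = 0")
  case True
  then show ?thesis
    by (intro exI[of _ "\<lambda>w. if w = v then 1 else 0"]) auto
next
  case False
  then obtain p where "p \<in> J" "p \<in> pvars (insert v V)" "mp_eval p (\<lambda>w. if w = v then 1 else 0) \<noteq> 0"
    by blast
  from homog_ideal_monic[OF J hcomp this] obtain d q where q: "var v ^ d + q \<in> J" "q \<in> pvars (insert v V)"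
    "\<And>m. m \<in> keys q \<Longrightarrow> lookup m v < d"
    by metis
  obtain F where "\<And>i. F i \<in> pvars V" "q = (\<Sum>i<d. F i * var v ^ i)"
    using pvars_insert_expand[OF q(2) v q(3)] by metis
  then obtain c where c: "\<forall>p\<in>J \<inter> pvars (insert v V). mp_eval p (a(v := c)) = 0"
    using zero_extends_if_monic[OF alg J v zero] q(1) by blast
  obtain w where "w \<in> V" "a w \<noteq> 0" using a by blast
  with v c show ?thesis
    by (intro exI[of _ "a(v := c)"]) auto
qed

text \<open>A nontrivial zero of the part of J in k[V] would extend variable by variable to one of
  J, so there is none for any V. Hence J contains an element of k[V, v] monic in v, which rewrites
  high powers of v, and induction on V brings all monomials of large degree into J.\<close>

theorem projective_nullstellensatz:
  fixes J :: "('v::finite, 'k::field) mpoly set"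
  assumes alg: "alg_closed TYPE('k)" and J: "ideal_set J" and hcomp: "\<And>p d. p \<in> J \<Longrightarrow> hcomp d p \<in> J"
    and no_zero: "\<And>a. (\<And>p. p \<in> J \<Longrightarrow> mp_eval p a = 0) \<Longrightarrow> a = (\<lambda>_. 0)"
  shows "\<exists>N. \<forall>m. N \<le> mon_deg m \<longrightarrow> mon m \<in> J"
proof -
  define Z where "Z V \<longleftrightarrow> (\<exists>a. (\<exists>w\<in>V. a w \<noteq> 0) \<and> (\<forall>p\<in>J \<inter> pvars V. mp_eval p a = 0))" for V
  have Z_step: "Z (insert v V)" if "Z V" "v \<notin> V" for v V
  proof -
    obtain a where a: "\<exists>w\<in>V. a w \<noteq> 0" "\<forall>p\<in>J \<inter> pvars V. mp_eval p a = 0"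
      using \<open>Z V\<close> by (auto simp: Z_def)
    show ?thesis
      unfolding Z_def using projective_zero_extends[OF alg J hcomp that(2) a(1)] a(2) by blast
  qed
  have "Z (V \<union> W)" if "Z V" "finite W" for V W
    using that(2,1) by (induction W) (simp, metis Un_insert_right Z_step insert_absorb)
  from this[of _ UNIV] have Z_UNIV: "Z V \<Longrightarrow> Z UNIV" for V by simp
  have "pvars UNIV = (UNIV :: ('v, 'k) mpoly set)" by (auto simp: pvars_def)
  then have not_Z: "\<not> Z V" for V
    using Z_UNIV[of V] no_zero by (fastforce simp: Z_def)
  have "\<exists>N. \<forall>m. keys m \<subseteq> V \<longrightarrow> N \<le> mon_deg m \<longrightarrow> mon m \<in> J" if "finite V" for V
    using that
  proof induction
    case empty
    show ?case by (rule exI[of _ 1]) auto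
  next
    case (insert v V)
    then obtain N where N: "\<And>m. keys m \<subseteq> V \<Longrightarrow> N \<le> mon_deg m \<Longrightarrow> mon m \<in> J"
      by blast
    have "\<exists>p\<in>J \<inter> pvars (insert v V). mp_eval p (\<lambda>w. if w = v then 1 else 0) \<noteq> 0"
    proof (rule ccontr)
      assume "\<not> ?thesis"
      then have "Z (insert v V)"
        unfolding Z_def by (intro exI[of _ "\<lambda>w. if w = v then 1 else 0"]) auto
      then show False using not_Z by blast
    qed
    then obtain p where "p \<in> J" "p \<in> pvars (insert v V)" "mp_eval p (\<lambda>w. if w = v then 1 else 0) \<noteq> 0"
      by blast
    from homog_ideal_monic[OF J hcomp this] obtain d q where q: "var v ^ d + q \<in> J"
      "q \<in> pvars (insert v V)" "homog d q" "\<And>m. m \<in> keys q \<Longrightarrow> lookup m v < d"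
      by metis
    \<comment> \<open>Here t bounds how far the degree of m outside v falls short of N. While it
      does, m contains v^d, because its degree is at least N + d, and replacing v^d by terms lower
      in v raises the degree outside v. For t = 0 the factor of m outside v is in J.\<close>
    have "mon m \<in> J" if "keys m \<subseteq> insert v V" "N + d \<le> mon_deg m" "N \<le> mon_deg m - lookup m v + t" for t m
      using that
    proof (induction t arbitrary: m)
      case 0
      obtain m' where m': "m = m' + single v (lookup m v)"
        by (rule mon_split_var[OF order_refl])
      have "lookup m v = lookup m' v + lookup m v"
        using arg_cong[OF m', of "\<lambda>m. lookup m v"] by (simp add: lookup_add)
      then have "v \<notin> keys m'" by (simp add: in_keys_iff)
      moreover have "keys m' \<subseteq> keys m"
        by (subst m') (auto simp: in_keys_iff lookup_add)
      ultimately have "keys m' \<subseteq> V" using 0(1) by blast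
      moreover have "N \<le> mon_deg m'"
        using 0(3) arg_cong[OF m', of mon_deg] by simp
      ultimately have "mon m' * mon (single v (lookup m v)) \<in> J"
        using N by (intro ideal_setD[OF J])
      then show ?case
        unfolding mon_add[symmetric] using m' by simp
    next
      case (Suc t)
      show ?case
      proof (cases "N \<le> mon_deg m - lookup m v + t")
        case True
        then show ?thesis using Suc by blast
      next
        case False
        then have "d \<le> lookup m v" using Suc.prems(2) by linarith
        then obtain m1 where m1: "m = m1 + single v d"
          by (rule mon_split_var)
        have keys_m1: "keys m1 \<subseteq> insert v V"
          using Suc.prems(1) m1 by (auto simp: in_keys_iff lookup_add subset_iff)
        have "mon (m1 + m2) \<in> J" if m2: "m2 \<in> keys q" for m2
        proof (rule Suc.IH)
          have "keys m2 \<subseteq> insert v V" using q(2) m2 by (auto simp: pvars_def)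
          then show "keys (m1 + m2) \<subseteq> insert v V"
            using keys_m1 Poly_Mapping.keys_add[of m1 m2] by blast
          have deg: "mon_deg m2 = d" using q(3) m2 by (auto simp: homog_def mons_def)
          then show "N + d \<le> mon_deg (m1 + m2)"
            using Suc.prems(2) m1 by simp
          have "lookup m2 v < d" using q(4) m2 .
          moreover have "lookup m1 v \<le> mon_deg m1" by (rule lookup_le_mon_deg)
          ultimately show "N \<le> mon_deg (m1 + m2) - lookup (m1 + m2) v + t"
            using Suc.prems(3) m1 deg by (simp add: lookup_add)
        qed
        then have "(\<Sum>m2\<in>keys q. const_mp (lookup q m2) * mon (m1 + m2)) \<in> J"
          by (intro ideal_set_sum[OF J] ideal_setD[OF J]) auto
        also have "(\<Sum>m2\<in>keys q. const_mp (lookup q m2) * mon (m1 + m2)) = mon m1 * q"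
          by (subst (3) mpoly_conv_mon[of "keys q" q]) (auto simp: sum_distrib_left mon_add algebra_simps)
        finally have "mon m1 * (var v ^ d + q) - mon m1 * q \<in> J"
          using q(1) ideal_setD(3)[OF J] by (intro ideal_setD(6)[OF J]) auto
        then show ?thesis
          by (simp add: m1 mon_add var_power algebra_simps)
      qed
    qed
    then show ?case
      by (intro exI[of _ "N + d"]) (metis le_add2)
  qed
  from this[of UNIV] show ?thesis by auto
qed

lemma ideal_set_combinations: "ideal_set {(\<Sum>i\<in>I. h i * \<Gamma> i) | h. True}" (is "ideal_set ?J")
  unfolding ideal_set_def
proof (intro conjI ballI allI)
  show "0 \<in> ?J" by (rule CollectI, rule exI[of _ "\<lambda>_. 0"]) simp
  show "p + q \<in> ?J" if pq: "p \<in> ?J" "q \<in> ?J" for p q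
  proof -
    obtain h h' where "p = (\<Sum>i\<in>I. h i * \<Gamma> i)" "q = (\<Sum>i\<in>I. h' i * \<Gamma> i)" using pq by blast
    then have "p + q = (\<Sum>i\<in>I. (h i + h' i) * \<Gamma> i)" by (simp add: sum.distrib algebra_simps)
    then show ?thesis by (intro CollectI exI[of _ "\<lambda>i. h i + h' i"]) simp
  qed
  show "q * p \<in> ?J" if p: "p \<in> ?J" for p q
  proof -
    obtain h where "p = (\<Sum>i\<in>I. h i * \<Gamma> i)" using p by blast
    then have "q * p = (\<Sum>i\<in>I. (q * h i) * \<Gamma> i)" by (simp add: sum_distrib_left algebra_simps)
    then show ?thesis by (intro CollectI exI[of _ "\<lambda>i. q * h i"]) simp
  qed
qed

text \<open>The Nullstellensatz puts all monomials of large degree into the ideal, and taking degree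
  d components makes the cofactors homogeneous. Generators of degree above d get cofactor 0, since
  truncated subtraction would give a wrong degree.\<close>

lemma homog_ideal_contains_power:
  fixes \<Gamma> :: "'i \<Rightarrow> ('v::finite, 'k::field) mpoly"
  assumes alg: "alg_closed TYPE('k)" and homog: "\<And>i. i \<in> I \<Longrightarrow> homog (\<delta> i) (\<Gamma> i)"
    and no_zero: "\<And>a. (\<And>i. i \<in> I \<Longrightarrow> mp_eval (\<Gamma> i) a = 0) \<Longrightarrow> a = (\<lambda>_. 0)"
    and I: "finite I"
  shows "\<exists>N. \<forall>d\<ge>N. \<forall>p. homog d p \<longrightarrow>
    (\<exists>h. p = (\<Sum>i\<in>I. h i * \<Gamma> i) \<and> (\<forall>i\<in>I. h i \<noteq> 0 \<longrightarrow> \<delta> i \<le> d \<and> homog (d - \<delta> i) (h i)))"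
proof -
  define J where "J = {(\<Sum>i\<in>I. h i * \<Gamma> i) | h. True}"
  have "ideal_set J" unfolding J_def by (rule ideal_set_combinations)
  have hcomp_comb: "hcomp d (\<Sum>i\<in>I. h i * \<Gamma> i)
      = (\<Sum>i\<in>I. (if \<delta> i \<le> d then hcomp (d - \<delta> i) (h i) else 0) * \<Gamma> i)" for h d
    unfolding hcomp_sum by (rule sum.cong) (simp_all add: hcomp_mult_homog[OF homog])
  have "hcomp d p \<in> J" if "p \<in> J" for p d
  proof -
    obtain h where h: "p = (\<Sum>i\<in>I. h i * \<Gamma> i)" using \<open>p \<in> J\<close> by (auto simp: J_def)
    show ?thesis unfolding h hcomp_comb J_def by (rule CollectI, rule exI) (rule conjI[OF refl TrueI])
  qed
  moreover have "a = (\<lambda>_. 0)" if "\<And>p. p \<in> J \<Longrightarrow> mp_eval p a = 0" for a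
  proof (rule no_zero)
    fix i assume i: "i \<in> I"
    have "(\<Sum>j\<in>I. (if j = i then 1 else 0) * \<Gamma> j) = \<Gamma> i"
      using I i by (simp add: if_distrib[of "\<lambda>x. x * _"] cong: if_cong)
    then have "\<Gamma> i \<in> J"
      unfolding J_def by (intro CollectI exI[of _ "\<lambda>j. if j = i then 1 else 0"]) auto
    then show "mp_eval (\<Gamma> i) a = 0" by (rule that)
  qed
  ultimately obtain N where N: "\<And>m. N \<le> mon_deg m \<Longrightarrow> mon m \<in> J"
    using projective_nullstellensatz[OF alg \<open>ideal_set J\<close>] by blast
  have "\<exists>h. p = (\<Sum>i\<in>I. h i * \<Gamma> i) \<and> (\<forall>i\<in>I. h i \<noteq> 0 \<longrightarrow> \<delta> i \<le> d \<and> homog (d - \<delta> i) (h i))"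
    if "N \<le> d" "homog d p" for d p
  proof -
    have "(\<Sum>m\<in>keys p. const_mp (lookup p m) * mon m) \<in> J"
      using that N by (intro ideal_set_sum[OF \<open>ideal_set J\<close>] ideal_setD(3)[OF \<open>ideal_set J\<close>])
        (auto simp: homog_def mons_def)
    then have "p \<in> J" by (simp add: mpoly_conv_mon[of "keys p" p, symmetric])
    then obtain h where h: "p = (\<Sum>i\<in>I. h i * \<Gamma> i)" by (auto simp: J_def)
    have "p = hcomp d p" using that by (simp add: hcomp_homog)
    also have "\<dots> = (\<Sum>i\<in>I. (if \<delta> i \<le> d then hcomp (d - \<delta> i) (h i) else 0) * \<Gamma> i)"
      by (subst h) (rule hcomp_comb)
    finally show ?thesis
      by (intro exI[of _ "\<lambda>i. if \<delta> i \<le> d then hcomp (d - \<delta> i) (h i) else 0"]) auto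
  qed
  then show ?thesis by blast
qed

text \<open>By the Nullstellensatz the multiples of the \<open>\<Gamma> i f\<close> span some degree
  N. For this fixed N spanning is a rank condition on g, and it excludes nontrivial zeros in turn,
  since the N-th powers of all variables are then combinations of the
  \<open>\<Gamma> i g\<close>.\<close>

theorem projective_elimination:
  fixes \<Gamma> :: "'i \<Rightarrow> (nat \<Rightarrow> ('n, 'k::field) mpoly) \<Rightarrow> ('v::finite, 'k) mpoly"
  assumes alg: "alg_closed TYPE('k)" and I: "finite I" and homog: "\<And>i g. i \<in> I \<Longrightarrow> homog (\<delta> i) (\<Gamma> i g)"
    and pf: "\<And>i m. i \<in> I \<Longrightarrow> polyfun (\<lambda>g. lookup (\<Gamma> i g) m)"
    and no_zero: "\<And>a. (\<And>i. i \<in> I \<Longrightarrow> mp_eval (\<Gamma> i f) a = 0) \<Longrightarrow> a = (\<lambda>_. 0)"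
  shows "\<exists>G. polyfun G \<and> G f \<noteq> 0 \<and>
    (\<forall>g. G g \<noteq> 0 \<longrightarrow> (\<forall>a. (\<forall>i\<in>I. mp_eval (\<Gamma> i g) a = 0) \<longrightarrow> a = (\<lambda>_. 0)))"
proof -
  obtain N where N: "\<And>p. homog N p \<Longrightarrow> \<exists>h. p = (\<Sum>i\<in>I. h i * \<Gamma> i f) \<and>
      (\<forall>i\<in>I. h i \<noteq> 0 \<longrightarrow> \<delta> i \<le> N \<and> homog (N - \<delta> i) (h i))"
    using homog_ideal_contains_power[where \<Gamma> = "\<lambda>i. \<Gamma> i f", OF alg homog no_zero I] by blast
  define K where "K = (SIGMA i:{i\<in>I. \<delta> i \<le> N}. (mons (N - \<delta> i) :: 'v expo set))"
  define w where "w = (\<lambda>(i, m) g. mon m * \<Gamma> i g)"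
  have "\<exists>G. polyfun G \<and> G f \<noteq> 0 \<and>
    (\<forall>g\<in>UNIV. G g \<noteq> 0 \<longrightarrow> (\<forall>p. homog N p \<longrightarrow> p \<in> mp.span ((\<lambda>\<kappa>. w \<kappa> g) ` K)))"
  proof (rule polyfun_span_open)
    show "finite K" unfolding K_def using I by (intro finite_SigmaI) auto
    show "homog N (w \<kappa> g)" if "\<kappa> \<in> K" for \<kappa> g
    proof -
      obtain i m where \<kappa>: "\<kappa> = (i, m)" "i \<in> I" "\<delta> i \<le> N" "mon_deg m = N - \<delta> i"
        using \<open>\<kappa> \<in> K\<close> by (auto simp: K_def mons_def)
      have "homog (N - \<delta> i + \<delta> i) (mon m * \<Gamma> i g)"
        using \<kappa> homog by (intro homog_mult homog_mon) auto
      then show ?thesis using \<kappa> by (simp add: w_def)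
    qed
    show "polyfun (\<lambda>g. lookup (w \<kappa> g) m)" if "\<kappa> \<in> K" for \<kappa> m
      using that pf by (auto simp: K_def w_def intro!: polyfun_lookup_mon_mult)
    show "p \<in> mp.span ((\<lambda>\<kappa>. w \<kappa> f) ` K)" if p: "homog N p" for p
    proof -
      obtain h where h: "p = (\<Sum>i\<in>I. h i * \<Gamma> i f)"
        "\<And>i. i \<in> I \<Longrightarrow> h i \<noteq> 0 \<Longrightarrow> \<delta> i \<le> N \<and> homog (N - \<delta> i) (h i)"
        using N[OF p] by blast
      have "h i * \<Gamma> i f \<in> mp.span ((\<lambda>\<kappa>. w \<kappa> f) ` K)" if i: "i \<in> I" for i
      proof (cases "h i = 0")
        case False
        then have *: "\<delta> i \<le> N" "homog (N - \<delta> i) (h i)" using h(2) i by auto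
        then have "h i = (\<Sum>m\<in>mons (N - \<delta> i). const_mp (lookup (h i) m) * mon m)"
          by (intro mpoly_conv_mon) (auto simp: homog_def)
        then have "h i * \<Gamma> i f = (\<Sum>m\<in>mons (N - \<delta> i). const_mp (lookup (h i) m) * w (i, m) f)"
          by (simp add: w_def sum_distrib_right[symmetric] mult.assoc[symmetric])
        also have "\<dots> \<in> mp.span ((\<lambda>\<kappa>. w \<kappa> f) ` K)"
          using * i by (intro mp.span_sum mp.span_scale mp.span_base imageI) (auto simp: K_def)
        finally show ?thesis .
      qed (simp add: mp.span_zero)
      then show ?thesis unfolding h(1) by (intro mp.span_sum) auto
    qed
  qed auto
  then obtain G where G: "polyfun G" "G f \<noteq> 0"
    "\<And>g p. G g \<noteq> 0 \<Longrightarrow> homog N p \<Longrightarrow> p \<in> mp.span ((\<lambda>\<kappa>. w \<kappa> g) ` K)"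
    by blast
  have "a = (\<lambda>_. 0)" if g: "G g \<noteq> 0" and zero: "\<forall>i\<in>I. mp_eval (\<Gamma> i g) a = 0" for g a
  proof
    fix u
    have "mp_eval p a = 0" if "p \<in> mp.span ((\<lambda>\<kappa>. w \<kappa> g) ` K)" for p
      using that
    proof (induction rule: mp.span_induct_alt)
      case (step c x y)
      then show ?case using zero by (auto simp: mp_eval_simps K_def w_def)
    qed (simp add: mp_eval_simps)
    moreover have "mon (single u N) \<in> mp.span ((\<lambda>\<kappa>. w \<kappa> g) ` K)"
      by (rule G(3)[OF g homog_mon]) simp
    ultimately have "mp_eval (mon (single u N)) a = 0" by blast
    then show "a u = 0" by simp
  qed
  with G(1,2) show ?thesis by blast
qed

section \<open>Products of linear forms\<close>

lemma hcomp_mult: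
  "hcomp d (a * b) = (\<Sum>j\<le>d. hcomp (d - j) a * hcomp j b)"
proof -
  obtain D where D: "\<And>m. m \<in> keys b \<Longrightarrow> mon_deg m \<le> D"
    using ex_mon_deg_bound by metis
  have "b = (\<Sum>j\<le>d + D. hcomp j b)"
    by (rule sum_hcomp[symmetric]) (use D in \<open>auto intro: le_SucI trans_le_add2\<close>)
  then have "hcomp d (a * b) = hcomp d (a * (\<Sum>j\<le>d + D. hcomp j b))" by simp
  also have "\<dots> = (\<Sum>j\<le>d + D. if j \<le> d then hcomp (d - j) a * hcomp j b else 0)"
    by (simp add: sum_distrib_left hcomp_sum hcomp_mult_homog[OF homog_hcomp])
  also have "\<dots> = (\<Sum>j\<le>d. hcomp (d - j) a * hcomp j b)"
    by (rule sum.mono_neutral_cong_right) auto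
  finally show ?thesis .
qed

lemma hcomp_mult_eq:
  assumes "\<And>i' j'. i' + j' = i + j \<Longrightarrow> j' \<noteq> j \<Longrightarrow> hcomp i' a = 0 \<or> hcomp j' b = 0"
  shows "hcomp (i + j) (a * b) = hcomp i a * hcomp j b"
proof -
  have "hcomp (i + j) (a * b) = (\<Sum>j'\<le>i + j. if j' = j then hcomp i a * hcomp j b else 0)"
    unfolding hcomp_mult
  proof (rule sum.cong)
    fix j' assume "j' \<in> {..i + j}"
    then show "hcomp (i + j - j') a * hcomp j' b = (if j' = j then hcomp i a * hcomp j b else 0)"
      using assms[of "i + j - j'" j'] by auto
  qed simp
  then show ?thesis by simp
qed

lemma ex_lowest_hcomp:
  assumes "p \<noteq> 0"
  obtains i where "hcomp i p \<noteq> 0" "\<And>j. j < i \<Longrightarrow> hcomp j p = 0"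
proof -
  obtain D where "\<And>m. m \<in> keys p \<Longrightarrow> mon_deg m \<le> D"
    using ex_mon_deg_bound by metis
  then have "\<exists>i. hcomp i p \<noteq> 0"
    using assms sum_hcomp[of p D] by (metis sum.neutral)
  then show ?thesis
    using that[of "LEAST i. hcomp i p \<noteq> 0"] by (metis (mono_tags, lifting) LeastI not_less_Least)
qed

lemma ex_highest_hcomp:
  assumes "p \<noteq> 0"
  obtains i where "hcomp i p \<noteq> 0" "\<And>j. i < j \<Longrightarrow> hcomp j p = 0"
proof -
  obtain D where D: "\<And>m. m \<in> keys p \<Longrightarrow> mon_deg m \<le> D"
    using ex_mon_deg_bound by metis
  then have bound: "hcomp j p \<noteq> 0 \<Longrightarrow> j \<le> D" for j
    by (auto simp: poly_mapping_eq_iff fun_eq_iff lookup_hcomp when_def in_keys_iff split: if_splits)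
  obtain i where "hcomp i p \<noteq> 0"
    using ex_lowest_hcomp[OF assms] by metis
  then have "\<exists>i. hcomp i p \<noteq> 0 \<and> (\<forall>j. hcomp j p \<noteq> 0 \<longrightarrow> j \<le> i)"
    using bound Greatest_le_nat[of "\<lambda>i. hcomp i p \<noteq> 0" _ D] GreatestI_nat[of "\<lambda>i. hcomp i p \<noteq> 0" _ D]
    by blast
  then show ?thesis using that by (metis not_less)
qed

text \<open>The product of the lowest components and that of the highest components of a and b are
  nonzero components of a * b, hence both of degree d. So for each factor the lowest and the highest
  degree agree.\<close>

lemma homog_factors:
  fixes a b :: "('v::finite, 'k::field) mpoly"
  assumes "homog d (a * b)" "a * b \<noteq> 0"
  obtains i j where "homog i a" "homog j b" "i + j = d"
proof -
  have nz: "a \<noteq> 0" "b \<noteq> 0" using assms(2) by auto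
  obtain i0 where i0: "hcomp i0 a \<noteq> 0" "\<And>j. j < i0 \<Longrightarrow> hcomp j a = 0"
    using ex_lowest_hcomp[OF nz(1)] by metis
  obtain j0 where j0: "hcomp j0 b \<noteq> 0" "\<And>j. j < j0 \<Longrightarrow> hcomp j b = 0"
    using ex_lowest_hcomp[OF nz(2)] by metis
  obtain i1 where i1: "hcomp i1 a \<noteq> 0" "\<And>j. i1 < j \<Longrightarrow> hcomp j a = 0"
    using ex_highest_hcomp[OF nz(1)] by metis
  obtain j1 where j1: "hcomp j1 b \<noteq> 0" "\<And>j. j1 < j \<Longrightarrow> hcomp j b = 0"
    using ex_highest_hcomp[OF nz(2)] by metis
  have "hcomp (i0 + j0) (a * b) = hcomp i0 a * hcomp j0 b"
  proof (rule hcomp_mult_eq)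
    fix i' j' assume "i' + j' = i0 + j0" "j' \<noteq> j0"
    then have "i' < i0 \<or> j' < j0" by linarith
    then show "hcomp i' a = 0 \<or> hcomp j' b = 0" using i0(2) j0(2) by blast
  qed
  then have "hcomp (i0 + j0) (a * b) \<noteq> 0"
    using i0(1) j0(1) by (simp add: mpoly_mult_eq_0_iff)
  then have 0: "i0 + j0 = d"
    using hcomp_homog[OF assms(1)] by metis
  have "hcomp (i1 + j1) (a * b) = hcomp i1 a * hcomp j1 b"
  proof (rule hcomp_mult_eq)
    fix i' j' assume "i' + j' = i1 + j1" "j' \<noteq> j1"
    then have "i1 < i' \<or> j1 < j'" by linarith
    then show "hcomp i' a = 0 \<or> hcomp j' b = 0" using i1(2) j1(2) by blast
  qed
  then have "hcomp (i1 + j1) (a * b) \<noteq> 0"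
    using i1(1) j1(1) by (simp add: mpoly_mult_eq_0_iff)
  then have 1: "i1 + j1 = d"
    using hcomp_homog[OF assms(1)] by metis
  have "i0 \<le> i1" "j0 \<le> j1"
    using i0 i1 j0 j1 by (meson not_less)+
  with 0 1 have eq: "i1 = i0" "j1 = j0" by auto
  have only: "homog i p" if "\<And>j. j < i \<Longrightarrow> hcomp j p = 0" "\<And>j. i < j \<Longrightarrow> hcomp j p = 0"
    for i and p :: "('v, 'k) mpoly"
    unfolding homog_def
  proof
    fix m assume m: "m \<in> keys p"
    then have "lookup (hcomp (mon_deg m) p) m \<noteq> 0" by (simp add: lookup_hcomp in_keys_iff)
    then have "\<not> mon_deg m < i" "\<not> i < mon_deg m" using that by force+
    then show "m \<in> mons i" by (simp add: mons_def)
  qed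
  show ?thesis
    by (rule that[of i0 j0]) (use 0 only i0 i1 j0 j1 eq in auto)
qed

section \<open>Linear forms and reducible quadratic forms\<close>

definition lin :: "('v::finite \<Rightarrow> 'k::comm_ring_1) \<Rightarrow> ('v, 'k) mpoly" where
  "lin x = (\<Sum>v\<in>UNIV. const_mp (x v) * var v)"

lemma mons_1: "mons (Suc 0) = range (\<lambda>v. single v (Suc 0))"
proof (intro equalityI subsetI)
  fix m :: "'a expo" assume "m \<in> mons (Suc 0)"
  then have m: "mon_deg m = Suc 0" by (simp add: mons_def)
  then obtain v where v: "v \<in> keys m"
    by (metis keys_eq_empty mon_deg_eq_0_iff equals0I old.nat.distinct(1))
  have "Suc 0 \<le> lookup m v" using v by (simp add: in_keys_iff Suc_leI)
  then obtain m' where "m = m' + single v (Suc 0)" by (rule mon_split_var)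
  with m show "m \<in> range (\<lambda>v. single v (Suc 0))" by simp
qed (auto simp: mons_def)

lemma homog_lin: "homog (Suc 0) (lin x)"
  unfolding lin_def by (intro homog_sum homog_const_mult homog_mon) simp

lemma single_eq_single_iff [simp]: "single u (Suc 0) = single v (Suc 0) \<longleftrightarrow> u = v"
  by (metis keys_single old.nat.distinct(1) singleton_inject)

lemma lookup_lin: "lookup (lin x) (single v (Suc 0)) = x v"
  by (simp add: lin_def lookup_sum lookup_single when_def if_distrib cong: if_cong)

lemma lin_eq_0_iff [simp]: "lin x = 0 \<longleftrightarrow> x = (\<lambda>_. 0)"
proof
  assume "lin x = 0"
  then have "x v = 0" for v using lookup_lin[of x v] by simp
  then show "x = (\<lambda>_. 0)" by auto
qed (simp add: lin_def)

lemma homog_1_eq_lin: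
  assumes "homog (Suc 0) p"
  shows "p = lin (\<lambda>v. lookup p (single v (Suc 0)))"
  by (rule homog_eqI[OF assms homog_lin]) (auto simp: mons_1 lookup_lin)

lemma homog_0_eq_const:
  assumes "homog 0 p"
  shows "p = const_mp (lookup p 0)"
  by (rule homog_eqI[OF assms homog_const]) (auto simp: mons_def const_mp_def)

lemma not_unit_if_homog:
  fixes p :: "('v, 'k::field) mpoly"
  assumes "homog d p" "d > 0"
  shows "\<not> p dvd 1"
proof
  assume "p dvd 1"
  then obtain q where "1 = p * q" by (elim dvdE)
  then have "mp_eval p (\<lambda>_. 0) * mp_eval q (\<lambda>_. 0) = 1"
    by (metis mp_eval_simps(1,3))
  then show False using mp_eval_eq_0_at_0[OF assms] by simp
qed

text \<open>Factors of a nonzero form are forms: degrees 0 and 2 make one factor a unit, degrees 1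
  and 1 leave a product of linear forms.\<close>

lemma irreducible_quad_form_iff:
  fixes p :: "('v::finite, 'k::field) mpoly"
  assumes "homog 2 p" "p \<noteq> 0"
  shows "irreducible p \<longleftrightarrow> \<not> (\<exists>x y. p = lin x * lin y)"
proof
  assume irr: "irreducible p"
  show "\<not> (\<exists>x y. p = lin x * lin y)"
  proof
    assume "\<exists>x y. p = lin x * lin y"
    then obtain x y where "p = lin x * lin y" by blast
    then have "lin x dvd 1 \<or> lin y dvd 1"
      using irr by (auto simp: irreducible_def)
    then show False
      using not_unit_if_homog[OF homog_lin] by auto
  qed
next
  assume no: "\<not> (\<exists>x y. p = lin x * lin y)"
  show "irreducible p"
  proof (rule irreducibleI)
    show "\<not> p dvd 1" by (rule not_unit_if_homog[OF assms(1)]) simp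
    fix a b assume p: "p = a * b"
    obtain i j where ij: "homog i a" "homog j b" "i + j = 2"
      using homog_factors assms p by metis
    have unit: "q dvd 1" if "homog 0 q" "q \<noteq> 0" for q :: "('v, 'k) mpoly"
    proof -
      obtain c where c: "q = const_mp c" using homog_0_eq_const[OF \<open>homog 0 q\<close>] by blast
      then have "c \<noteq> 0" using that(2) by auto
      then have "1 = q * const_mp (inverse c)"
        by (simp add: c const_mp_mult[symmetric])
      then show ?thesis by (rule dvdI)
    qed
    have "a \<noteq> 0" "b \<noteq> 0" using p assms(2) by auto
    consider "i = 0" | "j = 0" | "i = Suc 0" "j = Suc 0" using ij(3) by linarith
    then show "a dvd 1 \<or> b dvd 1"
    proof cases
      case 3
      then have "p = lin (\<lambda>v. lookup a (single v (Suc 0))) * lin (\<lambda>v. lookup b (single v (Suc 0)))"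
        using ij homog_1_eq_lin[of a] homog_1_eq_lin[of b] p by simp
      with no show ?thesis by blast
    qed (use ij unit \<open>a \<noteq> 0\<close> \<open>b \<noteq> 0\<close> in auto)
  qed (use assms in auto)
qed

lemma lin_mult_lin:
  "lin x * lin y = (\<Sum>u\<in>UNIV. \<Sum>v\<in>UNIV. const_mp (x u * y v) * mon (single u (Suc 0) + single v (Suc 0)))"
  by (simp add: lin_def sum_product const_mp_mult mon_add algebra_simps)

lemma homog_lin_mult_lin: "homog 2 (lin x * lin y)"
  using homog_mult[OF homog_lin homog_lin, of x y] by (simp add: numeral_2_eq_2)

text \<open>This makes membership of a product of linear forms in a linear space a system of
  bilinear equations.\<close>

lemma pairing_lin_mult_lin:
  fixes x y :: "'v::finite \<Rightarrow> 'k::comm_ring_1"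
  shows "(\<Sum>m\<in>mons 2. \<phi> m * lookup (lin x * lin y) m)
    = (\<Sum>u\<in>UNIV. \<Sum>v\<in>UNIV. \<phi> (single u (Suc 0) + single v (Suc 0)) * (x u * y v))"
proof -
  have mem: "single u (Suc 0) + single v (Suc 0) \<in> mons 2" for u v :: 'v
    by (simp add: mons_def)
  have "(\<Sum>m\<in>mons 2. \<phi> m * lookup (lin x * lin y) m)
      = (\<Sum>u\<in>UNIV. \<Sum>v\<in>UNIV. \<Sum>m\<in>mons 2. \<phi> m * (x u * y v * lookup (mon (single u (Suc 0) + single v (Suc 0))) m))"
    by (simp add: lin_mult_lin lookup_sum sum_distrib_left sum.swap[of _ "mons 2"])
  also have "\<dots> = (\<Sum>u\<in>UNIV. \<Sum>v\<in>UNIV. \<phi> (single u (Suc 0) + single v (Suc 0)) * (x u * y v))"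
    using mem by (simp add: lookup_single when_def if_distrib cong: if_cong)
  finally show ?thesis .
qed

text \<open>Pairs of vectors are encoded by rank one matrices, cut out by the \<open>2 \<times> 2\<close> minors in the
  polynomial ring with variables \<open>'v \<times> 'v\<close>.\<close>

fun segre_gen :: "('s \<Rightarrow> 'v::finite \<Rightarrow> 'v \<Rightarrow> 'k::comm_ring_1) \<Rightarrow> 's + 'v \<times> 'v \<times> 'v \<times> 'v \<Rightarrow> ('v \<times> 'v, 'k) mpoly" where
  "segre_gen \<beta> (Inl s) = (\<Sum>(u, v)\<in>UNIV. const_mp (\<beta> s u v) * var (u, v))"
| "segre_gen \<beta> (Inr (u, v, u', v')) = var (u, v) * var (u', v') - var (u, v') * var (u', v)"

definition segre_deg :: "'s + 'r \<Rightarrow> nat" where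
  "segre_deg i = (case i of Inl _ \<Rightarrow> 1 | Inr _ \<Rightarrow> 2)"

definition bilin :: "('v::finite \<Rightarrow> 'v \<Rightarrow> 'k::comm_ring_1) \<Rightarrow> ('v \<Rightarrow> 'k) \<Rightarrow> ('v \<Rightarrow> 'k) \<Rightarrow> 'k" where
  "bilin b x y = (\<Sum>u\<in>UNIV. \<Sum>v\<in>UNIV. b u v * (x u * y v))"

lemma homog_segre_gen: "homog (segre_deg i) (segre_gen \<beta> i)"
proof (cases i)
  case (Inl s)
  then show ?thesis
    by (auto simp: segre_deg_def intro!: homog_sum homog_const_mult homog_mon)
next
  case (Inr r)
  obtain u v u' v' where "r = (u, v, u', v')" by (cases r) auto
  with Inr show ?thesis
    by (auto simp: segre_deg_def mon_add[symmetric] intro!: homog_diff homog_mon)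
qed

lemma polyfun_lookup_segre_gen:
  assumes "\<And>s u v. Inl s \<in> I \<Longrightarrow> polyfun (\<lambda>g. \<beta> g s u v)" "i \<in> I"
  shows "polyfun (\<lambda>g. lookup (segre_gen (\<beta> g) i) m)"
proof (cases i)
  case (Inl s)
  then show ?thesis
    using assms by (auto simp: lookup_sum case_prod_beta intro!: polyfun_sum polyfun_mult)
next
  case (Inr r)
  obtain u v u' v' where "r = (u, v, u', v')" by (cases r) auto
  with Inr show ?thesis by simp
qed

lemma mp_eval_segre_gen_rank_one:
  "mp_eval (segre_gen \<beta> (Inl s)) (\<lambda>(u, v). x u * y v) = bilin (\<beta> s) x y"
  "mp_eval (segre_gen \<beta> (Inr r)) (\<lambda>(u, v). x u * y v) = 0"
proof -
  show "mp_eval (segre_gen \<beta> (Inl s)) (\<lambda>(u, v). x u * y v) = bilin (\<beta> s) x y"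
    by (simp add: mp_eval_sum mp_eval_simps case_prod_beta bilin_def sum.cartesian_product)
  obtain u v u' v' where "r = (u, v, u', v')" by (cases r) auto
  then show "mp_eval (segre_gen \<beta> (Inr r)) (\<lambda>(u, v). x u * y v) = 0"
    by (simp add: mp_eval_simps)
qed

text \<open>The column and the scaled row through a nonzero entry of z serve as x and y.\<close>

lemma segre_zero_rank_one:
  fixes z :: "'v::finite \<times> 'v \<Rightarrow> 'k::field"
  assumes "\<And>r. mp_eval (segre_gen \<beta> (Inr r)) z = 0" "z \<noteq> (\<lambda>_. 0)"
  obtains x y where "z = (\<lambda>(u, v). x u * y v)" "x \<noteq> (\<lambda>_. 0)" "y \<noteq> (\<lambda>_. 0)"
proof -
  obtain u0 v0 where z0: "z (u0, v0) \<noteq> 0"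
    using assms(2) by (metis surj_pair ext)
  define x where "x u = z (u, v0)" for u
  define y where "y v = z (u0, v) / z (u0, v0)" for v
  show ?thesis
  proof
    have "z (u, v) * z (u0, v0) = z (u, v0) * z (u0, v)" for u v
      using assms(1)[of "(u, v, u0, v0)"] by (simp add: mp_eval_simps)
    then show "z = (\<lambda>(u, v). x u * y v)"
      using z0 by (auto simp: x_def y_def field_simps)
    have "x u0 \<noteq> 0" "y v0 \<noteq> 0" using z0 by (auto simp: x_def y_def)
    then show "x \<noteq> (\<lambda>_. 0)" "y \<noteq> (\<lambda>_. 0)" by auto
  qed
qed

definition segre_index :: "'s set \<Rightarrow> ('s + 'v \<times> 'v \<times> 'v \<times> 'v) set" where
  "segre_index S = Inl ` S \<union> range Inr"

lemma segre_no_zero: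
  fixes \<beta> :: "'s \<Rightarrow> 'v::finite \<Rightarrow> 'v \<Rightarrow> 'k::field"
  assumes "\<And>x y. x \<noteq> (\<lambda>_. 0) \<Longrightarrow> y \<noteq> (\<lambda>_. 0) \<Longrightarrow> \<exists>s\<in>S. bilin (\<beta> s) x y \<noteq> 0"
    and zero: "\<And>i. i \<in> segre_index S \<Longrightarrow> mp_eval (segre_gen \<beta> i) z = 0"
  shows "z = (\<lambda>_. 0)"
proof (rule ccontr)
  assume "z \<noteq> (\<lambda>_. 0)"
  have "mp_eval (segre_gen \<beta> (Inr r)) z = 0" for r
    using zero by (auto simp: segre_index_def)
  from segre_zero_rank_one[OF this \<open>z \<noteq> _\<close>] obtain x y where
    xy: "z = (\<lambda>(u, v). x u * y v)" "x \<noteq> (\<lambda>_. 0)" "y \<noteq> (\<lambda>_. 0)" by metis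
  obtain s where "s \<in> S" "bilin (\<beta> s) x y \<noteq> 0" using assms(1) xy by blast
  with zero[of "Inl s"] xy(1) show False
    by (simp add: segre_index_def mp_eval_segre_gen_rank_one del: segre_gen.simps)
qed

lemma quad_tuplesD:
  "f \<in> quad_tuples TYPE(('n::finite, 'k::comm_ring_1) mpoly) \<Longrightarrow> homog 2 (f i)"
  by (cases "i < CARD('n)") (auto simp: quad_tuples_def quad_form_iff_homog)

text \<open>The functionals of \<open>cut_out\<close> restricted to products of linear forms. That a
  product in the span is a common zero holds at every g, the converse at f. The number of
  functionals is the codimension of the span.\<close>

lemma quad_tuple_annihilator:
  fixes f :: "nat \<Rightarrow> ('n::finite, 'k::field) mpoly"
  assumes f: "f \<in> quad_tuples TYPE(('n, 'k) mpoly)"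
    and indep: "indep_mp {..<CARD('n)} f"
  obtains S :: "'n expo set" and \<beta> :: "(nat \<Rightarrow> ('n, 'k) mpoly) \<Rightarrow> 'n expo \<Rightarrow> 'n \<Rightarrow> 'n \<Rightarrow> 'k"
  where "finite S" "card S + CARD('n) = card (mons 2 :: 'n expo set)"
    "\<And>s u v. s \<in> S \<Longrightarrow> polyfun (\<lambda>g. \<beta> g s u v)"
    "\<And>g x y s. lin x * lin y \<in> kspan g CARD('n) \<Longrightarrow> s \<in> S \<Longrightarrow> bilin (\<beta> g s) x y = 0"
    "\<And>x y. (\<And>s. s \<in> S \<Longrightarrow> bilin (\<beta> f s) x y = 0) \<Longrightarrow> lin x * lin y \<in> kspan f CARD('n)"
proof -
  let ?n = "CARD('n)" and ?M = "mons 2 :: 'n expo set"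
  have "\<exists>S \<phi>. cut_out ?M ?n (\<lambda>j m g. lookup (g j) m) f S \<phi>"
  proof (rule polyfun_annihilator)
    show "c j = 0" if c: "\<forall>m\<in>?M. (\<Sum>j<?n. c j * lookup (f j) m) = 0" "j < ?n" for c j
    proof (rule indep_familyD[OF indep])
      show "j \<in> {..<?n}" using c(2) by simp
      show "(\<Sum>j<?n. const_mp (c j) * f j) = 0"
        by (rule homog_eqI[of 2])
          (use c(1) in \<open>auto simp: lookup_sum intro!: homog_sum homog_const_mult quad_tuplesD[OF f]\<close>)
    qed
  qed auto
  then obtain S \<phi> where "cut_out ?M ?n (\<lambda>j m g. lookup (g j) m) f S \<phi>" by blast
  then have S: "S \<subseteq> ?M" "card S + ?n = card ?M"
    and pf: "\<And>s m. s \<in> S \<Longrightarrow> m \<in> ?M \<Longrightarrow> polyfun (\<phi> s m)"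
    and ann: "\<And>g s j. s \<in> S \<Longrightarrow> j < ?n \<Longrightarrow> (\<Sum>m\<in>?M. \<phi> s m g * lookup (g j) m) = 0"
    and cut: "\<And>q. (\<forall>s\<in>S. (\<Sum>m\<in>?M. \<phi> s m f * q m) = 0) \<Longrightarrow>
      \<exists>c. \<forall>m\<in>?M. q m = (\<Sum>j<?n. c j * lookup (f j) m)"
    by (simp_all add: cut_out_def)
  define \<beta> where "\<beta> g s u v = \<phi> s (single u (Suc 0) + single v (Suc 0)) g" for g s u v
  have bilin: "bilin (\<beta> g s) x y = (\<Sum>m\<in>?M. \<phi> s m g * lookup (lin x * lin y) m)" for g s x y
    by (simp add: pairing_lin_mult_lin bilin_def \<beta>_def)
  show ?thesis
  proof (rule that[of S \<beta>])
    show "finite S" using S(1) finite_subset by (metis finite_mons)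
    show "card S + ?n = card ?M" by (rule S(2))
    show "polyfun (\<lambda>g. \<beta> g s u v)" if "s \<in> S" for s u v
      unfolding \<beta>_def by (rule pf[OF that]) (simp add: mons_def)
    show "bilin (\<beta> g s) x y = 0" if mem: "lin x * lin y \<in> kspan g ?n" and s: "s \<in> S" for g x y s
    proof -
      obtain c where c: "lin x * lin y = (\<Sum>j<?n. const_mp (c j) * g j)"
        using mem by (auto simp: kspan_def)
      have "bilin (\<beta> g s) x y = (\<Sum>j<?n. c j * (\<Sum>m\<in>?M. \<phi> s m g * lookup (g j) m))"
        unfolding bilin c lookup_sum
        by (simp add: sum_distrib_left mult.left_commute sum.swap[of _ ?M])
      also have "\<dots> = 0" using ann[OF s] by simp
      finally show ?thesis .
    qed
    show "lin x * lin y \<in> kspan f ?n" if zero: "\<And>s. s \<in> S \<Longrightarrow> bilin (\<beta> f s) x y = 0" for x y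
    proof -
      obtain c where c: "\<forall>m\<in>?M. lookup (lin x * lin y) m = (\<Sum>j<?n. c j * lookup (f j) m)"
        using cut[of "lookup (lin x * lin y)"] zero by (auto simp: bilin)
      have "lin x * lin y = (\<Sum>j<?n. const_mp (c j) * f j)"
        by (rule homog_eqI[of 2])
          (use c in \<open>auto simp: lookup_sum intro!: homog_sum homog_const_mult quad_tuplesD[OF f]
            homog_lin_mult_lin\<close>)
      then show ?thesis by (auto simp: kspan_def)
    qed
  qed
qed

text \<open>At f the bilinear forms have no common zero among rank one matrices, so elimination
  yields G. Where G g \<noteq> 0 the forms at g have none either, whereas a product in the span of g
  would be one.\<close>

lemma lin_products_open:
  fixes f :: "nat \<Rightarrow> ('n::finite, 'k::field) mpoly"
  assumes alg: "alg_closed TYPE('k)" and f: "f \<in> quad_tuples TYPE(('n, 'k) mpoly)"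
    and indep: "indep_mp {..<CARD('n)} f"
    and no: "\<And>x y. x \<noteq> (\<lambda>_. 0) \<Longrightarrow> y \<noteq> (\<lambda>_. 0) \<Longrightarrow> lin x * lin y \<notin> kspan f CARD('n)"
  shows "\<exists>G. polyfun G \<and> G f \<noteq> 0 \<and> (\<forall>g. G g \<noteq> 0 \<longrightarrow>
    (\<forall>x y. x \<noteq> (\<lambda>_. 0) \<longrightarrow> y \<noteq> (\<lambda>_. 0) \<longrightarrow> lin x * lin y \<notin> kspan g CARD('n)))"
proof -
  obtain S :: "'n expo set" and \<beta> where S: "finite S"
    and pf: "\<And>s u v. s \<in> S \<Longrightarrow> polyfun (\<lambda>g. \<beta> g s u v)"
    and ann: "\<And>g x y s. lin x * lin y \<in> kspan g CARD('n) \<Longrightarrow> s \<in> S \<Longrightarrow> bilin (\<beta> g s) x y = 0"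
    and cut: "\<And>x y. (\<And>s. s \<in> S \<Longrightarrow> bilin (\<beta> f s) x y = 0) \<Longrightarrow> lin x * lin y \<in> kspan f CARD('n)"
    by (rule quad_tuple_annihilator[OF f indep]) auto
  have "\<exists>G. polyfun G \<and> G f \<noteq> 0 \<and>
    (\<forall>g. G g \<noteq> 0 \<longrightarrow> (\<forall>z. (\<forall>i\<in>segre_index S. mp_eval (segre_gen (\<beta> g) i) z = 0) \<longrightarrow> z = (\<lambda>_. 0)))"
  proof (rule projective_elimination[OF alg, where \<delta> = segre_deg and \<Gamma> = "\<lambda>i g. segre_gen (\<beta> g) i"])
    show "finite (segre_index S :: ('n expo + 'n \<times> 'n \<times> 'n \<times> 'n) set)"
      using S by (simp add: segre_index_def)
    show "homog (segre_deg i) (segre_gen (\<beta> g) i)" for i g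
      by (rule homog_segre_gen)
    show "polyfun (\<lambda>g. lookup (segre_gen (\<beta> g) i) m)" if "i \<in> segre_index S" for i m
      by (rule polyfun_lookup_segre_gen[OF _ that]) (auto simp: segre_index_def intro: pf)
    show "z = (\<lambda>_. 0)" if "\<And>i. i \<in> segre_index S \<Longrightarrow> mp_eval (segre_gen (\<beta> f) i) z = 0" for z
      by (rule segre_no_zero[OF _ that]) (use no cut in blast)
  qed
  then obtain G where G: "polyfun G" "G f \<noteq> 0"
    "\<And>g z. G g \<noteq> 0 \<Longrightarrow> (\<forall>i\<in>segre_index S. mp_eval (segre_gen (\<beta> g) i) z = 0) \<Longrightarrow> z = (\<lambda>_. 0)"
    by blast
  have "lin x * lin y \<notin> kspan g CARD('n)" if g: "G g \<noteq> 0" and xy: "x \<noteq> (\<lambda>_. 0)" "y \<noteq> (\<lambda>_. 0)" for g x y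
  proof
    assume mem: "lin x * lin y \<in> kspan g CARD('n)"
    have "(\<lambda>(u, v). x u * y v) = (\<lambda>_. 0)"
    proof (rule G(3)[OF g], rule ballI)
      fix i :: "'n expo + 'n \<times> 'n \<times> 'n \<times> 'n" assume "i \<in> segre_index S"
      then show "mp_eval (segre_gen (\<beta> g) i) (\<lambda>(u, v). x u * y v) = 0"
        using ann[OF mem] by (auto simp: segre_index_def mp_eval_segre_gen_rank_one simp del: segre_gen.simps)
    qed
    then have "x u * y v = 0" for u v by (metis case_prod_conv)
    then show False using xy by (metis ext mult_eq_0_iff)
  qed
  with G show ?thesis by blast
qed

section \<open>Common zeros of bilinear forms\<close>

lemma mon_ev_sum: "mon_ev x (\<Sum>i\<in>A. f i) = (\<Prod>i\<in>A. mon_ev x (f i))"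
  by (induction A rule: infinite_finite_induct) (simp_all add: mon_ev_add)

lemma mon_deg_sum: "mon_deg (\<Sum>i\<in>A. f i) = (\<Sum>i\<in>A. mon_deg (f i))"
  by (induction A rule: infinite_finite_induct) simp_all

lemma prod_monom: "(\<Prod>i\<in>A. monom (1 :: 'a::comm_semiring_1) (f i)) = monom 1 (\<Sum>i\<in>A. f i)"
  by (induction A rule: infinite_finite_induct) (simp_all add: mult_monom)

lemma sum_lessThan_add: "(\<Sum>i<a + b. f i) = (\<Sum>i<a. f i) + (\<Sum>i<b. f (a + i :: nat) :: 'a::comm_monoid_add)"
  by (induction b) (simp_all add: add.assoc)

lemma sum_if_less: "g \<le> t \<Longrightarrow> (\<Sum>c<t. if c < g then x else 0) = g * (x :: nat)"
  by (subst sum.mono_neutral_cong_right[of _ "{..<g}" _ "\<lambda>_. x"]) auto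

lemma sum_digits: "(\<Sum>i<k. (e div B ^ i mod B) * B ^ i) = e mod (B ^ k :: nat)"
proof (induction k)
  case (Suc k)
  then show ?case
    using mod_mult2_eq[of e "B ^ k" B] by (simp add: mult.commute)
qed simp

text \<open>The monomials of degree d in b 0, ..., b (r - 1), taken as a set of values.\<close>

fun power_products :: "(nat \<Rightarrow> 'a::comm_monoid_mult) \<Rightarrow> nat \<Rightarrow> nat \<Rightarrow> 'a set" where
  "power_products b 0 d = (if d = 0 then {1} else {})"
| "power_products b (Suc r) d = (\<Union>a\<le>d. (\<lambda>q. b r ^ a * q) ` power_products b r (d - a))"

lemma finite_power_products [simp]: "finite (power_products b r d)"
  by (induction r arbitrary: d) auto

text \<open>Of the r + 1 exponents with sum d, r have at most d + 1 choices each and determine the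
  last.\<close>

lemma card_power_products: "card (power_products b (Suc r) d) \<le> (d + 1) ^ r"
proof (induction r arbitrary: d)
  case 0
  have "power_products b (Suc 0) d \<subseteq> {b 0 ^ d}"
    by (auto split: if_splits)
  then show ?case using card_mono[of "{b 0 ^ d}"] by fastforce
next
  case (Suc r)
  have "card (power_products b (Suc (Suc r)) d)
      \<le> (\<Sum>a\<le>d. card ((\<lambda>q. b (Suc r) ^ a * q) ` power_products b (Suc r) (d - a)))"
    unfolding power_products.simps(2)[of b "Suc r"] by (rule card_UN_le) simp
  also have "\<dots> \<le> (\<Sum>a\<le>d. (d + 1) ^ r)"
  proof (rule sum_mono)
    fix a assume "a \<in> {..d}"
    have "card ((\<lambda>q. b (Suc r) ^ a * q) ` power_products b (Suc r) (d - a))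
        \<le> card (power_products b (Suc r) (d - a))"
      by (rule card_image_le) (rule finite_power_products)
    also have "\<dots> \<le> (d - a + 1) ^ r" by (rule Suc)
    also have "\<dots> \<le> (d + 1) ^ r" by (rule power_mono) auto
    finally show "card ((\<lambda>q. b (Suc r) ^ a * q) ` power_products b (Suc r) (d - a)) \<le> (d + 1) ^ r" .
  qed
  finally show ?case by simp
qed

lemma power_products_mult:
  assumes "q \<in> power_products b r d" "i < r"
  shows "b i * q \<in> power_products b r (Suc d)"
  using assms
proof (induction r arbitrary: d q)
  case (Suc r)
  then obtain a q' where a: "a \<le> d" "q' \<in> power_products b r (d - a)" "q = b r ^ a * q'"
    by auto
  show ?case
  proof (cases "i = r")
    case True
    then show ?thesis
      using a by (auto intro!: bexI[of _ "Suc a"] image_eqI[of _ _ q'] simp: mult.assoc)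
  next
    case False
    then have "b i * q' \<in> power_products b r (Suc d - a)"
      using Suc.IH[OF a(2)] Suc.prems(2) a(1) by (simp add: Suc_diff_le)
    then show ?thesis
      using a by (auto intro!: bexI[of _ a] image_eqI[of _ _ "b i * q'"] simp: mult_ac)
  qed
qed simp

lemma one_in_power_products: "1 \<in> power_products b r 0"
  by (induction r) (auto intro: image_eqI[of _ _ 1])

lemma indep_family_monom: "indep_family smult {..<D} (\<lambda>e. monom (1 :: 'k::field) e)"
  unfolding indep_family_def
proof (intro allI impI ballI)
  fix c :: "nat \<Rightarrow> 'k" and e
  assume *: "(\<Sum>i<D. smult (c i) (monom 1 i)) = 0" "e \<in> {..<D}"
  have "coeff (\<Sum>i<D. smult (c i) (monom 1 i)) e = c e"
    using *(2) by (simp add: coeff_sum if_distrib cong: if_cong)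
  with *(1) show "c e = 0" by simp
qed

text \<open>The Segre variety of pairs \<open>(x, y)\<close> has dimension \<open>2 n - 2\<close>. If \<open>r \<le> 2 n - 2\<close> bilinear
  forms had no common zero on it, its coordinate ring would be finite over the \<open>r\<close> forms, so its
  degree \<open>d\<close> part would grow at most like \<open>d ^ (r - 1)\<close>. Substituting powers of one variable
  \<open>t\<close> with exponents given by digits in base \<open>B\<close> exhibits \<open>B ^ (2 n - 2)\<close> independent elements in
  degree \<open>(n - 1) * (B - 1)\<close>.\<close>

theorem bilinear_common_zero:
  fixes \<beta> :: "'s \<Rightarrow> 'v::finite \<Rightarrow> 'v \<Rightarrow> 'k::field"
  assumes alg: "alg_closed TYPE('k)" and S: "finite S" and card_S: "card S + 2 \<le> 2 * CARD('v)"
  shows "\<exists>x y. x \<noteq> (\<lambda>_. 0) \<and> y \<noteq> (\<lambda>_. 0) \<and> (\<forall>s\<in>S. bilin (\<beta> s) x y = 0)"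
proof (rule ccontr)
  assume "\<not> ?thesis"
  then have no: "x \<noteq> (\<lambda>_. 0) \<Longrightarrow> y \<noteq> (\<lambda>_. 0) \<Longrightarrow> \<exists>s\<in>S. bilin (\<beta> s) x y \<noteq> 0" for x y
    by blast
  define n where "n = CARD('v)"
  \<comment> \<open>Without any forms the all-one vectors would contradict \<open>no\<close>.
    Writing \<open>card S\<close> as r + 1 produces the growth exponent r.\<close>
  have "S \<noteq> {}"
    using no[of "\<lambda>_. 1" "\<lambda>_. 1"] by (auto simp: fun_eq_iff)
  then obtain r where r: "card S = Suc r"
    using S by (metis card_eq_0_iff not0_implies_Suc)
  obtain enum where enum: "bij_betw enum {..<Suc r} S"
    using ex_bij_betw_nat_finite[OF S] r by (auto simp: atLeast0LessThan)
  have "\<exists>N. \<forall>d\<ge>N. \<forall>p. homog d p \<longrightarrow> (\<exists>h. p = (\<Sum>i\<in>segre_index S. h i * segre_gen \<beta> i) \<and>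
      (\<forall>i\<in>segre_index S. h i \<noteq> 0 \<longrightarrow> segre_deg i \<le> d \<and> homog (d - segre_deg i) (h i)))"
  proof (rule homog_ideal_contains_power[OF alg])
    show "finite (segre_index S :: ('s + 'v \<times> 'v \<times> 'v \<times> 'v) set)"
      using S by (simp add: segre_index_def)
    show "z = (\<lambda>_. 0)" if "\<And>i. i \<in> segre_index S \<Longrightarrow> mp_eval (segre_gen \<beta> i) z = 0" for z
      by (rule segre_no_zero[OF no that])
  qed (rule homog_segre_gen)
  then obtain N where N: "\<And>d p. N \<le> d \<Longrightarrow> homog d p \<Longrightarrow>
      \<exists>h. p = (\<Sum>i\<in>segre_index S. h i * segre_gen \<beta> i) \<and>
      (\<forall>i\<in>segre_index S. h i \<noteq> 0 \<longrightarrow> segre_deg i \<le> d \<and> homog (d - segre_deg i) (h i))"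
    by blast
  \<comment> \<open>Under the substitution below these monomials generate the image as a module over
    the forms: above degree N every polynomial is a combination of forms and minors, and the minors
    are sent to 0.\<close>
  define Ms where "Ms = {m :: 'v \<times> 'v \<Rightarrow>\<^sub>0 nat. mon_deg m \<le> N}"
  define K where "K = card Ms"
  have "finite Ms" unfolding Ms_def by (rule finite_mon_deg_le)
  have growth: "B ^ (2 * (n - 1)) \<le> K * ((n - 1) * t + 1) ^ r" if B: "B = Suc t" for t B
  proof -
    obtain h :: "'v \<Rightarrow> nat" where h: "bij_betw h UNIV {..<n}"
      using ex_bij_betw_finite_nat[of "UNIV :: 'v set"] by (auto simp: n_def atLeast0LessThan)
    \<comment> \<open>Place values in base B: x contributes 1, B, ..., B^(n - 2), y contributes B^(n
      - 1), ..., B^(2n - 3), and the index numbered 0 has weight 0 on both sides. The exponent of t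
      for (u, v) is a part from u plus a part from v, so the minors vanish.\<close>
    define w where "w u = (if h u = 0 then 0 else B ^ (h u - 1))" for u
    define w' where "w' v = (if h v = 0 then 0 else B ^ (n - 1 + (h v - 1)))" for v
    define x :: "'v \<times> 'v \<Rightarrow> 'k poly" where "x = (\<lambda>(u, v). monom 1 (w u + w' v))"
    define \<theta> where "\<theta> = ev (\<lambda>c. [:c:]) x"
    have \<theta>: "ring_map \<theta>" unfolding \<theta>_def by (rule ring_map_ev[OF ring_map_pCons])
    have \<theta>_scale: "\<theta> (const_mp c * p) = smult c (\<theta> p)" for c p
      by (simp add: \<theta>_def ev_mult[OF ring_map_pCons] ev_const[OF ring_map_pCons])
    have \<theta>_mon: "\<theta> (mon m) = mon_ev x m" for m
      by (simp add: \<theta>_def ev_single[OF ring_map_pCons] one_pCons[symmetric])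
    define b where "b i = \<theta> (segre_gen \<beta> (Inl (enum i)))" for i
    have \<theta>_minor: "\<theta> (segre_gen \<beta> (Inr q)) = 0" for q
    proof -
      obtain u v u' v' where "q = (u, v, u', v')" by (cases q) auto
      then show ?thesis
        by (simp add: ring_mapD[OF \<theta>] \<theta>_mon x_def mult_monom add_ac)
    qed
    define W where "W d = (\<Union>m\<in>{m\<in>Ms. mon_deg m \<le> d}.
        (\<lambda>q. \<theta> (mon m) * q) ` power_products b (Suc r) (d - mon_deg m))" for d
    have W_mult: "b i * q \<in> up.span (W (Suc d))" if q: "q \<in> up.span (W d)" and i: "i < Suc r" for q i d
      using q
    proof (induction rule: up.span_induct_alt)
      case base
      show ?case by (simp add: up.span_zero)
    next
      case (step c y q)
      obtain m q' where m: "m \<in> Ms" "mon_deg m \<le> d" "y = \<theta> (mon m) * q'"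
        "q' \<in> power_products b (Suc r) (d - mon_deg m)"
        using step(1) by (auto simp: W_def simp del: power_products.simps)
      have "b i * q' \<in> power_products b (Suc r) (Suc d - mon_deg m)"
        using power_products_mult[OF m(4) i] m(2) by (simp add: Suc_diff_le)
      then have "\<theta> (mon m) * (b i * q') \<in> W (Suc d)"
        unfolding W_def using m(1,2) by (intro UN_I[of m]) auto
      then have "smult c (b i * y) \<in> up.span (W (Suc d))"
        unfolding m(3) by (intro up.span_scale up.span_base) (simp add: mult.left_commute)
      then show ?case
        using step(2) by (simp add: algebra_simps up.span_add)
    qed
    have \<theta>_in_span: "\<theta> p \<in> up.span (W d)" if "homog d p" for d p
      using that
    proof (induction d arbitrary: p rule: less_induct)
      case (less d)
      show ?case
      proof (cases "d \<le> N")
        case True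
        have "p = (\<Sum>m\<in>mons d. const_mp (lookup p m) * mon m)"
          using less.prems by (intro mpoly_conv_mon) (auto simp: homog_def)
        then have "\<theta> p = (\<Sum>m\<in>mons d. smult (lookup p m) (\<theta> (mon m)))"
          by (simp only: \<theta>_scale[symmetric] ring_map_sum[OF \<theta>, symmetric])
        also have "\<dots> \<in> up.span (W d)"
        proof (intro up.span_sum up.span_scale up.span_base)
          fix m :: "('v \<times> 'v) expo" assume "m \<in> mons d"
          then have m: "mon_deg m = d" by (simp add: mons_def)
          then have "\<theta> (mon m) * 1 \<in> W d"
            unfolding W_def using True one_in_power_products[of b "Suc r"]
            by (intro UN_I[of m] imageI) (auto simp: Ms_def simp del: power_products.simps)
          then show "\<theta> (mon m) \<in> W d" by simp
        qed
        finally show ?thesis .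
      next
        case False
        then obtain d' where d': "d = Suc d'" by (cases d) auto
        obtain g where g: "p = (\<Sum>i\<in>segre_index S. g i * segre_gen \<beta> i)"
          "\<And>i. i \<in> segre_index S \<Longrightarrow> g i \<noteq> 0 \<Longrightarrow> segre_deg i \<le> d \<and> homog (d - segre_deg i) (g i)"
          using N[OF _ less.prems] False by auto
        have "\<theta> p = (\<Sum>i\<in>segre_index S. \<theta> (g i) * \<theta> (segre_gen \<beta> i))"
          by (simp add: g(1) ring_map_sum[OF \<theta>] ring_mapD[OF \<theta>])
        also have "\<dots> \<in> up.span (W d)"
        proof (rule up.span_sum)
          fix i :: "'s + 'v \<times> 'v \<times> 'v \<times> 'v" assume i: "i \<in> segre_index S"
          show "\<theta> (g i) * \<theta> (segre_gen \<beta> i) \<in> up.span (W d)"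
          proof (cases "g i = 0 \<or> i \<in> range Inr")
            case True
            then show ?thesis by (auto simp: \<theta>_minor ring_mapD[OF \<theta>] up.span_zero simp del: segre_gen.simps)
          next
            case False
            then obtain s where s: "i = Inl s" "s \<in> S" using i by (auto simp: segre_index_def)
            then obtain j where j: "j < Suc r" "s = enum j"
              using enum by (auto simp: bij_betw_def)
            have "homog d' (g i)"
              using g(2)[OF i] False s by (simp add: segre_deg_def d')
            then have "b j * \<theta> (g i) \<in> up.span (W (Suc d'))"
              using less.IH[of d'] d' by (intro W_mult j) auto
            then show ?thesis by (simp add: d' b_def s(1) j(2) mult.commute del: segre_gen.simps)
          qed
        qed
        finally show ?thesis .
      qed
    qed
    define d where "d = (n - 1) * t"
    have onto: "\<exists>m\<in>mons d. \<theta> (mon m) = monom 1 e" if e: "e < B ^ (2 * (n - 1))" for e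
    proof -
      define dig where "dig i = e div B ^ i mod B" for i
      have dig_le: "dig i \<le> t" for i
        unfolding dig_def using B by (metis less_Suc_eq_le mod_less_divisor zero_less_Suc)
      define h' where "h' = inv_into UNIV h"
      have h': "h (h' i) = i" if "i < n" for i
        using that h by (simp add: h'_def bij_betw_def f_inv_into_f)
      \<comment> \<open>For each i < n - 1 exactly t = B - 1 variables are multiplied. The digit of
        e at place k + i tells how many of them use the index of that place value; the others use
        the index of weight 0. The total degree is thus the same for every e.\<close>
      define U where "U k i c = (if c < dig (k + i) then h' (Suc i) else h' 0)" for k i c :: nat
      have n_pos: "0 < n" by (simp add: n_def)
      have w_sum: "(\<Sum>c<t. w (U 0 i c)) = dig i * B ^ i" if "i < n - 1" for i
        unfolding sum_if_less[OF dig_le, symmetric]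
        by (rule sum.cong) (use that n_pos h'[of 0] h'[of "Suc i"] in \<open>auto simp: w_def U_def\<close>)
      have w'_sum: "(\<Sum>c<t. w' (U (n - 1) i c)) = dig (n - 1 + i) * B ^ (n - 1 + i)"
        if "i < n - 1" for i
        unfolding sum_if_less[OF dig_le, symmetric]
        by (rule sum.cong) (use that n_pos h'[of 0] h'[of "Suc i"] in \<open>auto simp: w'_def U_def\<close>)
      define m where "m = (\<Sum>i<n - 1. \<Sum>c<t. single (U 0 i c, U (n - 1) i c) (Suc 0))"
      have "m \<in> mons d"
        by (simp add: m_def mons_def mon_deg_sum d_def)
      moreover have "\<theta> (mon m) = monom 1 (\<Sum>i<n - 1. \<Sum>c<t. w (U 0 i c) + w' (U (n - 1) i c))"
        by (simp add: \<theta>_mon m_def mon_ev_sum x_def prod_monom)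
      moreover have "(\<Sum>i<n - 1. \<Sum>c<t. w (U 0 i c) + w' (U (n - 1) i c))
          = (\<Sum>i<n - 1. dig i * B ^ i) + (\<Sum>i<n - 1. dig (n - 1 + i) * B ^ (n - 1 + i))"
        unfolding sum.distrib
        by (intro arg_cong2[where f = "(+)"] sum.cong refl w_sum w'_sum) auto
      moreover have "\<dots> = (\<Sum>i<2 * (n - 1). dig i * B ^ i)"
        by (simp add: mult_2 sum_lessThan_add)
      moreover have "\<dots> = e"
        using e by (simp add: dig_def sum_digits)
      ultimately show ?thesis by auto
    qed
    have card_W: "card (W d) \<le> K * (d + 1) ^ r"
    proof -
      have "card (W d) \<le> (\<Sum>m\<in>{m\<in>Ms. mon_deg m \<le> d}.
          card ((\<lambda>q. \<theta> (mon m) * q) ` power_products b (Suc r) (d - mon_deg m)))"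
        unfolding W_def by (rule card_UN_le) (use \<open>finite Ms\<close> in auto)
      also have "\<dots> \<le> (\<Sum>m\<in>{m\<in>Ms. mon_deg m \<le> d}. (d + 1) ^ r)"
      proof (rule sum_mono)
        fix m :: "('v \<times> 'v) expo"
        have "card ((\<lambda>q. \<theta> (mon m) * q) ` power_products b (Suc r) (d - mon_deg m))
            \<le> card (power_products b (Suc r) (d - mon_deg m))"
          by (rule card_image_le) (rule finite_power_products)
        also have "\<dots> \<le> (d - mon_deg m + 1) ^ r" by (rule card_power_products)
        also have "\<dots> \<le> (d + 1) ^ r" by (rule power_mono) auto
        finally show "card ((\<lambda>q. \<theta> (mon m) * q) ` power_products b (Suc r) (d - mon_deg m)) \<le> (d + 1) ^ r" .
      qed
      also have "\<dots> = card {m\<in>Ms. mon_deg m \<le> d} * (d + 1) ^ r" by simp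
      also have "\<dots> \<le> K * (d + 1) ^ r"
        unfolding K_def using \<open>finite Ms\<close> by (intro mult_right_mono card_mono) auto
      finally show ?thesis .
    qed
    have "finite (W d)"
      unfolding W_def using \<open>finite Ms\<close> by (auto simp del: power_products.simps)
    have "card {..<B ^ (2 * (n - 1))} \<le> card (W d)"
    proof (rule up.card_indep_family_le[OF _ indep_family_monom])
      show "monom 1 ` {..<B ^ (2 * (n - 1))} \<subseteq> up.span (W d)"
      proof (rule image_subsetI)
        fix e assume "e \<in> {..<B ^ (2 * (n - 1))}"
        then obtain m where m: "m \<in> mons d" "\<theta> (mon m) = monom 1 e" using onto by auto
        have "\<theta> (mon m) \<in> up.span (W d)"
          by (rule \<theta>_in_span, rule homog_mon) (use m(1) in \<open>simp add: mons_def\<close>)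
        then show "monom 1 e \<in> up.span (W d)" by (simp add: m(2))
      qed
    qed (use \<open>finite (W d)\<close> in auto)
    with card_W show ?thesis by (simp add: d_def)
  qed
  have n2: "r + 1 \<le> 2 * (n - 1)" using card_S r by (simp add: n_def)
  then have n_pos: "2 \<le> n" by simp
  \<comment> \<open>Chosen so that K (n (t + 1))^r equals t (t + 1)^r, which is less than (t + 1)^(r
    + 1).\<close>
  define t where "t = K * n ^ r"
  have "Suc t * Suc t ^ r \<le> Suc t ^ (2 * (n - 1))"
    using power_increasing[OF n2, of "Suc t"] by simp
  also have "\<dots> \<le> K * ((n - 1) * t + 1) ^ r" by (rule growth[OF refl])
  also have "\<dots> \<le> K * (n * Suc t) ^ r"
  proof (intro mult_left_mono power_mono)
    show "(n - 1) * t + 1 \<le> n * Suc t"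
      using n_pos by (simp add: algebra_simps diff_mult_distrib)
  qed auto
  also have "\<dots> = t * Suc t ^ r" by (simp only: t_def power_mult_distrib mult.assoc)
  finally show False by simp
qed

text \<open>Every monomial of degree 2 is a product of variables numbered i \<le> j, and there are
  n(n + 1)/2 such pairs.\<close>

lemma card_mons_2: "2 * card (mons 2 :: ('v::finite \<Rightarrow>\<^sub>0 nat) set) \<le> CARD('v) * (CARD('v) + 1)"
proof -
  define n where "n = CARD('v)"
  obtain h :: "'v \<Rightarrow> nat" where h: "bij_betw h UNIV {..<n}"
    using ex_bij_betw_finite_nat[of "UNIV :: 'v set"] by (auto simp: n_def atLeast0LessThan)
  define e where "e i = (single (inv_into UNIV h i) (Suc 0) :: 'v \<Rightarrow>\<^sub>0 nat)" for i
  have "(mons 2 :: 'v expo set) \<subseteq> (\<lambda>(j, i). e i + e j) ` (SIGMA j:{..<n}. {..j})"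
  proof
    fix m :: "'v expo" assume "m \<in> mons 2"
    then have m: "mon_deg m = 2" by (simp add: mons_def)
    obtain a b where ab: "m = a + b" "mon_deg a = Suc 0"
      using mon_split[of "Suc 0" m] m by auto
    then have "mon_deg b = Suc 0" using m by simp
    with ab(2) have "a \<in> mons (Suc 0)" "b \<in> mons (Suc 0)"
      by (simp_all add: mons_def)
    then obtain u v where uv: "m = single u (Suc 0) + single v (Suc 0)"
      using ab(1) by (auto simp: mons_1)
    have e_h: "e (h u) = single u (Suc 0)" for u
      using h by (simp add: e_def bij_betw_def inv_into_f_f)
    have hn: "h u < n" for u using h by (auto simp: bij_betw_def)
    show "m \<in> (\<lambda>(j, i). e i + e j) ` (SIGMA j:{..<n}. {..j})"
    proof (cases "h u \<le> h v")
      case True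
      then show ?thesis by (intro image_eqI[of _ _ "(h v, h u)"]) (auto simp: e_h uv hn)
    next
      case False
      then show ?thesis by (intro image_eqI[of _ _ "(h u, h v)"]) (auto simp: e_h uv hn add.commute)
    qed
  qed
  then have "card (mons 2 :: 'v expo set) \<le> card (SIGMA j:{..<n}. {..j})"
    by (rule surj_card_le[rotated]) auto
  also have "\<dots> = (\<Sum>j<n. Suc j)" by simp
  also have "2 * \<dots> = n * (n + 1)" by (induction n) (auto simp: algebra_simps)
  finally show ?thesis by (simp add: n_def)
qed

section \<open>Regular sequences of quadrics\<close>

text \<open>Counted by the Hilbert function of P modulo a regular sequence of n quadrics.\<close>

definition sqfree :: "nat \<Rightarrow> 'v expo set" where
  "sqfree d = {m \<in> mons d. \<forall>v. lookup m v \<le> 1}"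

text \<open>The exponents \<alpha> for which f^\<alpha>, a form of degree 2 |\<alpha>|, can be a
  factor in degree d.\<close>

definition half_le :: "nat \<Rightarrow> 'v expo set" where
  "half_le d = {\<alpha>. 2 * mon_deg \<alpha> \<le> d}"

lemma finite_half_le [simp]: "finite (half_le d :: ('v::finite \<Rightarrow>\<^sub>0 nat) set)"
  by (rule finite_subset[OF _ finite_mon_deg_le[of d]]) (auto simp: half_le_def)

lemma finite_sqfree [simp]: "finite (sqfree d :: ('v::finite \<Rightarrow>\<^sub>0 nat) set)"
  by (rule finite_subset[OF _ finite_mons[of d]]) (auto simp: sqfree_def)

lemma sqfree_empty:
  assumes "CARD('v::finite) < d"
  shows "(sqfree d :: 'v expo set) = {}"
proof (rule ccontr)
  assume "sqfree d \<noteq> ({} :: 'v expo set)"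
  then obtain m :: "'v expo" where m: "mon_deg m = d" "\<And>v. lookup m v \<le> 1"
    by (auto simp: sqfree_def mons_def)
  have "mon_deg m = (\<Sum>v\<in>UNIV. lookup m v)" by (rule mon_deg_superset) auto
  also have "\<dots> \<le> (\<Sum>v\<in>(UNIV :: 'v set). 1)" by (rule sum_mono) (rule m(2))
  finally show False using m(1) assms by simp
qed

lemma card_mons_eq_sum_sqfree:
  "card (mons d :: ('v::finite) expo set)
    = (\<Sum>\<alpha>\<in>(half_le d :: 'v expo set). card (sqfree (d - 2 * mon_deg \<alpha>) :: 'v expo set))"
proof -
  let ?K = "SIGMA \<alpha>:(half_le d :: 'v expo set). (sqfree (d - 2 * mon_deg \<alpha>) :: 'v expo set)"
  have "bij_betw (\<lambda>(\<alpha>, s). s + \<alpha> + \<alpha>) ?K (mons d)"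
  proof (rule bij_betwI')
    fix p q assume pq: "p \<in> ?K" "q \<in> ?K"
    obtain \<alpha> s \<alpha>' s' where p: "p = (\<alpha>, s)" and q: "q = (\<alpha>', s')" by (cases p, cases q) auto
    have le: "lookup s v \<le> 1" "lookup s' v \<le> 1" for v
      using pq by (auto simp: p q sqfree_def)
    show "((case p of (\<alpha>, s) \<Rightarrow> s + \<alpha> + \<alpha>) = (case q of (\<alpha>, s) \<Rightarrow> s + \<alpha> + \<alpha>)) = (p = q)"
    proof
      assume "(case p of (\<alpha>, s) \<Rightarrow> s + \<alpha> + \<alpha>) = (case q of (\<alpha>, s) \<Rightarrow> s + \<alpha> + \<alpha>)"
      then have eq: "lookup s v + 2 * lookup \<alpha> v = lookup s' v + 2 * lookup \<alpha>' v" for v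
        by (simp add: p q poly_mapping_eq_iff fun_eq_iff lookup_add mult_2 add.assoc)
      have "lookup s v = lookup s' v" "lookup \<alpha> v = lookup \<alpha>' v" for v
        using eq[of v] le[of v] by presburger+
      then show "p = q" by (simp add: p q poly_mapping_eq_iff fun_eq_iff)
    qed simp
  next
    fix p assume "p \<in> ?K"
    then show "(case p of (\<alpha>, s) \<Rightarrow> s + \<alpha> + \<alpha>) \<in> mons d"
      by (auto simp: sqfree_def mons_def half_le_def)
  next
    fix m :: "'v expo" assume m: "m \<in> mons d"
    define \<alpha> where "\<alpha> = Poly_Mapping.map (\<lambda>i. i div 2) m"
    define s where "s = Poly_Mapping.map (\<lambda>i. i mod 2) m"
    have lookup: "lookup \<alpha> v = lookup m v div 2" "lookup s v = lookup m v mod 2" for v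
      by (simp_all add: \<alpha>_def s_def Poly_Mapping.map.rep_eq when_def)
    have eq: "m = s + \<alpha> + \<alpha>"
      by (rule poly_mapping_eqI) (simp add: lookup_add lookup, presburger)
    have "mon_deg s + 2 * mon_deg \<alpha> = d"
      using m arg_cong[OF eq, of mon_deg] by (simp add: mons_def)
    then have "(\<alpha>, s) \<in> ?K"
      by (auto simp: sqfree_def mons_def half_le_def lookup)
    then show "\<exists>p\<in>?K. m = (case p of (\<alpha>, s) \<Rightarrow> s + \<alpha> + \<alpha>)"
      using eq by (intro bexI[of _ "(\<alpha>, s)"]) simp
  qed
  then have "card ?K = card (mons d :: 'v expo set)" by (rule bij_betw_same_card)
  then show ?thesis by simp
qed

lemma gen_ideal_ideal: "ideal_set (gen_ideal f i)"
  unfolding gen_ideal_def by (rule ideal_set_combinations)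

lemma gen_in_gen_ideal: "j < i \<Longrightarrow> f j \<in> gen_ideal f i"
  unfolding gen_ideal_def
  by (intro CollectI exI[of _ "\<lambda>k. if k = j then 1 else 0"]) (simp add: if_distrib[of "\<lambda>x. x * _"] cong: if_cong)

lemma gen_ideal_mono: "i \<le> i' \<Longrightarrow> gen_ideal f i \<subseteq> gen_ideal f i'"
proof
  fix p assume "i \<le> i'" "p \<in> gen_ideal f i"
  then obtain a where "p = (\<Sum>j<i. a j * f j)" by (auto simp: gen_ideal_def)
  also have "\<dots> \<in> gen_ideal f i'"
    using \<open>i \<le> i'\<close>
    by (intro ideal_set_sum[OF gen_ideal_ideal] ideal_setD(3)[OF gen_ideal_ideal] gen_in_gen_ideal) auto
  finally show "p \<in> gen_ideal f i'" .
qed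

text \<open>In a nontrivial relation the last f j with nonzero coefficient lies in the ideal of its
  predecessors. Regularity applied to f j * 1 then puts 1 into that ideal.\<close>

lemma regular_seq_imp_indep:
  fixes f :: "nat \<Rightarrow> ('n, 'k::field) mpoly"
  assumes "regular_seq f r"
  shows "indep_mp {..<r} f"
  unfolding indep_family_def
proof (intro allI impI, rule ccontr)
  fix c assume sum: "(\<Sum>i<r. const_mp (c i) * f i) = 0" and "\<not> (\<forall>i\<in>{..<r}. c i = 0)"
  then have ex: "\<exists>i. i < r \<and> c i \<noteq> 0" by auto
  define j where "j = (GREATEST i. i < r \<and> c i \<noteq> 0)"
  have j: "j < r" "c j \<noteq> 0"
    using GreatestI_ex_nat[OF ex, of r] by (auto simp: j_def)
  have "c i = 0" if "j < i" "i < r" for i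
    using Greatest_le_nat[of "\<lambda>i. i < r \<and> c i \<noteq> 0" i r] that by (force simp: j_def)
  then have "(\<Sum>i<r. const_mp (c i) * f i) = (\<Sum>i<Suc j. const_mp (c i) * f i)"
    using j(1) by (intro sum.mono_neutral_right) (auto simp: Suc_le_eq not_less)
  with sum have "const_mp (c j) * f j = - (\<Sum>i<j. const_mp (c i) * f i)"
    by (simp add: eq_neg_iff_add_eq_0 add.commute)
  then have "const_mp (inverse (c j)) * (const_mp (c j) * f j)
      = (\<Sum>i<j. (- const_mp (inverse (c j)) * const_mp (c i)) * f i)"
    by (simp add: sum_distrib_left sum_negf mult.assoc)
  then have "f j * 1 = (\<Sum>i<j. (- const_mp (inverse (c j)) * const_mp (c i)) * f i)"
    using j(2) by (simp add: mult.assoc[symmetric] const_mp_mult[symmetric] del: mult_minus_left)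
  then have "f j * 1 \<in> gen_ideal f j"
    unfolding gen_ideal_def
    by (intro CollectI exI[of _ "\<lambda>i. - const_mp (inverse (c j)) * const_mp (c i)"] conjI TrueI)
  then have "1 \<in> gen_ideal f j"
    using assms j(1) unfolding regular_seq_def by blast
  then show False
    using assms gen_ideal_mono[of j r f] j(1) unfolding regular_seq_def by auto
qed

section \<open>Expansions in the powers of f and the count of their terms\<close>

definition quad_multiples :: "(nat \<Rightarrow> ('n::finite, 'k::field) mpoly) \<Rightarrow> nat \<Rightarrow> ('n, 'k) mpoly set" where
  "quad_multiples f d = {mon m * f j | m j. mon_deg m + 2 = d \<and> j < CARD('n)}"

text \<open>The candidate B d supplements the degree d part of the ideal, which is spanned by
  \<open>quad_multiples f d\<close> when f consists of quadrics.\<close>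

definition complement_span ::
  "(nat \<Rightarrow> ('n::finite, 'k::field) mpoly) \<Rightarrow> (nat \<Rightarrow> ('n, 'k) mpoly set) \<Rightarrow> nat \<Rightarrow> ('n, 'k) mpoly set" where
  "complement_span f B d = mp.span (B d \<union> quad_multiples f d)"

text \<open>Polynomials over \<open>'n\<close> with coefficients in \<open>('n, 'k) mpoly\<close> are used to write elements in
  the form \<open>\<Sum>\<^sub>\<alpha> u\<^sub>\<alpha> f\<^sup>\<alpha>\<close>; here \<open>h\<close> matches the exponent variables with the indices of \<open>f\<close>.\<close>

locale quad_complement =
  fixes f :: "nat \<Rightarrow> ('n::finite, 'k::field) mpoly" and h :: "'n \<Rightarrow> nat"
    and B :: "nat \<Rightarrow> ('n, 'k) mpoly set"
  assumes homog_f: "homog 2 (f i)"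
    and h: "bij_betw h UNIV {..<CARD('n)}"
    and finite_B: "finite (B d)"
    and homog_B: "b \<in> B d \<Longrightarrow> homog d b"
begin

definition fpow :: "'n expo \<Rightarrow> ('n, 'k) mpoly" where
  "fpow \<alpha> = mon_ev (\<lambda>v. f (h v)) \<alpha>"

definition \<Psi> :: "('n, ('n, 'k) mpoly) mpoly \<Rightarrow> ('n, 'k) mpoly" where
  "\<Psi> u = mp_eval u (\<lambda>v. f (h v))"

text \<open>The direct sum of the spans of the B e, described through homogeneous
  components.\<close>

definition U :: "('n, 'k) mpoly set" where
  "U = {p. \<forall>e. hcomp e p \<in> mp.span (B e)}"

text \<open>Polynomials in new variables y with coefficients in U. On this set \<Psi> expresses
  freeness over k[f]: surjectivity is spanning, injectivity is uniqueness of the expansion.\<close>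

definition \<Omega> :: "('n, ('n, 'k) mpoly) mpoly set" where
  "\<Omega> = {u. \<forall>\<alpha>. lookup u \<alpha> \<in> U}"

definition K :: "nat \<Rightarrow> ('n expo \<times> ('n, 'k) mpoly) set" where
  "K d = (SIGMA \<alpha>:half_le d. B (d - 2 * mon_deg \<alpha>))"

abbreviation kterm :: "'n expo \<times> ('n, 'k) mpoly \<Rightarrow> ('n, 'k) mpoly" where
  "kterm \<equiv> \<lambda>(\<alpha>, b). b * fpow \<alpha>"

lemma h_lt [simp]: "h v < CARD('n)"
  using h by (auto simp: bij_betw_def)

lemma h_eq_iff [simp]: "h u = h v \<longleftrightarrow> u = v"
  using h by (auto simp: bij_betw_def inj_on_def)

lemma ex_h: assumes "j < CARD('n)" obtains v where "h v = j"
proof -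
  have "j \<in> range h" using h assms by (simp add: bij_betw_def)
  then show ?thesis using that by blast
qed

lemma ring_map_\<Psi>: "ring_map \<Psi>"
  unfolding \<Psi>_def by (rule ring_map_mp_eval)

lemma \<Psi>_single: "\<Psi> (single \<alpha> p) = p * fpow \<alpha>"
  by (simp add: \<Psi>_def mp_eval_single fpow_def)

lemma \<Psi>_var: "\<Psi> (var v) = f (h v)"
  by (simp add: \<Psi>_def)

lemma \<Psi>_expand: "\<Psi> u = (\<Sum>\<alpha>\<in>keys u. lookup u \<alpha> * fpow \<alpha>)"
  by (simp add: \<Psi>_def mp_eval_conv_ev ev_def fpow_def)

lemma fpow_0 [simp]: "fpow 0 = 1"
  by (simp add: fpow_def)

lemma fpow_add: "fpow (\<alpha> + \<beta>) = fpow \<alpha> * fpow \<beta>"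
  by (simp add: fpow_def mon_ev_add)

lemma fpow_var: "fpow (single v (Suc 0)) = f (h v)"
  by (simp add: fpow_def)

lemma homog_fpow: "homog (2 * mon_deg \<alpha>) (fpow \<alpha>)"
proof (induction "mon_deg \<alpha>" arbitrary: \<alpha>)
  case 0
  then show ?case using homog_const[of "1 :: 'k"] by simp
next
  case (Suc k)
  obtain a b where ab: "\<alpha> = a + b" "mon_deg a = Suc 0"
    using mon_split[of "Suc 0" \<alpha>] Suc.hyps(2) by auto
  then have "mon_deg b = k" using Suc.hyps(2) by simp
  from ab(2) have "a \<in> mons (Suc 0)" by (simp add: mons_def)
  then obtain v where v: "a = single v (Suc 0)" by (auto simp: mons_1)
  have "homog (2 + 2 * mon_deg b) (fpow a * fpow b)"
    unfolding v fpow_var using homog_f Suc.hyps(1) \<open>mon_deg b = k\<close> by (intro homog_mult) auto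
  then show ?case using ab by (simp add: fpow_add)
qed

lemma subspace_U: "mp.subspace U"
  unfolding mp.subspace_def
  by (auto simp: U_def hcomp_add hcomp_const_mult mp.span_add mp.span_scale mp.span_zero)

lemma U_0: "0 \<in> U" and U_add: "p \<in> U \<Longrightarrow> q \<in> U \<Longrightarrow> p + q \<in> U"
  and U_scale: "p \<in> U \<Longrightarrow> const_mp c * p \<in> U"
  using subspace_U by (auto simp: mp.subspace_def)

lemma U_diff: "p \<in> U \<Longrightarrow> q \<in> U \<Longrightarrow> p - q \<in> U"
  by (rule mp.subspace_diff[OF subspace_U])

lemma B_subset_U: "b \<in> B d \<Longrightarrow> b \<in> U"
  by (auto simp: U_def hcomp_homog[OF homog_B] mp.span_zero mp.span_base)

lemma \<Omega>_add: "u \<in> \<Omega> \<Longrightarrow> w \<in> \<Omega> \<Longrightarrow> u + w \<in> \<Omega>"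
  by (simp add: \<Omega>_def lookup_add U_add)

lemma \<Omega>_diff: "u \<in> \<Omega> \<Longrightarrow> w \<in> \<Omega> \<Longrightarrow> u - w \<in> \<Omega>"
  by (simp add: \<Omega>_def lookup_minus U_diff)

lemma \<Omega>_0: "0 \<in> \<Omega>"
  by (simp add: \<Omega>_def U_0)

lemma \<Omega>_sum: "(\<And>i. i \<in> A \<Longrightarrow> w i \<in> \<Omega>) \<Longrightarrow> (\<Sum>i\<in>A. w i) \<in> \<Omega>"
  by (induction A rule: infinite_finite_induct) (auto intro: \<Omega>_0 \<Omega>_add)

lemma \<Omega>_single: "p \<in> U \<Longrightarrow> single \<alpha> p \<in> \<Omega>"
  by (auto simp: \<Omega>_def lookup_single when_def U_0)

lemma \<Omega>_scale: "u \<in> \<Omega> \<Longrightarrow> const_mp (const_mp c) * u \<in> \<Omega>"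
  by (simp add: \<Omega>_def U_scale)

lemma \<Omega>_mon_mult: "u \<in> \<Omega> \<Longrightarrow> mon m * u \<in> \<Omega>"
  by (auto simp: \<Omega>_def lookup_mon_mult U_0)

lemma finite_K: "finite (K d)"
  unfolding K_def using finite_B by (intro finite_SigmaI) auto

lemma card_K: "card (K d) = (\<Sum>\<alpha>\<in>(half_le d :: 'n expo set). card (B (d - 2 * mon_deg \<alpha>)))"
  unfolding K_def using finite_B by (intro card_SigmaI) auto

text \<open>Strong induction on d: in a multiple m f j the monomial m has degree d - 2, so it is
  already a combination of terms b f^\<alpha>, and the factor f j only raises the exponent.\<close>

lemma homog_in_span_K:
  assumes "\<And>d p. homog d p \<Longrightarrow> p \<in> complement_span f B d" and "homog d p"
  shows "p \<in> mp.span (kterm ` K d)"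
  using assms(2)
proof (induction d arbitrary: p rule: less_induct)
  case (less d)
  have "B d \<union> quad_multiples f d \<subseteq> mp.span (kterm ` K d)"
  proof (intro Un_least subsetI)
    fix b assume "b \<in> B d"
    then have "b * fpow 0 \<in> kterm ` K d"
      by (intro image_eqI[of _ _ "(0, b)"]) (auto simp: K_def half_le_def)
    then show "b \<in> mp.span (kterm ` K d)"
      by (intro mp.span_base) simp
  next
    fix q assume "q \<in> quad_multiples f d"
    then obtain m j where q: "q = mon m * f j" "mon_deg m + 2 = d" "j < CARD('n)"
      by (auto simp: quad_multiples_def)
    obtain v where v: "h v = j" using ex_h[OF q(3)] .
    have "mon m \<in> mp.span (kterm ` K (mon_deg m))"
      using q(2) by (intro less.IH homog_mon) auto
    then have "mon m * f j \<in> mp.span (kterm ` K d)"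
    proof (induction rule: mp.span_induct_alt)
      case base
      show ?case by (simp add: mp.span_zero)
    next
      case (step c x y)
      obtain \<alpha> b where x: "x = b * fpow \<alpha>" "2 * mon_deg \<alpha> \<le> mon_deg m" "b \<in> B (mon_deg m - 2 * mon_deg \<alpha>)"
        using step(1) by (auto simp: K_def half_le_def)
      have "mon_deg m - 2 * mon_deg \<alpha> = d - 2 * mon_deg (\<alpha> + single v (Suc 0))"
        using q(2) by simp
      then have "(\<alpha> + single v (Suc 0), b) \<in> K d"
        using x q(2) by (auto simp: K_def half_le_def)
      then have "b * fpow (\<alpha> + single v (Suc 0)) \<in> mp.span (kterm ` K d)"
        by (intro mp.span_base image_eqI[of _ _ "(\<alpha> + single v (Suc 0), b)"]) auto
      then have "const_mp c * (x * f j) \<in> mp.span (kterm ` K d)"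
        by (intro mp.span_scale) (simp add: x(1) fpow_add fpow_var v mult.assoc)
      then show ?case
        using step(2) by (simp add: distrib_right mult.assoc mp.span_add)
    qed
    then show "q \<in> mp.span (kterm ` K d)" by (simp add: q(1))
  qed
  then have "complement_span f B d \<subseteq> mp.span (kterm ` K d)"
    unfolding complement_span_def by (rule mp.span_minimal) (rule mp.subspace_span)
  then show ?case using assms(1)[OF less.prems] by blast
qed

lemma card_mons_le_K:
  assumes "\<And>d p. homog d p \<Longrightarrow> p \<in> complement_span f B d"
  shows "card (mons d :: 'n expo set) \<le> card (K d)"
proof -
  have "card (mons d :: 'n expo set) \<le> card (kterm ` K d)"
  proof (rule mp.card_indep_family_le[OF finite_mons indep_family_mon[OF finite_mons]])
    show "mon ` mons d \<subseteq> mp.span (kterm ` K d)"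
      using homog_in_span_K[OF assms] by (auto intro!: homog_mon simp: mons_def)
  qed (use finite_K in auto)
  also have "\<dots> \<le> card (K d)" by (rule card_image_le[OF finite_K])
  finally show ?thesis .
qed

lemma \<Psi>_surj:
  assumes "\<And>d p. homog d p \<Longrightarrow> p \<in> complement_span f B d"
  obtains u where "u \<in> \<Omega>" "p = \<Psi> u"
proof -
  have homog: "q \<in> \<Psi> ` \<Omega>" if q: "homog d q" for d q
  proof -
    have "q \<in> mp.span (kterm ` K d)"
      using assms q by (rule homog_in_span_K)
    then show ?thesis
    proof (induction rule: mp.span_induct_alt)
      case base
      show ?case by (rule image_eqI[of _ _ 0]) (auto simp: ring_mapD[OF ring_map_\<Psi>] \<Omega>_0)
    next
      case (step c x y)
      then obtain u where u: "u \<in> \<Omega>" "y = \<Psi> u" by blast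
      obtain \<alpha> b e where x: "x = b * fpow \<alpha>" "b \<in> B e"
        using step(1) by (auto simp: K_def)
      have "const_mp c * x + y = \<Psi> (const_mp (const_mp c) * single \<alpha> b + u)"
        unfolding u(2) x(1) by (simp add: ring_mapD[OF ring_map_\<Psi>] \<Psi>_single) (simp add: \<Psi>_def)
      then show ?case
        using u(1) x(2) by (intro image_eqI[of _ _ "const_mp (const_mp c) * single \<alpha> b + u"])
          (auto intro!: \<Omega>_add \<Omega>_scale \<Omega>_single B_subset_U)
    qed
  qed
  obtain D where D: "\<And>m. m \<in> keys p \<Longrightarrow> mon_deg m \<le> D"
    using ex_mon_deg_bound by metis
  have "\<forall>d. \<exists>u. u \<in> \<Omega> \<and> hcomp d p = \<Psi> u"
    using homog[OF homog_hcomp] by blast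
  from choice[OF this] obtain w where "\<forall>d. w d \<in> \<Omega> \<and> hcomp d p = \<Psi> (w d)" by (elim exE) (rule that)
  then have w: "w d \<in> \<Omega>" "hcomp d p = \<Psi> (w d)" for d by simp_all
  have "p = \<Psi> (\<Sum>d\<le>D. w d)"
    using sum_hcomp[of p D] D by (simp add: w(2) ring_map_sum[OF ring_map_\<Psi>])
  then show ?thesis using w(1) by (intro that[of "\<Sum>d\<le>D. w d"] \<Omega>_sum)
qed

text \<open>The terms span degree d and are no more numerous than its monomials, because both counts
  are sums over the same \<alpha> and \<open>card\<close> bounds them summand by summand.\<close>

lemma indep_family_K_if_card_le:
  assumes span: "\<And>d p. homog d p \<Longrightarrow> p \<in> complement_span f B d"
    and card: "\<And>d. card (B d) \<le> card (sqfree d :: 'n expo set)"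
  shows "indep_mp (K d) kterm"
proof (rule mp.indep_family_if_card_le[OF finite_K finite_mons indep_family_mon])
  show "mon ` mons d \<subseteq> mp.span (kterm ` K d)"
    using homog_in_span_K[OF span] by (auto intro!: homog_mon simp: mons_def)
  show "card (K d) \<le> card (mons d :: 'n expo set)"
    unfolding card_K card_mons_eq_sum_sqfree by (rule sum_mono) (rule card)
qed auto

text \<open>The degree d component of \<Psi> u is a combination of the terms indexed by
  \<open>K d\<close>, so its coefficients vanish. The component of degree e of the coefficient at
  \<alpha> is reached with d = e + 2 |\<alpha>|.\<close>

lemma \<Psi>_inj:
  assumes indep: "\<And>d. indep_mp (K d) kterm"
    and u: "u \<in> \<Omega>" "\<Psi> u = 0"
  shows "u = 0"
proof -
  have hcomp_0: "hcomp e (lookup u \<alpha>) = 0" for e \<alpha>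
  proof (cases "\<alpha> \<in> keys u")
    case True
    define d where "d = e + 2 * mon_deg \<alpha>"
    have "\<forall>\<beta>. \<exists>c. hcomp (d - 2 * mon_deg \<beta>) (lookup u \<beta>) = (\<Sum>b\<in>B (d - 2 * mon_deg \<beta>). const_mp (c b) * b)"
      using u(1) mp.in_span_image_finite[OF finite_B, of _ "\<lambda>x. x"] by (simp add: \<Omega>_def U_def)
    from choice[OF this] obtain c where c: "\<forall>\<beta>. hcomp (d - 2 * mon_deg \<beta>) (lookup u \<beta>)
        = (\<Sum>b\<in>B (d - 2 * mon_deg \<beta>). const_mp (c \<beta> b) * b)"
      by (elim exE) (rule that)
    define c' where "c' = (\<lambda>(\<beta>, b). if \<beta> \<in> keys u then c \<beta> b else 0)"
    have "0 = hcomp d (\<Psi> u)" by (simp add: u(2))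
    also have "\<dots> = (\<Sum>\<beta>\<in>keys u. if 2 * mon_deg \<beta> \<le> d then hcomp (d - 2 * mon_deg \<beta>) (lookup u \<beta>) * fpow \<beta> else 0)"
      by (simp add: \<Psi>_expand hcomp_sum hcomp_mult_homog[OF homog_fpow])
    also have "\<dots> = (\<Sum>\<beta>\<in>half_le d. if \<beta> \<in> keys u then hcomp (d - 2 * mon_deg \<beta>) (lookup u \<beta>) * fpow \<beta> else 0)"
    proof -
      have "(\<Sum>\<beta>\<in>keys u. if 2 * mon_deg \<beta> \<le> d then hcomp (d - 2 * mon_deg \<beta>) (lookup u \<beta>) * fpow \<beta> else 0)
          = (\<Sum>\<beta>\<in>keys u \<inter> half_le d. hcomp (d - 2 * mon_deg \<beta>) (lookup u \<beta>) * fpow \<beta>)"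
        by (rule sum.mono_neutral_cong_right) (auto simp: half_le_def)
      also have "\<dots> = (\<Sum>\<beta>\<in>half_le d. if \<beta> \<in> keys u then hcomp (d - 2 * mon_deg \<beta>) (lookup u \<beta>) * fpow \<beta> else 0)"
        by (rule sum.mono_neutral_cong_left) auto
      finally show ?thesis .
    qed
    also have "\<dots> = (\<Sum>\<beta>\<in>half_le d. \<Sum>b\<in>B (d - 2 * mon_deg \<beta>). const_mp (c' (\<beta>, b)) * (b * fpow \<beta>))"
      by (rule sum.cong) (auto simp: c'_def c sum_distrib_right mult.assoc)
    also have "\<dots> = (\<Sum>k\<in>K d. const_mp (c' k) * (case k of (\<beta>, b) \<Rightarrow> b * fpow \<beta>))"
      unfolding K_def using finite_B by (subst sum.Sigma) (auto intro!: sum.cong)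
    finally have *: "(\<Sum>k\<in>K d. const_mp (c' k) * (case k of (\<beta>, b) \<Rightarrow> b * fpow \<beta>)) = 0" by simp
    have "c \<alpha> b = 0" if "b \<in> B (d - 2 * mon_deg \<alpha>)" for b
    proof -
      have "(\<alpha>, b) \<in> K d" using that by (auto simp: K_def half_le_def d_def)
      from indep_familyD[OF indep * this] show ?thesis using True by (simp add: c'_def)
    qed
    then have "hcomp (d - 2 * mon_deg \<alpha>) (lookup u \<alpha>) = 0" by (simp add: c)
    then show ?thesis by (simp add: d_def)
  qed (simp add: in_keys_iff)
  show "u = 0"
  proof (rule poly_mapping_eqI)
    fix \<alpha>
    obtain D where "\<And>m. m \<in> keys (lookup u \<alpha>) \<Longrightarrow> mon_deg m \<le> D"
      using ex_mon_deg_bound by metis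
    then show "lookup u \<alpha> = lookup 0 \<alpha>"
      using sum_hcomp[of "lookup u \<alpha>" D] by (simp add: hcomp_0)
  qed
qed

text \<open>Membership in the ideal generated by the variables that \<Psi> sends to f 0, ..., f (i -
  1).\<close>

definition good :: "nat \<Rightarrow> ('n, ('n, 'k) mpoly) mpoly \<Rightarrow> bool" where
  "good i u \<longleftrightarrow> (\<forall>\<alpha>\<in>keys u. \<exists>v. h v < i \<and> lookup \<alpha> v \<noteq> 0)"

lemma good_sum: "(\<And>j. j \<in> A \<Longrightarrow> good i (w j)) \<Longrightarrow> good i (\<Sum>j\<in>A. w j)"
  using keys_sum[of w A] by (fastforce simp: good_def)

lemma good_imp_in_gen_ideal:
  assumes "good i u"
  shows "\<Psi> u \<in> gen_ideal f i"
  unfolding \<Psi>_expand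
proof (rule ideal_set_sum[OF gen_ideal_ideal])
  fix \<alpha> assume "\<alpha> \<in> keys u"
  then obtain v where v: "h v < i" "lookup \<alpha> v \<noteq> 0" using assms by (auto simp: good_def)
  then obtain \<alpha>' where "\<alpha> = \<alpha>' + single v (Suc 0)"
    using mon_split_var[of "Suc 0" \<alpha> v] by auto
  then have "lookup u \<alpha> * fpow \<alpha> = (lookup u \<alpha> * fpow \<alpha>') * f (h v)"
    by (simp add: fpow_add fpow_var mult.assoc)
  also have "\<dots> \<in> gen_ideal f i"
    by (intro ideal_setD(3)[OF gen_ideal_ideal] gen_in_gen_ideal v(1))
  finally show "lookup u \<alpha> * fpow \<alpha> \<in> gen_ideal f i" .
qed

text \<open>The cofactors are lifted by surjectivity of \<Psi>, and each f j is lifted to its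
  variable.\<close>

lemma gen_ideal_imp_good:
  assumes span: "\<And>d p. homog d p \<Longrightarrow> p \<in> complement_span f B d"
    and "p \<in> gen_ideal f i" "i \<le> CARD('n)"
  obtains u where "u \<in> \<Omega>" "good i u" "p = \<Psi> u"
proof -
  obtain a where a: "p = (\<Sum>j<i. a j * f j)" using assms(2) by (auto simp: gen_ideal_def)
  have "\<exists>u. u \<in> \<Omega> \<and> a j = \<Psi> u" for j
    using \<Psi>_surj[OF span, of "a j"] by metis
  then obtain w where w: "\<And>j. w j \<in> \<Omega>" "\<And>j. a j = \<Psi> (w j)" by metis
  have "\<exists>v. h v = j" if "j < i" for j using ex_h[of j] that assms(3) by (metis less_le_trans)
  then obtain hv where hv: "\<And>j. j < i \<Longrightarrow> h (hv j) = j" by metis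
  define u where "u = (\<Sum>j<i. var (hv j) * w j)"
  have "p = \<Psi> u"
    by (simp add: a u_def ring_map_sum[OF ring_map_\<Psi>] ring_mapD[OF ring_map_\<Psi>] \<Psi>_var hv w(2) mult.commute)
  moreover have "u \<in> \<Omega>" unfolding u_def using w(1) by (intro \<Omega>_sum \<Omega>_mon_mult)
  moreover have "good i u"
    unfolding u_def
  proof (rule good_sum)
    fix j assume "j \<in> {..<i}"
    then show "good i (var (hv j) * w j)"
      unfolding good_def
      by (intro ballI exI[of _ "hv j"])
        (auto simp: hv in_keys_iff lookup_mon_mult lookup_add split: if_splits)
  qed
  ultimately show ?thesis using that by blast
qed

lemma one_notin_gen_ideal: "1 \<notin> gen_ideal f i"
proof
  assume "1 \<in> gen_ideal f i"
  then obtain a where "1 = (\<Sum>j<i. a j * f j)" by (auto simp: gen_ideal_def)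
  then have "mp_eval (1 :: ('n, 'k) mpoly) (\<lambda>_. 0) = mp_eval (\<Sum>j<i. a j * f j) (\<lambda>_. 0)"
    by (rule arg_cong[of _ _ "\<lambda>p. mp_eval p (\<lambda>_. 0)"])
  also have "\<dots> = 0"
    using mp_eval_eq_0_at_0[OF homog_f] by (simp add: mp_eval_sum mp_eval_simps)
  finally show False by (simp add: mp_eval_simps)
qed

text \<open>Bijectivity of \<Psi> on \<Omega> lifts the relation to polynomials in y, with f i
  replaced by a variable. There each monomial of that variable times u is divisible by an earlier
  variable, hence so is each monomial of u.\<close>

lemma regular_if_card_le:
  assumes span: "\<And>d p. homog d p \<Longrightarrow> p \<in> complement_span f B d"
    and card: "\<And>d. card (B d) \<le> card (sqfree d :: 'n expo set)"
  shows "regular_seq f CARD('n)"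
  unfolding regular_seq_def
proof (intro conjI allI impI one_notin_gen_ideal)
  fix i p assume i: "i < CARD('n)" and p: "f i * p \<in> gen_ideal f i"
  obtain v where v: "h v = i" using ex_h[OF i] .
  obtain u where u: "u \<in> \<Omega>" "p = \<Psi> u" using \<Psi>_surj[OF span] by metis
  obtain w where w: "w \<in> \<Omega>" "good i w" "f i * p = \<Psi> w"
    using gen_ideal_imp_good[OF span p] i by (metis less_imp_le)
  have "\<Psi> (var v * u - w) = 0"
    by (simp add: ring_mapD[OF ring_map_\<Psi>] \<Psi>_var v u(2)[symmetric] w(3)[symmetric])
  moreover have "var v * u - w \<in> \<Omega>" using u(1) w(1) by (intro \<Omega>_diff \<Omega>_mon_mult)
  ultimately have eq: "var v * u = w"
    using \<Psi>_inj[OF indep_family_K_if_card_le[OF span card]] by fastforce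
  have "good i u"
    unfolding good_def
  proof
    fix \<alpha> assume "\<alpha> \<in> keys u"
    then have "single v (Suc 0) + \<alpha> \<in> keys w"
      unfolding eq[symmetric] by (auto simp: in_keys_iff lookup_mon_mult)
    then obtain v' where v': "h v' < i" "lookup (single v (Suc 0) + \<alpha>) v' \<noteq> 0"
      using w(2) by (auto simp: good_def)
    then have "v' \<noteq> v" using v by auto
    with v' show "\<exists>v. h v < i \<and> lookup \<alpha> v \<noteq> 0"
      by (auto simp: lookup_add lookup_single when_def)
  qed
  then show "p \<in> gen_ideal f i" unfolding u(2) by (rule good_imp_in_gen_ideal)
qed

text \<open>Descending induction on i, with an inner induction on the degree in the variable y of f
  i. For u = u0 + y u1 with u0 free of y, the case i + 1 gives u0 = 0; regularity then cancels f i
  from f i * \<Psi> u1, and u1 has smaller degree in y. For i = n, u is constant in y and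
  \<open>disj\<close> applies; i = 0 is injectivity on \<Omega>.\<close>

lemma \<Psi>_inj_mod_ideal:
  assumes reg: "regular_seq f CARD('n)"
    and disj: "\<And>p. p \<in> U \<Longrightarrow> p \<in> gen_ideal f CARD('n) \<Longrightarrow> p = 0"
    and "i \<le> CARD('n)" "u \<in> \<Omega>" "\<And>\<alpha> v. \<alpha> \<in> keys u \<Longrightarrow> h v < i \<Longrightarrow> lookup \<alpha> v = 0"
    and "\<Psi> u \<in> gen_ideal f i"
  shows "u = 0"
  using assms(3-)
proof (induction arbitrary: u rule: inc_induct)
  case base
  have "\<alpha> = 0" if "\<alpha> \<in> keys u" for \<alpha>
    by (rule poly_mapping_eqI) (use base(2)[OF that] in simp)
  then have u: "u = single 0 (lookup u 0)"
    by (intro poly_mapping_eqI[of u]) (auto simp: lookup_single when_def in_keys_iff)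
  then have "\<Psi> u = lookup u 0" using \<Psi>_single[of 0 "lookup u 0"] by simp
  then have "lookup u 0 = 0"
    using disj base(1,3) by (simp add: \<Omega>_def)
  then show ?case using u by simp
next
  case (step k)
  obtain v where v: "h v = k" using ex_h[of k] step.hyps(2) by metis
  have "u = 0" if "u \<in> \<Omega>" "\<And>\<alpha> v. \<alpha> \<in> keys u \<Longrightarrow> h v < k \<Longrightarrow> lookup \<alpha> v = 0"
    "\<Psi> u \<in> gen_ideal f k" "\<And>\<alpha>. \<alpha> \<in> keys u \<Longrightarrow> lookup \<alpha> v < D" for u D
    using that
  proof (induction D arbitrary: u)
    case 0
    then show ?case by (metis keys_eq_empty equals0I less_nat_zero_code)
  next
    case (Suc D)
    let ?e = "single v (Suc 0)"
    have inj: "inj (\<lambda>\<alpha>. \<alpha> + ?e)" by (simp add: inj_on_def)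
    define u1 where "u1 = Poly_Mapping.map_key (\<lambda>\<alpha>. \<alpha> + ?e) u"
    define u0 where "u0 = u - var v * u1"
    have lookup_u1: "lookup u1 \<alpha> = lookup u (\<alpha> + ?e)" for \<alpha>
      by (simp add: u1_def map_key.rep_eq[OF inj])
    have lookup_u0: "lookup u0 \<alpha> = (if lookup \<alpha> v = 0 then lookup u \<alpha> else 0)" for \<alpha>
    proof (cases "lookup \<alpha> v = 0")
      case True
      then have "\<nexists>\<beta>. \<alpha> = ?e + \<beta>" by (auto simp: lookup_add)
      with True show ?thesis by (simp add: u0_def lookup_minus lookup_mon_mult)
    next
      case False
      then obtain \<beta> where "\<alpha> = \<beta> + ?e" using mon_split_var[of "Suc 0" \<alpha> v] by auto
      with False show ?thesis
        by (auto simp: u0_def lookup_minus lookup_mon_mult lookup_u1 add.commute)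
    qed
    have \<Omega>1: "u1 \<in> \<Omega>" using Suc.prems(1) by (simp add: \<Omega>_def lookup_u1)
    have \<Omega>0: "u0 \<in> \<Omega>" using Suc.prems(1) by (simp add: \<Omega>_def lookup_u0 U_0)
    have \<Psi>_u: "\<Psi> u = \<Psi> u0 + f k * \<Psi> u1"
      by (simp add: u0_def ring_mapD[OF ring_map_\<Psi>] \<Psi>_var v)
    have "u0 = 0"
    proof (rule step.IH[OF \<Omega>0])
      show "lookup \<alpha> v' = 0" if "\<alpha> \<in> keys u0" "h v' < Suc k" for \<alpha> v'
      proof (cases "h v' < k")
        case True
        have "\<alpha> \<in> keys u" using that(1) by (auto simp: in_keys_iff lookup_u0 split: if_splits)
        then show ?thesis using Suc.prems(2) True by blast
      next
        case False
        then have "h v' = h v" using that(2) v by simp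
        then have "v' = v" by simp
        then show ?thesis using that(1) by (auto simp: in_keys_iff lookup_u0 split: if_splits)
      qed
      have "\<Psi> u - \<Psi> u1 * f k \<in> gen_ideal f (Suc k)"
        using Suc.prems(3) gen_ideal_mono[of k "Suc k" f]
        by (intro ideal_setD(6)[OF gen_ideal_ideal] ideal_setD(3)[OF gen_ideal_ideal] gen_in_gen_ideal) auto
      then show "\<Psi> u0 \<in> gen_ideal f (Suc k)" by (simp add: \<Psi>_u mult.commute)
    qed
    then have "f k * \<Psi> u1 \<in> gen_ideal f k"
      using Suc.prems(3) \<Psi>_u by (simp add: ring_mapD[OF ring_map_\<Psi>])
    then have "\<Psi> u1 \<in> gen_ideal f k"
      using reg step.hyps(2) unfolding regular_seq_def by blast
    moreover have "lookup \<alpha> v' = 0" if "\<alpha> \<in> keys u1" "h v' < k" for \<alpha> v'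
    proof -
      have "\<alpha> + ?e \<in> keys u" using that(1) by (simp add: in_keys_iff lookup_u1)
      then have "lookup (\<alpha> + ?e) v' = 0" using Suc.prems(2) that(2) by blast
      then show ?thesis by (simp add: lookup_add)
    qed
    moreover have "lookup \<alpha> v < D" if "\<alpha> \<in> keys u1" for \<alpha>
    proof -
      have "\<alpha> + ?e \<in> keys u" using that(1) by (simp add: in_keys_iff lookup_u1)
      then show ?thesis using Suc.prems(4)[of "\<alpha> + ?e"] by (simp add: lookup_add)
    qed
    ultimately have "u1 = 0" using Suc.IH[OF \<Omega>1] by blast
    then show ?case using \<open>u0 = 0\<close> by (simp add: u0_def)
  qed
  moreover obtain D where "\<And>\<alpha>. \<alpha> \<in> keys u \<Longrightarrow> mon_deg \<alpha> \<le> D"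
    using ex_mon_deg_bound by metis
  then have "lookup \<alpha> v < Suc D" if "\<alpha> \<in> keys u" for \<alpha>
    using lookup_le_mon_deg[of \<alpha> v] that by (metis le_imp_less_Suc le_trans)
  ultimately show ?case using step.prems by blast
qed

text \<open>A relation is collected, for each \<alpha>, into one coefficient in U. These vanish by
  \<open>\<Psi>_inj_mod_ideal\<close> at i = 0, and independence of the B d finishes.\<close>

lemma indep_family_K_if_regular:
  assumes reg: "regular_seq f CARD('n)"
    and disj: "\<And>p. p \<in> U \<Longrightarrow> p \<in> gen_ideal f CARD('n) \<Longrightarrow> p = 0"
    and indep: "\<And>d. mp.independent (B d)"
  shows "indep_mp (K d) kterm"
  unfolding indep_family_def
proof (intro allI impI ballI)
  fix c k assume sum: "(\<Sum>k\<in>K d. const_mp (c k) * (case k of (\<alpha>, b) \<Rightarrow> b * fpow \<alpha>)) = 0" and k: "k \<in> K d"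
  obtain \<alpha> b where \<alpha>b: "k = (\<alpha>, b)" "\<alpha> \<in> half_le d" "b \<in> B (d - 2 * mon_deg \<alpha>)"
    using k by (auto simp: K_def)
  define w where "w \<beta> = (\<Sum>b\<in>B (d - 2 * mon_deg \<beta>). const_mp (c (\<beta>, b)) * b)" for \<beta>
  define u where "u = (\<Sum>\<beta>\<in>half_le d. single \<beta> (w \<beta>))"
  have w_U: "w \<beta> \<in> U" for \<beta>
    unfolding w_def by (intro mp.subspace_sum[OF subspace_U] U_scale B_subset_U)
  have "\<Psi> u = (\<Sum>\<beta>\<in>half_le d. \<Sum>b\<in>B (d - 2 * mon_deg \<beta>). const_mp (c (\<beta>, b)) * (b * fpow \<beta>))"
    by (simp add: u_def ring_map_sum[OF ring_map_\<Psi>] \<Psi>_single w_def sum_distrib_right mult.assoc)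
  also have "\<dots> = (\<Sum>k\<in>K d. const_mp (c k) * (case k of (\<alpha>, b) \<Rightarrow> b * fpow \<alpha>))"
    unfolding K_def using finite_B by (subst sum.Sigma) (auto intro!: sum.cong)
  finally have "\<Psi> u = 0" using sum by simp
  moreover have "u \<in> \<Omega>"
    unfolding u_def by (intro \<Omega>_sum \<Omega>_single w_U)
  ultimately have "u = 0"
    by (intro \<Psi>_inj_mod_ideal[OF reg disj, of 0]) (auto intro: ideal_setD(1)[OF gen_ideal_ideal])
  have "lookup u \<alpha> = (\<Sum>\<beta>\<in>half_le d. if \<beta> = \<alpha> then w \<beta> else 0)"
    unfolding u_def lookup_sum by (rule sum.cong) (auto simp: lookup_single when_def)
  also have "\<dots> = w \<alpha>" using \<alpha>b(2) by simp
  finally have "w \<alpha> = 0" using \<open>u = 0\<close> by simp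
  then have "(\<Sum>b\<in>B (d - 2 * mon_deg \<alpha>). const_mp (c (\<alpha>, b)) * b) = 0"
    by (simp add: w_def)
  from mp.independentD[OF indep finite_B subset_refl this \<alpha>b(3)] show "c k = 0"
    by (simp add: \<alpha>b(1))
qed

text \<open>Spanning and independence together make \<open>card (K d)\<close> the number of
  monomials of degree d. In the resulting equality of sums the terms with \<alpha> \<noteq> 0 agree
  by induction, so the terms at \<alpha> = 0 agree as well.\<close>

lemma card_B_if_regular:
  assumes span: "\<And>d p. homog d p \<Longrightarrow> p \<in> complement_span f B d"
    and reg: "regular_seq f CARD('n)"
    and disj: "\<And>p. p \<in> U \<Longrightarrow> p \<in> gen_ideal f CARD('n) \<Longrightarrow> p = 0"
    and indep: "\<And>d. mp.independent (B d)"
  shows "card (B d) = card (sqfree d :: 'n expo set)"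
proof (induction d rule: less_induct)
  case (less d)
  have "card (K d) \<le> card (mon ` mons d :: ('n, 'k) mpoly set)"
  proof (rule mp.card_indep_family_le[OF finite_K indep_family_K_if_regular[OF reg disj indep]])
    show "kterm ` K d \<subseteq> mp.span (mon ` mons d)"
    proof (rule image_subsetI)
      fix k assume "k \<in> K d"
      then obtain \<alpha> b where k: "k = (\<alpha>, b)" "2 * mon_deg \<alpha> \<le> d" "b \<in> B (d - 2 * mon_deg \<alpha>)"
        by (auto simp: K_def half_le_def)
      have "homog (d - 2 * mon_deg \<alpha> + 2 * mon_deg \<alpha>) (b * fpow \<alpha>)"
        by (intro homog_mult homog_B k homog_fpow)
      then show "(case k of (\<alpha>, b) \<Rightarrow> b * fpow \<alpha>) \<in> mp.span (mon ` mons d)"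
        using k by (auto intro: homog_in_span_mons)
    qed
  qed auto
  also have "\<dots> \<le> card (mons d :: 'n expo set)" by (rule card_image_le) simp
  finally have "card (K d) = card (mons d :: 'n expo set)"
    using card_mons_le_K[OF span, of d] by simp
  then have "(\<Sum>\<alpha>\<in>(half_le d :: 'n expo set). card (B (d - 2 * mon_deg \<alpha>)))
      = (\<Sum>\<alpha>\<in>(half_le d :: 'n expo set). card (sqfree (d - 2 * mon_deg \<alpha>) :: 'n expo set))"
    by (simp only: card_K card_mons_eq_sum_sqfree)
  moreover have "(\<Sum>\<alpha>\<in>half_le d - {0 :: 'n \<Rightarrow>\<^sub>0 nat}. card (B (d - 2 * mon_deg \<alpha>)))
      = (\<Sum>\<alpha>\<in>half_le d - {0 :: 'n \<Rightarrow>\<^sub>0 nat}. card (sqfree (d - 2 * mon_deg \<alpha>) :: 'n expo set))"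
  proof (rule sum.cong)
    fix \<alpha> :: "'n expo" assume \<alpha>: "\<alpha> \<in> half_le d - {0}"
    then have "mon_deg \<alpha> \<noteq> 0" "2 * mon_deg \<alpha> \<le> d" by (auto simp: half_le_def)
    then show "card (B (d - 2 * mon_deg \<alpha>)) = card (sqfree (d - 2 * mon_deg \<alpha>) :: 'n expo set)"
      by (intro less) linarith
  qed simp
  moreover have 0: "(0 :: 'n \<Rightarrow>\<^sub>0 nat) \<in> half_le d" by (simp add: half_le_def)
  ultimately show ?case
    using sum.remove[OF finite_half_le 0, of "\<lambda>\<alpha>. card (B (d - 2 * mon_deg \<alpha>))"]
      sum.remove[OF finite_half_le 0, of "\<lambda>\<alpha>. card (sqfree (d - 2 * mon_deg \<alpha>) :: 'n expo set)"]
    by simp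
qed

end

section \<open>Regularity as an open condition\<close>

lemma obtain_enum:
  obtains h :: "'n::finite \<Rightarrow> nat" where "bij_betw h UNIV {..<CARD('n)}"
  using ex_bij_betw_finite_nat[of "UNIV :: 'n set"] by (auto simp: atLeast0LessThan)

text \<open>If B D is empty, the ideal contains all forms of degree D and hence all forms of higher
  degree.\<close>

lemma complement_span_all_degrees:
  fixes f :: "nat \<Rightarrow> ('n::finite, 'k::field) mpoly"
  assumes low: "\<And>d p. d \<le> D \<Longrightarrow> homog d p \<Longrightarrow> p \<in> complement_span f B d"
    and "B D = {}" and p: "homog d p"
  shows "p \<in> complement_span f B d"
proof (cases "d \<le> D")
  case False
  have "mon m \<in> complement_span f B d" if m: "mon_deg m = d" for m
  proof -
    obtain m1 m2 where m12: "m = m1 + m2" "mon_deg m1 = D"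
      using mon_split[of D m] False m by auto
    have "mon m1 \<in> mp.span (quad_multiples f D)"
      using low[of D "mon m1"] assms(2) m12(2) by (simp add: homog_mon complement_span_def)
    then have "mon m2 * mon m1 \<in> mp.span (quad_multiples f d)"
    proof (induction rule: mp.span_induct_alt)
      case base
      show ?case by (simp add: mp.span_zero)
    next
      case (step c x y)
      obtain a j where x: "x = mon a * f j" "mon_deg a + 2 = D" "j < CARD('n)"
        using step(1) by (auto simp: quad_multiples_def)
      have "mon_deg m2 + D = d" using m m12 by simp
      then have "mon (m2 + a) * f j \<in> mp.span (quad_multiples f d)"
        using x by (intro mp.span_base) (auto simp: quad_multiples_def intro!: exI[of _ "m2 + a"] exI[of _ j])
      then have "const_mp c * (mon m2 * x) \<in> mp.span (quad_multiples f d)"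
        by (intro mp.span_scale) (simp add: x(1) mon_add mult.assoc)
      then show ?case
        using step(2) by (simp add: distrib_left mult.left_commute mp.span_add)
    qed
    also have "\<dots> \<subseteq> complement_span f B d"
      unfolding complement_span_def by (rule mp.span_mono) blast
    finally show ?thesis by (simp add: m12(1) mon_add mult.commute)
  qed
  then have "(\<Sum>m\<in>mons d. const_mp (lookup p m) * mon m) \<in> complement_span f B d"
    unfolding complement_span_def by (intro mp.span_sum mp.span_scale) (simp add: mons_def)
  then show ?thesis
    using mpoly_conv_mon[of "mons d" p] p by (simp add: homog_def)
qed (use low p in auto)

text \<open>B stays fixed while g varies. That B and the multiples of g span is a rank condition in
  each degree, and it yields regularity of g by \<open>regular_if_card_le\<close>.\<close>

lemma regular_seq_open_if_complement:
  fixes f :: "nat \<Rightarrow> ('n::finite, 'k::field) mpoly"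
  assumes f: "f \<in> quad_tuples TYPE(('n, 'k) mpoly)"
    and B: "\<And>d. finite (B d)" "\<And>d b. b \<in> B d \<Longrightarrow> homog d b"
      "\<And>d. card (B d) \<le> card (sqfree d :: 'n expo set)"
    and span: "\<And>d p. homog d p \<Longrightarrow> p \<in> complement_span f B d"
  shows "\<exists>G. polyfun G \<and> G f \<noteq> 0 \<and>
    (\<forall>g\<in>quad_tuples TYPE(('n, 'k) mpoly). G g \<noteq> 0 \<longrightarrow> regular_seq g CARD('n))"
proof -
  let ?X = "quad_tuples TYPE(('n, 'k) mpoly)"
  define I :: "nat \<Rightarrow> (('n, 'k) mpoly + 'n expo \<times> nat) set" where
    "I d = B d <+> (SIGMA m:{m. mon_deg m + 2 = d}. {..<CARD('n)})" for d
  define w :: "('n, 'k) mpoly + 'n expo \<times> nat \<Rightarrow> (nat \<Rightarrow> ('n, 'k) mpoly) \<Rightarrow> ('n, 'k) mpoly" where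
    "w i g = (case i of Inl b \<Rightarrow> b | Inr (m, j) \<Rightarrow> mon m * g j)" for i g
  have w_image: "mp.span ((\<lambda>i. w i g) ` I d) = complement_span g B d" for g d
  proof -
    have "(\<lambda>i. w i g) ` I d = B d \<union> quad_multiples g d"
      unfolding I_def Plus_def image_Un image_image quad_multiples_def by (force simp: w_def)
    then show ?thesis by (simp add: complement_span_def)
  qed
  have "\<exists>G. polyfun G \<and> G f \<noteq> 0 \<and> (\<forall>g\<in>?X. G g \<noteq> 0 \<longrightarrow>
      (\<forall>p. homog d p \<longrightarrow> p \<in> mp.span ((\<lambda>i. w i g) ` I d)))" for d
  proof (rule polyfun_span_open)
    have "finite {m :: 'n \<Rightarrow>\<^sub>0 nat. mon_deg m + 2 = d}"
      by (rule finite_subset[OF _ finite_mon_deg_le[of d]]) auto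
    then show "finite (I d)" unfolding I_def using B(1) by auto
    show "homog d (w i g)" if i: "i \<in> I d" and g: "g \<in> ?X" for i g
    proof (cases i)
      case (Inl b)
      then show ?thesis using i B(2) by (auto simp: I_def w_def)
    next
      case (Inr q)
      then obtain m j where "i = Inr (m, j)" "mon_deg m + 2 = d"
        using i by (auto simp: I_def)
      then show ?thesis
        using homog_mult[OF homog_mon[OF refl] quad_tuplesD[OF g], of m j] by (simp add: w_def)
    qed
    show "polyfun (\<lambda>g. lookup (w i g) m)" for i m
      by (cases i) (auto simp: w_def split: prod.split intro: polyfun_lookup_mon_mult)
    show "p \<in> mp.span ((\<lambda>i. w i f) ` I d)" if "homog d p" for p
      using span[OF that] by (simp add: w_image)
  qed (rule f)
  then have "\<forall>d. \<exists>G. polyfun G \<and> G f \<noteq> 0 \<and> (\<forall>g\<in>?X. G g \<noteq> 0 \<longrightarrow>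
      (\<forall>p. homog d p \<longrightarrow> p \<in> complement_span g B d))"
    by (simp add: w_image)
  from choice[OF this] obtain G where G: "\<forall>d. polyfun (G d) \<and> G d f \<noteq> 0 \<and> (\<forall>g\<in>?X. G d g \<noteq> 0 \<longrightarrow>
      (\<forall>p. homog d p \<longrightarrow> p \<in> complement_span g B d))"
    by (elim exE) (rule that)
  \<comment> \<open>No squarefree monomial has degree n + 1, so B is empty there and finitely many
    conditions govern all degrees.\<close>
  define D where "D = CARD('n) + 1"
  have "card (B D) = 0"
    using B(3)[of D] sqfree_empty[where 'v = 'n, of D] by (simp add: D_def)
  then have "B D = {}" using B(1) by simp
  obtain h :: "'n \<Rightarrow> nat" where h: "bij_betw h UNIV {..<CARD('n)}" by (rule obtain_enum)
  have "regular_seq g CARD('n)" if g: "g \<in> ?X" "(\<Prod>d\<le>D. G d g) \<noteq> 0" for g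
  proof -
    have low: "p \<in> complement_span g B d" if "d \<le> D" "homog d p" for d p
      using G g that by auto
    interpret quad_complement g h B
      by unfold_locales (use quad_tuplesD[OF g(1)] h B in auto)
    show ?thesis
    proof (rule regular_if_card_le)
      show "p \<in> complement_span g B d" if "homog d p" for d p
        using low \<open>B D = {}\<close> that by (rule complement_span_all_degrees[where D = D])
    qed (rule B(3))
  qed
  moreover have "polyfun (\<lambda>g. \<Prod>d\<le>D. G d g)"
    using G by (intro polyfun_prod) auto
  moreover have "(\<Prod>d\<le>D. G d f) \<noteq> 0" using G by simp
  ultimately show ?thesis by (intro exI[of _ "\<lambda>g. \<Prod>d\<le>D. G d g"]) auto
qed

text \<open>B d consists of the vectors extending a basis E d of the degree d part of the ideal to a
  basis of all forms of degree d. Then \<open>U\<close> meets the ideal only in 0, and regularity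
  determines the cardinality.\<close>

lemma regular_seq_ex_complement:
  fixes f :: "nat \<Rightarrow> ('n::finite, 'k::field) mpoly"
  assumes f: "f \<in> quad_tuples TYPE(('n, 'k) mpoly)" and reg: "regular_seq f CARD('n)"
  obtains B where "\<And>d. finite (B d)" "\<And>d b. b \<in> B d \<Longrightarrow> homog d b"
    "\<And>d. card (B d) \<le> card (sqfree d :: 'n expo set)"
    "\<And>d p. homog d p \<Longrightarrow> p \<in> complement_span f B d"
proof -
  let ?J = "gen_ideal f CARD('n)"
  have homog_f: "homog 2 (f i)" for i by (rule quad_tuplesD[OF f])
  have hcomp_ideal: "hcomp d (\<Sum>j<CARD('n). a j * f j)
      = (\<Sum>j<CARD('n). (if 2 \<le> d then hcomp (d - 2) (a j) else 0) * f j)" for a d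
    unfolding hcomp_sum by (rule sum.cong) (auto simp: hcomp_mult_homog[OF homog_f])
  define split where "split d B E \<longleftrightarrow> finite B \<and> finite E \<and> mp.independent (B \<union> E) \<and> B \<inter> E = {} \<and>
      B \<union> E \<subseteq> {p. homog d p} \<and> {p. homog d p} \<subseteq> mp.span (B \<union> E) \<and>
      E \<subseteq> ?J \<and> {p \<in> ?J. homog d p} \<subseteq> mp.span E" for d B E
  have "\<forall>d. \<exists>B E. split d B E"
  proof
    fix d
    obtain E where E: "E \<subseteq> {p \<in> ?J. homog d p}" "mp.independent E" "{p \<in> ?J. homog d p} \<subseteq> mp.span E"
      by (rule mp.maximal_independent_subset)
    obtain B' where B': "E \<subseteq> B'" "B' \<subseteq> {p. homog d p}" "mp.independent B'" "{p. homog d p} \<subseteq> mp.span B'"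
      by (rule mp.maximal_independent_subset_extend[of E "{p. homog d p}"]) (use E in auto)
    have "finite B'"
      by (rule conjunct1[OF mp.independent_span_bound[of "mon ` mons d"]])
        (use B'(2,3) in \<open>auto intro: homog_in_span_mons\<close>)
    have "B' - E \<union> E = B'" using B'(1) by blast
    then show "\<exists>B E. split d B E"
      unfolding split_def
      using E B' \<open>finite B'\<close> finite_subset[OF B'(1)]
      by (intro exI[of _ "B' - E"] exI[of _ E]) auto
  qed
  then obtain B E where "\<And>d. split d (B d) (E d)" by metis
  then have finite_BE: "finite (B d)" "finite (E d)" and indep: "mp.independent (B d \<union> E d)"
    and disj: "B d \<inter> E d = {}" and homog_BE: "B d \<union> E d \<subseteq> {p. homog d p}"
    and span: "{p. homog d p} \<subseteq> mp.span (B d \<union> E d)" and E: "E d \<subseteq> ?J"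
    and J_span: "{p \<in> ?J. homog d p} \<subseteq> mp.span (E d)" for d
    by (simp_all add: split_def)
  have trivial: "p = 0" if pB: "p \<in> mp.span (B d)" and pE: "p \<in> mp.span (E d)" for p d
  proof -
    obtain b where b: "p = (\<Sum>x\<in>B d. const_mp (b x) * x)"
      using mp.in_span_image_finite[OF finite_BE(1), of p "\<lambda>x. x"] pB by auto
    obtain e where e: "p = (\<Sum>x\<in>E d. const_mp (e x) * x)"
      using mp.in_span_image_finite[OF finite_BE(2), of p "\<lambda>x. x"] pE by auto
    define c where "c x = (if x \<in> B d then b x else - e x)" for x
    have "(\<Sum>x\<in>B d \<union> E d. const_mp (c x) * x) = (\<Sum>x\<in>B d. const_mp (c x) * x) + (\<Sum>x\<in>E d. const_mp (c x) * x)"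
      by (rule sum.union_disjoint) (use finite_BE disj in auto)
    also have "(\<Sum>x\<in>B d. const_mp (c x) * x) = p"
      unfolding b by (rule sum.cong) (auto simp: c_def)
    also have "(\<Sum>x\<in>E d. const_mp (c x) * x) = - p"
      unfolding e sum_negf[symmetric] by (rule sum.cong) (use disj in \<open>auto simp: c_def const_mp_uminus\<close>)
    finally have "(\<Sum>x\<in>B d \<union> E d. const_mp (c x) * x) = 0" by simp
    then have "c x = 0" if "x \<in> B d \<union> E d" for x
      using mp.independentD[OF indep _ subset_refl] that finite_BE by blast
    then have "b x = 0" if "x \<in> B d" for x using that by (force simp: c_def)
    then show "p = 0" by (simp add: b)
  qed
  have comp_span: "p \<in> complement_span f B d" if "homog d p" for d p
  proof -
    have "E d \<subseteq> complement_span f B d"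
    proof
      fix q assume q: "q \<in> E d"
      then have "homog d q" using homog_BE by blast
      obtain a where a: "q = (\<Sum>j<CARD('n). a j * f j)" using q E by (auto simp: gen_ideal_def)
      have "q = hcomp d q" using \<open>homog d q\<close> by (simp add: hcomp_homog)
      also have "\<dots> = (\<Sum>j<CARD('n). (if 2 \<le> d then hcomp (d - 2) (a j) else 0) * f j)"
        by (subst a) (rule hcomp_ideal)
      also have "\<dots> \<in> complement_span f B d"
        unfolding complement_span_def
      proof (rule mp.span_sum)
        fix j assume j: "j \<in> {..<CARD('n)}"
        show "(if 2 \<le> d then hcomp (d - 2) (a j) else 0) * f j \<in> mp.span (B d \<union> quad_multiples f d)"
        proof (cases "2 \<le> d")
          case True
          have "hcomp (d - 2) (a j) = (\<Sum>m\<in>mons (d - 2). const_mp (lookup (hcomp (d - 2) (a j)) m) * mon m)"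
            by (rule mpoly_conv_mon) (use homog_hcomp[of "d - 2" "a j"] in \<open>auto simp: homog_def\<close>)
          then have "hcomp (d - 2) (a j) * f j
              = (\<Sum>m\<in>mons (d - 2). const_mp (lookup (hcomp (d - 2) (a j)) m) * mon m) * f j"
            by (rule arg_cong)
          also have "\<dots> = (\<Sum>m\<in>mons (d - 2). const_mp (lookup (hcomp (d - 2) (a j)) m) * (mon m * f j))"
            by (simp only: sum_distrib_right mult.assoc)
          also have "\<dots> \<in> mp.span (B d \<union> quad_multiples f d)"
            unfolding quad_multiples_def using j True
            by (intro mp.span_sum mp.span_scale mp.span_base UnI2 CollectI exI conjI refl)
              (auto simp: mons_def)
          finally show ?thesis using True by simp
        qed (simp add: mp.span_zero)
      qed
      finally show "q \<in> complement_span f B d" .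
    qed
    moreover have "B d \<subseteq> complement_span f B d"
      unfolding complement_span_def using mp.span_superset by blast
    ultimately have "mp.span (B d \<union> E d) \<subseteq> complement_span f B d"
      unfolding complement_span_def by (intro mp.span_minimal mp.subspace_span) auto
    then show ?thesis using span that by blast
  qed
  obtain h :: "'n \<Rightarrow> nat" where h: "bij_betw h UNIV {..<CARD('n)}" by (rule obtain_enum)
  interpret quad_complement f h B
    using homog_BE by unfold_locales (use homog_f h finite_BE in auto)
  have "p = 0" if p: "p \<in> U" "p \<in> ?J" for p
  proof -
    have "hcomp d p = 0" for d
    proof (rule trivial)
      show "hcomp d p \<in> mp.span (B d)" using p(1) by (simp add: U_def)
      obtain a where a: "p = (\<Sum>j<CARD('n). a j * f j)" using p(2) by (auto simp: gen_ideal_def)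
      have "hcomp d p \<in> ?J"
        unfolding a hcomp_ideal
        by (intro ideal_set_sum[OF gen_ideal_ideal] ideal_setD(3)[OF gen_ideal_ideal] gen_in_gen_ideal) auto
      then show "hcomp d p \<in> mp.span (E d)" using J_span[of d] homog_hcomp by blast
    qed
    moreover obtain D where "\<And>m. m \<in> keys p \<Longrightarrow> mon_deg m \<le> D"
      using ex_mon_deg_bound by metis
    ultimately show "p = 0" using sum_hcomp[of p D] by simp
  qed
  moreover have "mp.independent (B d)" for d
    by (rule mp.independent_mono[OF indep]) auto
  ultimately have "card (B d) = card (sqfree d :: 'n expo set)" for d
    by (intro card_B_if_regular comp_span reg) auto
  then show ?thesis
    using that[of B] finite_BE(1) homog_B comp_span by auto
qed

lemma regular_seq_open:
  fixes f :: "nat \<Rightarrow> ('n::finite, 'k::field) mpoly"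
  assumes f: "f \<in> quad_tuples TYPE(('n, 'k) mpoly)" and reg: "regular_seq f CARD('n)"
  shows "\<exists>G. polyfun G \<and> G f \<noteq> 0 \<and>
    (\<forall>g\<in>quad_tuples TYPE(('n, 'k) mpoly). G g \<noteq> 0 \<longrightarrow> regular_seq g CARD('n))"
proof (rule regular_seq_ex_complement[OF f reg])
  fix B :: "nat \<Rightarrow> ('n, 'k) mpoly set"
  assume "\<And>d. finite (B d)" "\<And>d b. b \<in> B d \<Longrightarrow> homog d b"
    "\<And>d. card (B d) \<le> card (sqfree d :: 'n expo set)"
    "\<And>d p. homog d p \<Longrightarrow> p \<in> complement_span f B d"
  then show ?thesis by (rule regular_seq_open_if_complement[OF f])
qed

section \<open>The main result\<close>

lemma homog_kspan:
  assumes "g \<in> quad_tuples TYPE(('n::finite, 'k::field) mpoly)" "p \<in> kspan g CARD('n)"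
  shows "homog 2 p"
  using assms(2) unfolding kspan_def
  by (auto intro!: homog_sum homog_const_mult quad_tuplesD[OF assms(1)])

text \<open>Reducible nonzero elements of the span are products of linear forms, and such a product
  is nonzero exactly when both coefficient vectors are.\<close>

lemma I_set_iff:
  fixes g :: "nat \<Rightarrow> ('n::finite, 'k::field) mpoly"
  shows "g \<in> I_set TYPE(('n, 'k) mpoly) \<longleftrightarrow> g \<in> quad_tuples TYPE(('n, 'k) mpoly) \<and> regular_seq g CARD('n) \<and>
    (\<forall>x y. x \<noteq> (\<lambda>_. 0) \<longrightarrow> y \<noteq> (\<lambda>_. 0) \<longrightarrow> lin x * lin y \<notin> kspan g CARD('n))"
proof -
  have "(\<forall>p\<in>kspan g CARD('n). p \<noteq> 0 \<longrightarrow> irreducible p) \<longleftrightarrow>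
      (\<forall>x y. x \<noteq> (\<lambda>_. 0) \<longrightarrow> y \<noteq> (\<lambda>_. 0) \<longrightarrow> lin x * lin y \<notin> kspan g CARD('n))"
    if g: "g \<in> quad_tuples TYPE(('n, 'k) mpoly)"
  proof -
    have "(\<forall>p\<in>kspan g CARD('n). p \<noteq> 0 \<longrightarrow> irreducible p) \<longleftrightarrow>
        (\<forall>p\<in>kspan g CARD('n). p \<noteq> 0 \<longrightarrow> \<not> (\<exists>x y. p = lin x * lin y))"
      using irreducible_quad_form_iff homog_kspan[OF g] by blast
    also have "\<dots> \<longleftrightarrow> (\<forall>x y. lin x * lin y \<noteq> 0 \<longrightarrow> lin x * lin y \<notin> kspan g CARD('n))"
      by blast
    finally show ?thesis unfolding mpoly_mult_eq_0_iff lin_eq_0_iff by blast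
  qed
  then show ?thesis unfolding I_set_def by blast
qed

lemma I_set_locally_open:
  fixes f :: "nat \<Rightarrow> ('n::finite, 'k::field) mpoly"
  assumes alg: "alg_closed TYPE('k)" and f: "f \<in> I_set TYPE(('n, 'k) mpoly)"
  shows "\<exists>G. polyfun G \<and> G f \<noteq> 0 \<and>
    (\<forall>g\<in>quad_tuples TYPE(('n, 'k) mpoly). G g \<noteq> 0 \<longrightarrow> g \<in> I_set TYPE(('n, 'k) mpoly))"
proof -
  have f': "f \<in> quad_tuples TYPE(('n, 'k) mpoly)" "regular_seq f CARD('n)"
    "\<And>x y. x \<noteq> (\<lambda>_. 0) \<Longrightarrow> y \<noteq> (\<lambda>_. 0) \<Longrightarrow> lin x * lin y \<notin> kspan f CARD('n)"
    using f by (auto simp: I_set_iff)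
  obtain G where G: "polyfun G" "G f \<noteq> 0"
    "\<forall>g\<in>quad_tuples TYPE(('n, 'k) mpoly). G g \<noteq> 0 \<longrightarrow> regular_seq g CARD('n)"
    using regular_seq_open[OF f'(1,2)] by blast
  obtain H where H: "polyfun H" "H f \<noteq> 0" "\<forall>g. H g \<noteq> 0 \<longrightarrow>
    (\<forall>x y. x \<noteq> (\<lambda>_. 0) \<longrightarrow> y \<noteq> (\<lambda>_. 0) \<longrightarrow> lin x * lin y \<notin> kspan g CARD('n))"
    using lin_products_open[OF alg f'(1) regular_seq_imp_indep[OF f'(2)] f'(3)] by blast
  show ?thesis
    by (rule exI[of _ "\<lambda>g. G g * H g"]) (use G H in \<open>auto simp: I_set_iff intro!: polyfun_mult\<close>)
qed

text \<open>The complement is cut out by all polynomials vanishing on it: the local function at a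
  point of U is one of them and is nonzero at that point.\<close>

lemma zariski_open_if_locally_open:
  fixes U :: "(nat \<Rightarrow> ('n::finite, 'k::field) mpoly) set"
  assumes sub: "U \<subseteq> quad_tuples TYPE(('n, 'k) mpoly)"
    and loc: "\<And>f. f \<in> U \<Longrightarrow> \<exists>G. polyfun G \<and> G f \<noteq> 0 \<and>
      (\<forall>g\<in>quad_tuples TYPE(('n, 'k) mpoly). G g \<noteq> 0 \<longrightarrow> g \<in> U)"
  shows "zariski_open_A U"
  unfolding zariski_open_A_def zariski_closed_A_def
proof (intro conjI sub)
  let ?X = "quad_tuples TYPE(('n, 'k) mpoly)"
  define F where "F = {p. \<forall>g\<in>?X - U. mp_eval p (coords g) = 0}"
  have "f \<notin> U" if "\<forall>p\<in>F. mp_eval p (coords f) = 0" for f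
  proof
    assume "f \<in> U"
    then obtain G where G: "polyfun G" "G f \<noteq> 0" "\<forall>g\<in>?X. G g \<noteq> 0 \<longrightarrow> g \<in> U"
      using loc by blast
    obtain p where p: "\<And>g. G g = mp_eval p (coords g)" using polyfunE[OF G(1)] by metis
    then have "p \<in> F" using G(3) by (auto simp: F_def)
    then show False using that G(2) p by simp
  qed
  moreover have "mp_eval p (coords g) = 0" if "g \<in> ?X - U" "p \<in> F" for g p
    using that unfolding F_def by blast
  ultimately have "?X - U = {f \<in> ?X. \<forall>p\<in>F. mp_eval p (coords f) = 0}"
    by blast
  then show "\<exists>F. ?X - U = {f \<in> ?X. \<forall>p\<in>F. mp_eval p (coords f) = 0}" by blast
qed

lemma I_set_empty:
  assumes alg: "alg_closed TYPE('k::field)" and "CARD('n::finite) \<le> 4"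
  shows "I_set TYPE(('n, 'k) mpoly) = {}"
proof (rule ccontr)
  assume "I_set TYPE(('n, 'k) mpoly) \<noteq> {}"
  then obtain f where "f \<in> I_set TYPE(('n, 'k) mpoly)" by blast
  then have f: "f \<in> quad_tuples TYPE(('n, 'k) mpoly)" "regular_seq f CARD('n)"
    "\<And>x y. x \<noteq> (\<lambda>_. 0) \<Longrightarrow> y \<noteq> (\<lambda>_. 0) \<Longrightarrow> lin x * lin y \<notin> kspan f CARD('n)"
    by (auto simp: I_set_iff)
  obtain S :: "'n expo set" and \<beta> where S: "finite S"
    "card S + CARD('n) = card (mons 2 :: 'n expo set)"
    and cut: "\<And>x y. (\<And>s. s \<in> S \<Longrightarrow> bilin (\<beta> f s) x y = 0) \<Longrightarrow> lin x * lin y \<in> kspan f CARD('n)"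
    by (rule quad_tuple_annihilator[OF f(1) regular_seq_imp_indep[OF f(2)]]) auto
  have "2 * (card S + CARD('n)) \<le> CARD('n) * (CARD('n) + 1)"
    using card_mons_2[where 'v = 'n] S(2) by simp
  \<comment> \<open>The inequality wanted is quadratic in n, so the four values are treated one by
    one.\<close>
  moreover have "CARD('n) = 1 \<or> CARD('n) = 2 \<or> CARD('n) = 3 \<or> CARD('n) = 4"
    using assms(2) zero_less_card_finite[where 'a = 'n] by linarith
  ultimately have "card S + 2 \<le> 2 * CARD('n)" by auto
  then obtain x y where "x \<noteq> (\<lambda>_. 0)" "y \<noteq> (\<lambda>_. 0)" "\<forall>s\<in>S. bilin (\<beta> f s) x y = 0"
    using bilinear_common_zero[OF alg S(1), of "\<beta> f"] by blast
  then show False using f(3) cut by blast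
qed

text \<open>Over a finite field, 1 plus the product of all x - c has positive degree and no
  root.\<close>

lemma alg_closed_imp_infinite:
  assumes "alg_closed TYPE('k::field)"
  shows "infinite (UNIV :: 'k set)"
proof
  assume fin: "finite (UNIV :: 'k set)"
  define q :: "'k poly" where "q = (\<Prod>c\<in>UNIV. [:- c, 1:]) + 1"
  have q: "poly q x = 1" for x
    using fin by (auto simp: q_def poly_prod intro!: prod_zero bexI[of _ x])
  have "degree q \<noteq> 0"
  proof
    assume "degree q = 0"
    then obtain c where "q = [:c:]" by (rule degree_eq_zeroE)
    then have "q = 1" using q[of 0] by (simp add: one_pCons)
    then have "(\<Prod>c\<in>UNIV. [:- c, 1:]) = (0 :: 'k poly)" by (simp add: q_def)
    then show False using fin by simp
  qed
  then have "1 \<le> degree q" by simp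
  then show False using assms q unfolding alg_closed_def by (metis zero_neq_one)
qed

text \<open>Along the line through two tuples a polynomial function is a polynomial in one parameter,
  so over an infinite field two of them that are nonzero somewhere are nonzero at a common point.\<close>

lemma polyfun_on_line:
  assumes "polyfun G"
  obtains q where "\<And>s. G (\<lambda>j. const_mp (1 - s) * f j + const_mp s * g j) = poly q s"
proof -
  obtain p where p: "\<And>f. G f = mp_eval p (coords f)" using polyfunE[OF assms] by metis
  \<comment> \<open>The coordinates of the point at parameter s, as polynomials f + s (g - f) of
    degree at most 1 in s.\<close>
  define x where "x = (\<lambda>(i, m). [:lookup (f i) m, lookup (g i) m - lookup (f i) m:])"
  have "G (\<lambda>j. const_mp (1 - s) * f j + const_mp s * g j) = poly (ev (\<lambda>c. [:c:]) x p) s" for s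
    unfolding p poly_ev_conv_mp_eval
    by (rule arg_cong[of _ _ "mp_eval p"], rule ext)
      (auto simp: x_def coords_def lookup_add, simp add: algebra_simps)
  then show ?thesis by (rule that)
qed

lemma polyfuns_common_nonzero:
  fixes f g :: "nat \<Rightarrow> ('n, 'k::field) mpoly"
  assumes "infinite (UNIV :: 'k set)" "polyfun G" "polyfun H" "G f \<noteq> 0" "H g \<noteq> 0"
  obtains s where "G (\<lambda>j. const_mp (1 - s) * f j + const_mp s * g j) \<noteq> 0"
    "H (\<lambda>j. const_mp (1 - s) * f j + const_mp s * g j) \<noteq> 0"
proof -
  obtain q where q: "\<And>s. G (\<lambda>j. const_mp (1 - s) * f j + const_mp s * g j) = poly q s"
    using polyfun_on_line[OF assms(2)] by metis
  obtain r where r: "\<And>s. H (\<lambda>j. const_mp (1 - s) * f j + const_mp s * g j) = poly r s"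
    using polyfun_on_line[OF assms(3)] by metis
  have "poly q 0 \<noteq> 0" "poly r 1 \<noteq> 0"
    using q[of 0] r[of 1] assms(4,5) by simp_all
  then have "q * r \<noteq> 0" by auto
  then have "finite {s. poly (q * r) s = 0}" by (rule poly_roots_finite)
  then have "\<exists>s. poly (q * r) s \<noteq> 0"
    using assms(1) by (metis (mono_tags, lifting) UNIV_eq_I mem_Collect_eq)
  then show ?thesis using that q r by auto
qed

section \<open>Two explicit tuples and nonemptiness for n \<ge> 5\<close>

context
  fixes h :: "'n::finite \<Rightarrow> nat" and X :: "nat \<Rightarrow> ('n, 'k::field) mpoly"
  assumes h: "bij_betw h UNIV {..<CARD('n)}"
    and X: "\<And>v. X (h v) = var v"
begin

lemma ex_index: assumes "j < CARD('n)" obtains v where "h v = j"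
proof -
  have "j \<in> range h" using h assms by (simp add: bij_betw_def)
  then show ?thesis using that by blast
qed

lemma homog_X: "j < CARD('n) \<Longrightarrow> homog 1 (X j)"
  by (erule ex_index) (metis X homog_mon mon_deg_single One_nat_def)

text \<open>The squarefree monomials serve as complement: any other monomial is divisible by the
  square of a variable, hence is a multiple of some f j.\<close>

lemma squares_regular_open:
  defines "f \<equiv> \<lambda>j. if j < CARD('n) then X j * X j else 0"
  shows "\<exists>G. polyfun G \<and> G f \<noteq> 0 \<and>
    (\<forall>g\<in>quad_tuples TYPE(('n, 'k) mpoly). G g \<noteq> 0 \<longrightarrow> regular_seq g CARD('n))"
proof (rule regular_seq_open_if_complement)
  show "f \<in> quad_tuples TYPE(('n, 'k) mpoly)"
    using homog_mult[OF homog_X homog_X]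
    by (auto simp: quad_tuples_def quad_form_iff_homog f_def numeral_2_eq_2)
  let ?B = "\<lambda>d. mon ` (sqfree d :: 'n expo set) :: ('n, 'k) mpoly set"
  show "finite (?B d)" for d by simp
  show "homog d b" if "b \<in> ?B d" for d b
    using that by (auto intro!: homog_mon simp: sqfree_def mons_def)
  show "card (?B d) \<le> card (sqfree d :: 'n expo set)" for d
    by (rule card_image_le) simp
  show "p \<in> complement_span f ?B d" if p: "homog d p" for d p
  proof -
    have "mon m \<in> complement_span f ?B d" if m: "m \<in> mons d" for m :: "'n expo"
      unfolding complement_span_def
    proof (rule mp.span_base)
      show "mon m \<in> ?B d \<union> quad_multiples f d"
      proof (cases "m \<in> sqfree d")
        case False
        then obtain v where "\<not> lookup m v \<le> 1" using m by (auto simp: sqfree_def)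
        then have "2 \<le> lookup m v" by simp
        then obtain m' where m': "m = m' + single v 2" by (rule mon_split_var)
        have "f (h v) = mon (single v 2)"
          using h by (auto simp: f_def X bij_betw_def mon_add[symmetric] single_add[symmetric] numeral_2_eq_2)
        then have "mon m = mon m' * f (h v)" by (simp add: m' mon_add)
        moreover have "mon_deg m' + 2 = d" using m m' by (simp add: mons_def)
        moreover have "h v < CARD('n)" using h by (auto simp: bij_betw_def)
        ultimately show ?thesis unfolding quad_multiples_def by blast
      qed auto
    qed
    then have "(\<Sum>m\<in>mons d. const_mp (lookup p m) * mon m) \<in> complement_span f ?B d"
      unfolding complement_span_def by (intro mp.span_sum mp.span_scale) auto
    then show ?thesis
      using mpoly_conv_mon[of "mons d" p] p by (simp add: homog_def)
  qed
qed

text \<open>Quadrics through the rational normal curve \<open>t \<mapsto> (1, t, \<dots>, t ^ (n - 1))\<close>: a product of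
  linear forms vanishing on the curve has a factor vanishing on it, hence identically.\<close>

definition curve_quadric :: "nat \<Rightarrow> ('n, 'k) mpoly" where
  "curve_quadric j = (if j + 2 < CARD('n) then X j * X (j + 2) - X (j + 1) * X (j + 1)
    else if j + 2 = CARD('n) then X 0 * X 3 - X 1 * X 2
    else if j + 1 = CARD('n) then X 1 * X 4 - X 2 * X 3 else 0)"

lemma curve_quadric_quad_tuple:
  assumes "CARD('n) \<ge> 5"
  shows "curve_quadric \<in> quad_tuples TYPE(('n, 'k) mpoly)"
proof -
  have hom: "homog 2 (X i * X j)" if "i < CARD('n)" "j < CARD('n)" for i j
    using homog_mult[OF homog_X[OF that(1)] homog_X[OF that(2)]] by (simp add: numeral_2_eq_2)
  have "homog 2 (curve_quadric j)" for j
    unfolding curve_quadric_def using assms by (auto intro!: homog_diff hom)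
  moreover have "curve_quadric j = 0" if "CARD('n) \<le> j" for j
    using that by (simp add: curve_quadric_def)
  ultimately show ?thesis by (simp add: quad_tuples_def quad_form_iff_homog)
qed

text \<open>Each quadric has a monomial that occurs in no other, its \<open>key\<close>: the square
  of X (j + 1) for the first n - 2, then X 0 * X 3 and X 1 * X 4. The variable X 4 exists because n
  \<ge> 5.\<close>

lemma curve_quadrics_indep:
  assumes n: "CARD('n) \<ge> 5"
  shows "indep_mp {..<CARD('n)} curve_quadric"
  unfolding indep_family_def
proof (intro allI impI ballI)
  fix c :: "nat \<Rightarrow> 'k" and j
  assume sum: "(\<Sum>i<CARD('n). const_mp (c i) * curve_quadric i) = 0" and j: "j \<in> {..<CARD('n)}"
  define e where "e i = (single (inv_into UNIV h i) (Suc 0) :: 'n \<Rightarrow>\<^sub>0 nat)" for i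
  have e_eq: "e i = e i' \<longleftrightarrow> i = i'" if "i < CARD('n)" "i' < CARD('n)" for i i'
    using that h by (auto simp: e_def bij_betw_def dest: inv_into_injective)
  have e_h: "e (h v) = single v (Suc 0)" for v
    using h by (simp add: e_def bij_betw_def inv_into_f_f)
  have X_e: "X i = mon (e i)" if "i < CARD('n)" for i
    by (rule ex_index[OF that]) (auto simp: X e_h)
  have e_add_eq: "e i + e k = e i' + e k' \<longleftrightarrow> (i = i' \<and> k = k') \<or> (i = k' \<and> k = i')"
    if "i < CARD('n)" "k < CARD('n)" "i' < CARD('n)" "k' < CARD('n)" for i k i' k'
  proof
    assume eq: "e i + e k = e i' + e k'"
    have "i = i' \<or> i = k'"
    proof (rule ccontr)
      assume "\<not> (i = i' \<or> i = k')"
      then have "e i \<noteq> e i'" "e i \<noteq> e k'" using e_eq that by auto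
      then have "lookup (e i' + e k') (inv_into UNIV h i) = 0"
        by (auto simp: e_def lookup_add lookup_single when_def)
      then show False unfolding eq[symmetric] by (simp add: e_def lookup_add)
    qed
    then show "(i = i' \<and> k = k') \<or> (i = k' \<and> k = i')"
    proof
      assume "i = i'"
      then show ?thesis using eq e_eq that by simp
    next
      assume "i = k'"
      then have "e k = e i'" using eq by (metis add.commute add_left_cancel)
      then show ?thesis using \<open>i = k'\<close> e_eq that by simp
    qed
  qed (auto simp: add.commute)
  define key where "key j = (if j + 2 < CARD('n) then e (j + 1) + e (j + 1)
    else if j + 2 = CARD('n) then e 0 + e 3 else e 1 + e 4)" for j
  have lookup_XX: "lookup (X i * X k) (e i' + e k') = (if (i = i' \<and> k = k') \<or> (i = k' \<and> k = i') then 1 else 0)"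
    if "i < CARD('n)" "k < CARD('n)" "i' < CARD('n)" "k' < CARD('n)" for i k i' k'
    using e_add_eq[OF that] that by (simp add: X_e mon_add[symmetric] lookup_single when_def)
  have lookup_key: "lookup (curve_quadric i) (key j) = 0 \<longleftrightarrow> i \<noteq> j"
    if ij: "i < CARD('n)" "j < CARD('n)" for i j
  proof -
    consider "i + 2 < CARD('n)" | "i + 2 = CARD('n)" | "i + 1 = CARD('n)" using ij(1) by linarith
    then show ?thesis
    proof cases
      case 1
      then show ?thesis using ij(2) n by (auto simp: curve_quadric_def key_def lookup_minus lookup_XX)
    next
      case 2
      then show ?thesis using ij(2) n by (auto simp: curve_quadric_def key_def lookup_minus lookup_XX)
    next
      case 3
      then show ?thesis using ij(2) n by (auto simp: curve_quadric_def key_def lookup_minus lookup_XX)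
    qed
  qed
  have "0 = (\<Sum>i<CARD('n). c i * lookup (curve_quadric i) (key j))"
    using arg_cong[OF sum, of "\<lambda>p. lookup p (key j)"] by (simp add: lookup_sum)
  also have "\<dots> = (\<Sum>i<CARD('n). if i = j then c j * lookup (curve_quadric j) (key j) else 0)"
    by (rule sum.cong) (use lookup_key j in auto)
  also have "\<dots> = c j * lookup (curve_quadric j) (key j)" using j by simp
  finally show "c j = 0" using lookup_key[of j j] j by simp
qed

lemma lin_mult_lin_notin_curve_quadrics:
  assumes n: "CARD('n) \<ge> 5" and xy: "x \<noteq> (\<lambda>_. 0)" "y \<noteq> (\<lambda>_. 0)"
  shows "lin x * lin y \<notin> kspan curve_quadric CARD('n)"
proof
  assume mem: "lin x * lin y \<in> kspan curve_quadric CARD('n)"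
  \<comment> \<open>Restriction to the curve: the variable numbered i becomes t^i. As the exponents
    are distinct, a linear form can be recovered from its restriction.\<close>
  define E where "E = ev (\<lambda>c. [:c :: 'k:]) (\<lambda>v. monom 1 (h v))"
  have E: "ring_map E" unfolding E_def by (rule ring_map_ev[OF ring_map_pCons])
  have E_X: "E (X i) = monom 1 i" if "i < CARD('n)" for i
    by (rule ex_index[OF that]) (auto simp: X E_def ev_var[OF ring_map_pCons])
  have E_0: "E (curve_quadric i) = 0" for i
    using n by (auto simp: curve_quadric_def ring_mapD[OF E] E_X mult_monom numeral_eq_Suc)
  obtain c where c: "lin x * lin y = (\<Sum>j<CARD('n). const_mp (c j) * curve_quadric j)"
    using mem by (auto simp: kspan_def)
  have "E (lin x) * E (lin y) = 0"
    unfolding ring_mapD(3)[OF E, symmetric] c by (simp add: ring_map_sum[OF E] ring_mapD[OF E] E_0)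
  moreover have "x = (\<lambda>_. 0)" if "E (lin x) = 0" for x
  proof
    fix v
    have "E (const_mp c) = [:c:]" "E (var v) = monom 1 (h v)" for c v
      by (simp_all add: E_def ev_const[OF ring_map_pCons] ev_var[OF ring_map_pCons])
    then have "E (lin x) = (\<Sum>u\<in>UNIV. monom (x u) (h u))"
      by (simp add: lin_def ring_map_sum[OF E] ring_mapD[OF E] smult_monom)
    then have "coeff (E (lin x)) (h v) = (\<Sum>u\<in>UNIV. if u = v then x u else 0)"
      using h by (simp add: coeff_sum bij_betw_def inj_eq)
    then show "x v = 0" using that by simp
  qed
  ultimately show False using xy by auto
qed

text \<open>Neither tuple lies in \<open>I_set\<close> itself: squares are reducible, and the curve
  quadrics share the nontrivial zeros on the curve. Each has one of the two properties, and G and H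
  carry these to a common point of the joining line.\<close>

lemma I_set_nonempty_aux:
  assumes alg: "alg_closed TYPE('k)" and n: "CARD('n) \<ge> 5"
  shows "I_set TYPE(('n, 'k) mpoly) \<noteq> {}"
proof -
  let ?Q = "quad_tuples TYPE(('n, 'k) mpoly)"
  let ?f = "\<lambda>j. if j < CARD('n) then X j * X j else 0"
  obtain G where G: "polyfun G" "G ?f \<noteq> 0" "\<forall>g\<in>?Q. G g \<noteq> 0 \<longrightarrow> regular_seq g CARD('n)"
    using squares_regular_open by blast
  obtain H where H: "polyfun H" "H curve_quadric \<noteq> 0" "\<forall>g. H g \<noteq> 0 \<longrightarrow>
    (\<forall>x y. x \<noteq> (\<lambda>_. 0) \<longrightarrow> y \<noteq> (\<lambda>_. 0) \<longrightarrow> lin x * lin y \<notin> kspan g CARD('n))"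
    using lin_products_open[OF alg curve_quadric_quad_tuple[OF n] curve_quadrics_indep[OF n]
        lin_mult_lin_notin_curve_quadrics[OF n]] by blast
  obtain s where s: "G (\<lambda>j. const_mp (1 - s) * ?f j + const_mp s * curve_quadric j) \<noteq> 0"
    "H (\<lambda>j. const_mp (1 - s) * ?f j + const_mp s * curve_quadric j) \<noteq> 0"
    using polyfuns_common_nonzero[OF alg_closed_imp_infinite[OF alg] G(1) H(1) G(2) H(2)] .
  have f: "homog 2 (?f j)" for j
    using homog_mult[OF homog_X homog_X, of j j] by (simp add: numeral_2_eq_2)
  have "homog 2 (const_mp (1 - s) * ?f i + const_mp s * curve_quadric i)" for i
    by (intro homog_add homog_const_mult f quad_tuplesD[OF curve_quadric_quad_tuple[OF n]])
  moreover have "const_mp (1 - s) * ?f i + const_mp s * curve_quadric i = 0" if "CARD('n) \<le> i" for i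
    using that by (simp add: curve_quadric_def)
  ultimately have "(\<lambda>j. const_mp (1 - s) * ?f j + const_mp s * curve_quadric j) \<in> ?Q"
    unfolding quad_tuples_def quad_form_iff_homog by blast
  then have "(\<lambda>j. const_mp (1 - s) * ?f j + const_mp s * curve_quadric j) \<in> I_set TYPE(('n, 'k) mpoly)"
    using s G(3) H(3) by (simp add: I_set_iff)
  then show ?thesis by blast
qed

end

lemma I_set_nonempty:
  assumes alg: "alg_closed TYPE('k::field)" and n: "CARD('n::finite) \<ge> 5"
  shows "I_set TYPE(('n, 'k) mpoly) \<noteq> {}"
proof -
  obtain h :: "'n \<Rightarrow> nat" where h: "bij_betw h UNIV {..<CARD('n)}" by (rule obtain_enum)
  define X :: "nat \<Rightarrow> ('n, 'k) mpoly" where "X j = var (inv_into UNIV h j)" for j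
  have "X (h v) = var v" for v using h by (simp add: X_def bij_betw_def inv_into_f_f)
  from I_set_nonempty_aux[OF h this alg n] show ?thesis .
qed

theorem theorem5p2:
  assumes "alg_closed TYPE('k::field)"
    and "(2::'k) \<noteq> 0"
  shows "zariski_open_A (I_set TYPE(('n::finite, 'k) mpoly)) \<and>
         (CARD('n) \<le> 4 \<longrightarrow> I_set TYPE(('n, 'k) mpoly) = {}) \<and>
         (CARD('n) \<ge> 5 \<longrightarrow> I_set TYPE(('n, 'k) mpoly) \<noteq> {})"
proof (intro conjI impI)
  show "zariski_open_A (I_set TYPE(('n, 'k) mpoly))"
    by (rule zariski_open_if_locally_open[OF _ I_set_locally_open[OF assms(1)]])
      (auto simp: I_set_def)
qed (use I_set_empty I_set_nonempty assms(1) in blast)+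

end
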